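(* Fix $t>0$, $a\in[-\pi,\pi)$, $\sigma>0$, and let $z=e^{ia+\sigma}$. Define $v_t^2(\sigma):=\log\frac{1-e^{-2(\sigma+t)}}{1-e^{-2\sigma}}$, and let $\mathcal F^\sigma(t,e^{ia})$ be a complex Gaussian random variable with i.i.d. real and imaginary parts distributed according to $\mathcal N(0,v_t^2(\sigma))$. Then $$\frac1{\sqrt c}\Big(\log\frac{\Phi_{\lfloor nt\rfloor}(z)}{z}-\lfloor nt\rfloor c\Big)\longrightarrow\mathcal F^\sigma(t,e^{ia})$$ in distribution as $n\to\infty$, $c\to0$ and $nc\to1$.
   Context: Growth model. Let $\mathbb D$ be the open unit disc and $D_0=(\mathbb C\cup\{\infty\})\setminus\overline{\mathbb D}$. A particle is a nonempty connected compact set $P\subset\mathbb C\setminus\mathbb D$ having $1$ as a limit point and such that $D=(\mathbb C\cup\{\infty\})\setminus(\overline{\mathbb D}\cup P)$ is simply connected. There are a unique conformal isomorphism $F:D_0\to D$ and a unique $c>0$ (logarithmic capacity) with $F(z)=e^cz+O(1)$ as $|z|\to\infty$. Standing assumptions: $F$ extends continuously to the boundary of $D_0$, and there is $\delta>0$ with $P\subseteq\{|z-1|\le\delta\}$, $1+\delta\in P$, $P=\{\bar z:z\in P\}$. Let $(\Theta_k)_{k\ge1}$ be i.i.d. uniform on $[-\pi,\pi)$, $F_k(z)=e^{i\Theta_k}F(e^{-i\Theta_k}z)$, and $\Phi_N=F_1\circ\cdots\circ F_N$. The function $\log(\Phi_N(z)/z)$ denotes the holomorphic branch on $\{|z|>1\}$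 tending to $Nc$ as $z\to\infty$. $\mathcal N(\mu,s^2)$ is the real Gaussian law with mean $\mu$ and variance $s^2$. Limit regime: one considers a sequence of particles $P=P^{(n)}$, each of which is a nonempty connected compact subset of $\mathbb C\setminus\mathbb D$ having $1$ as a limit point, with $(\mathbb C\cup\{\infty\})\setminus(\overline{\mathbb D}\cup P^{(n)})$ simply connected, with associated map $F$ extending continuously to the boundary of $D_0$, and with $P^{(n)}\subseteq\{|z-1|\le\delta_n\}$, $1+\delta_n\in P^{(n)}$, $P^{(n)}=\{\bar z:z\in P^{(n)}\}$ for some $\delta=\delta_n>0$; the capacities satisfy $c=c_n\to0$ and $nc_n\to1$; the $n$-th model uses $P^{(n)}$. *)

theory Defs
  imports "HOL-Probability.Probability" "HOL-Library.Landau_Symbols"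
begin

text \<open>
  The domain \<open>D\<close>, the complement in the Riemann sphere of the closed unit disc and \<open>P\<close>, contains
  \<open>\<infinity>\<close> but not \<open>0\<close>. It is represented in the chart \<open>w \<mapsto> 1/w\<close> of the sphere, which is a homeomorphism
  of the sphere minus \<open>0\<close> onto the complex plane sending \<open>\<infinity>\<close> to \<open>0\<close>.
\<close>

definition exterior_in_chart :: "complex set \<Rightarrow> complex set" where
  "exterior_in_chart P = insert 0 (inverse ` (- (cball 0 1 \<union> P)))"

definition particle :: "complex set \<Rightarrow> bool" where
  "particle P \<longleftrightarrow>
     P \<noteq> {} \<and> connected P \<and> compact P \<and> P \<subseteq> - ball 0 1 \<and> 1 islimpt P \<and>
     simply_connected (exterior_in_chart P)"

definition symmetric_particle :: "complex set \<Rightarrow> bool" where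
  "symmetric_particle P \<longleftrightarrow>
     (\<exists>\<delta>::real. \<delta> > 0 \<and> P \<subseteq> cball 1 \<delta> \<and> of_real (1 + \<delta>) \<in> P) \<and> P = cnj ` P"

text \<open>
  A conformal isomorphism \<open>D\<^sub>0 \<rightarrow> D\<close> with \<open>F(z) = e\<^sup>c z + O(1)\<close> fixes \<open>\<infinity>\<close>, so it is given by its restriction
  to the finite points; conversely, the expansion makes the extension by \<open>\<infinity> \<mapsto> \<infinity>\<close> holomorphic
  at \<open>\<infinity>\<close>. The values of \<open>F\<close> on the closed unit disc are irrelevant.
\<close>

definition particle_map :: "complex set \<Rightarrow> (complex \<Rightarrow> complex) \<Rightarrow> real \<Rightarrow> bool" where
  "particle_map P F c \<longleftrightarrow>
     c > 0 \<and>
     F holomorphic_on {z. norm z > 1} \<and>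
     bij_betw F {z. norm z > 1} (- (cball 0 1 \<union> P)) \<and>
     (\<lambda>z. F z - of_real (exp c) * z) \<in> O[at_infinity](\<lambda>_. 1)"

definition extends_to_boundary :: "(complex \<Rightarrow> complex) \<Rightarrow> bool" where
  "extends_to_boundary F \<longleftrightarrow>
     (\<exists>G. continuous_on {z. norm z \<ge> 1} G \<and> (\<forall>z. norm z > 1 \<longrightarrow> G z = F z))"

definition rotated_map :: "(complex \<Rightarrow> complex) \<Rightarrow> real \<Rightarrow> complex \<Rightarrow> complex" where
  "rotated_map F \<theta> z = cis \<theta> * F (cis (- \<theta>) * z)"

primrec cluster_map :: "(complex \<Rightarrow> complex) \<Rightarrow> (nat \<Rightarrow> real) \<Rightarrow> nat \<Rightarrow> complex \<Rightarrow> complex" where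
  "cluster_map F \<theta> 0 = id"
| "cluster_map F \<theta> (Suc N) = cluster_map F \<theta> N \<circ> rotated_map F (\<theta> (Suc N))"

text \<open>
  The value at \<open>z\<close> of the holomorphic branch of \<open>log (\<Phi>(z)/z)\<close> on \<open>|z| > 1\<close> with limit \<open>l\<close> at \<open>\<infinity>\<close>.
  The description is of the value, as the branch is only determined on \<open>|z| > 1\<close>.
\<close>

definition log_ratio :: "(complex \<Rightarrow> complex) \<Rightarrow> real \<Rightarrow> complex \<Rightarrow> complex" where
  "log_ratio \<Phi> l z =
     (THE w. \<exists>L. L holomorphic_on {u. norm u > 1} \<and>
                 (\<forall>u. norm u > 1 \<longrightarrow> exp (L u) = \<Phi> u / u) \<and>
                 (L \<longlongrightarrow> of_real l) at_infinity \<and> w = L z)"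

definition limit_variance :: "real \<Rightarrow> real \<Rightarrow> real" where
  "limit_variance t \<sigma> = ln ((1 - exp (- 2 * (\<sigma> + t))) / (1 - exp (- 2 * \<sigma>)))"

text \<open>\<open>normal_density\<close> takes the standard deviation, here \<open>sqrt v\<close>.\<close>

definition complex_gaussian :: "'a measure \<Rightarrow> ('a \<Rightarrow> complex) \<Rightarrow> real \<Rightarrow> bool" where
  "complex_gaussian M Z v \<longleftrightarrow>
     prob_space.indep_var M borel (\<lambda>\<omega>. Re (Z \<omega>)) borel (\<lambda>\<omega>. Im (Z \<omega>)) \<and>
     distributed M lborel (\<lambda>\<omega>. Re (Z \<omega>)) (normal_density 0 (sqrt v)) \<and>
     distributed M lborel (\<lambda>\<omega>. Im (Z \<omega>)) (normal_density 0 (sqrt v))"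

text \<open>
  The library's \<open>weak_conv_m\<close> is confined to laws on the real line. Measurability of the \<open>X n\<close> is
  part of the claim.
\<close>

definition converges_in_distribution ::
    "'a measure \<Rightarrow> (nat \<Rightarrow> 'a \<Rightarrow> 'c::metric_space) \<Rightarrow> 'b measure \<Rightarrow> ('b \<Rightarrow> 'c) \<Rightarrow> bool" where
  "converges_in_distribution M X M' Z \<longleftrightarrow>
     (\<forall>n. X n \<in> borel_measurable M) \<and> Z \<in> borel_measurable M' \<and>
     (\<forall>f::'c \<Rightarrow> real. continuous_on UNIV f \<longrightarrow> bounded (range f) \<longrightarrow>
        (\<lambda>n. \<integral>\<omega>. f (X n \<omega>) \<partial>M) \<longlonglongrightarrow> (\<integral>\<omega>. f (Z \<omega>) \<partial>M'))"

end

theory Submission imports Defs "HOL-Complex_Analysis.Complex_Analysis" begin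

text \<open>
  In the chart \<open>w = 1/z\<close> a particle map is \<open>F(z) = z exp(l(1/z))\<close> with \<open>l\<close> holomorphic on the disc,
  \<open>l(0) = c\<close> and \<open>Re l \<ge> 0\<close> by the Schwarz lemma. As \<open>c \<rightarrow> 0\<close> one has \<open>l(w)/c \<rightarrow> (1 + w)/(1 - w)\<close> with
  an error of order \<open>\<delta>\<close>: by the Schwarz integral formula this amounts to the measures with density
  \<open>Re l\<close> concentrating at \<open>1\<close>, and \<open>\<delta> \<rightarrow> 0\<close> since the omitted value \<open>1/(1 + \<delta>)\<close> of the bounded
  function \<open>1/F(1/w)\<close> forces \<open>sinh x \<le> x exp c\<close> for \<open>x = ln (1 + \<delta>)\<close>.

  Applying the maps from the innermost outwards, \<open>log (\<Phi>(z)/z) - N c\<close> is a sum of increments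
  \<open>l(exp(i\<Theta>)/y) - c\<close> with \<open>y\<close> independent of the uniform angle \<open>\<Theta>\<close>. By the mean value property an
  increment and its square have mean zero, and its squared modulus has mean
  \<open>4 c\<^sup>2/(\<bar>y\<bar>\<^sup>2 - 1) + o(c\<^sup>2)\<close>. A second moment bound gives \<open>\<bar>y\<bar> \<approx> exp(\<sigma> + j c)\<close> at step \<open>j\<close>, so the
  characteristic functions satisfy, up to \<open>o(c)\<close> per step, the Euler scheme of
  \<open>\<phi>' = -\<bar>s\<bar>\<^sup>2 \<phi>/(exp(2(\<sigma> + t)) - 1)\<close>, which is solved by \<open>exp(-\<bar>s\<bar>\<^sup>2 v\<^sup>2/2)\<close>.
\<close>

section \<open>Circle averages\<close>

text \<open>About \<open>t / c\<close> steps are composed, so only errors of order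
  \<open>o(c)\<close> per step are harmless. The obstacle is that the mean squared increment depends
  on the random modulus of \<open>y\<close>. Freezing it at the deterministic position
  \<open>\<sigma> + j c\<close> costs, by a Lipschitz bound on the rate, \<open>c\<close> times the
  mean fluctuation of the position; the second moment bound makes this fluctuation of order
  \<open>sqrt c\<close>, so the total loss is of order \<open>sqrt c\<close> as well.

  That the square of an increment has mean zero makes its covariance isotropic, which is why only
  the modulus of \<open>s\<close> appears in the limit.

  The driving measures are not taken to the unit circle: all integrals live on circles of radius
  \<open>r < 1\<close>, and the circle itself enters through \<open>r \<rightarrow> 1\<close> and
  the continuous extension of \<open>F\<close>. The boundary values limit \<open>Re l\<close> to
  about \<open>\<delta>\<close>, but say nothing of this kind about \<open>Im l\<close>; a mean
  square identity takes the place of a pointwise bound.\<close>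

definition angle_measure :: "real measure" where
  "angle_measure = uniform_measure lborel {-pi..<pi}"

lemma prob_space_angle_measure: "prob_space angle_measure"
  unfolding angle_measure_def by (rule prob_space_uniform_measure) auto

lemma sets_angle_measure [measurable_cong, simp]: "sets angle_measure = sets borel"
  by (simp add: angle_measure_def)

lemma space_angle_measure [simp]: "space angle_measure = UNIV"
  by (simp add: angle_measure_def)

lemma integrable_angle_measure_bounded:
  fixes g :: "real \<Rightarrow> 'a::{banach, second_countable_topology}"
  assumes "g \<in> borel_measurable borel" "\<And>\<theta>. norm (g \<theta>) \<le> B"
  shows "integrable angle_measure g"
proof -
  interpret prob_space angle_measure by (rule prob_space_angle_measure)
  show ?thesis
    by (rule integrable_const_bound[where B = B]) (use assms in \<open>auto simp: measurable_cong_sets[OF sets_angle_measure refl]\<close>)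
qed

lemma norm_integral_le:
  fixes f :: "'a \<Rightarrow> 'b::{banach, second_countable_topology}"
  assumes "integrable M f" "integrable M g" "\<And>x. norm (f x) \<le> g x"
  shows "norm (\<integral>x. f x \<partial>M) \<le> (\<integral>x. g x \<partial>M)"
  using assms by (intro order_trans[OF integral_norm_bound] integral_mono) auto

lemma integral_angle_measure_eq:
  fixes g :: "real \<Rightarrow> 'a::euclidean_space"
  assumes "continuous_on UNIV g" and I: "(g has_integral I) {-pi..pi}"
  shows "(\<integral>\<theta>. g \<theta> \<partial>angle_measure) = (1 / (2 * pi)) *\<^sub>R I"
proof -
  have [measurable]: "g \<in> borel_measurable borel"
    using assms(1) by (rule borel_measurable_continuous_onI)
  have dens: "angle_measure = density lborel (\<lambda>x. ennreal (indicator {-pi..<pi} x / (2 * pi)))"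
    unfolding angle_measure_def uniform_measure_def
    by (intro arg_cong2[where f = density] ext refl)
       (auto simp: indicator_def divide_ennreal[symmetric] ennreal_mult)
  have "(\<integral>\<theta>. g \<theta> \<partial>angle_measure) = (\<integral>x. (indicator {-pi..<pi} x / (2 * pi)) *\<^sub>R g x \<partial>lborel)"
    unfolding dens by (subst integral_density) auto
  also have "\<dots> = (\<integral>x. (1 / (2 * pi)) *\<^sub>R (indicator {-pi..<pi} x *\<^sub>R g x) \<partial>lborel)"
    by (simp add: divide_simps)
  also have "\<dots> = (1 / (2 * pi)) *\<^sub>R (\<integral>x. indicator {-pi..<pi} x *\<^sub>R g x \<partial>lborel)"
    by (rule integral_scaleR_right)
  also have "(\<integral>x. indicator {-pi..<pi} x *\<^sub>R g x \<partial>lborel) = (\<integral>x. indicator {-pi..pi} x *\<^sub>R g x \<partial>lborel)"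
  proof (rule integral_cong_AE)
    \<comment> \<open>The angle lives on a half-open interval, while contour integrals produce the
      closed one; the endpoint is a null set.\<close>
    have "AE x in lborel. x \<noteq> pi" by (rule AE_lborel_singleton)
    then show "AE x in lborel. indicator {-pi..<pi} x *\<^sub>R g x = indicator {-pi..pi} x *\<^sub>R g x"
      by eventually_elim (auto simp: indicator_def)
  qed auto
  also have "\<dots> = I"
  proof -
    have "set_integrable lborel {-pi..pi} g"
      by (rule borel_integrable_atLeastAtMost') (use assms(1) in \<open>auto intro: continuous_on_subset\<close>)
    then have "(LINT x : {-pi..pi} | lborel. g x) = integral {-pi..pi} g"
      by (rule set_borel_integral_eq_integral)
    then show ?thesis using I by (simp add: set_lebesgue_integral_def integral_unique)
  qed
  finally show ?thesis .
qed

section \<open>Integral formulas over a circle traversed by the uniform angle\<close>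

lemma continuous_on_circle:
  assumes "continuous_on (ball 0 R) g" "norm w < R"
  shows "continuous_on UNIV (\<lambda>\<theta>. g (w * cis \<theta>))"
  by (rule continuous_on_compose2[OF assms(1)]) (use assms(2) in \<open>auto intro!: continuous_intros simp: norm_mult\<close>)

lemma borel_measurable_circle [measurable (raw)]:
  assumes "continuous_on (ball 0 R) g" "norm w < R"
  shows "(\<lambda>\<theta>. g (w * cis \<theta>)) \<in> borel_measurable borel"
  by (rule borel_measurable_continuous_onI) (rule continuous_on_circle[OF assms])

lemma integrable_circle:
  fixes h :: "complex \<Rightarrow> 'a::{banach, second_countable_topology}"
  assumes "continuous_on (ball 0 R) h" "norm w < R"
  shows "integrable angle_measure (\<lambda>\<theta>. h (w * cis \<theta>))"
proof -
  have "compact (h ` sphere 0 (norm w))"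
    by (intro compact_continuous_image continuous_on_subset[OF assms(1)]) (use assms(2) in auto)
  then obtain B where B: "\<And>x. x \<in> sphere 0 (norm w) \<Longrightarrow> norm (h x) \<le> B"
    using compact_imp_bounded bounded_iff by (metis imageI)
  show ?thesis
    by (rule integrable_angle_measure_bounded[where B = B])
       (use assms B in \<open>auto simp: norm_mult intro: borel_measurable_circle\<close>)
qed

text \<open>Cauchy's formula is applied to \<open>u \<mapsto> g (w * u)\<close> on the unit circle,
  which absorbs the phase of \<open>w\<close> and covers \<open>w = 0\<close>. The arc from
  \<open>-pi\<close> to \<open>pi\<close> is used as the contour because its parameter interval is
  that of the angle.\<close>

lemma mean_value_circle:
  assumes g: "g holomorphic_on ball 0 R" and w: "norm w < R"
  shows "(\<integral>\<theta>. g (w * cis \<theta>) \<partial>angle_measure) = g 0"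
proof -
  define S where "S = {u. norm (w * u) < R}"
  define \<gamma> where "\<gamma> = part_circlepath 0 1 (-pi) pi"
  have Svim: "S = (\<lambda>u. w * u) -` ball 0 R" by (auto simp: S_def)
  have S: "convex S" "open S"
    unfolding Svim by (intro convex_linear_vimage bounded_linear.linear[OF bounded_linear_mult_right] convex_ball,
        intro open_vimage open_ball continuous_intros)
  have hol: "(\<lambda>u. g (w * u)) holomorphic_on S"
    by (rule holomorphic_on_compose_gen[of "\<lambda>u. w * u" S g "ball 0 R", unfolded o_def])
       (use g in \<open>auto simp: S_def intro!: holomorphic_intros\<close>)
  have valid: "valid_path \<gamma>" and closed: "pathfinish \<gamma> = pathstart \<gamma>"
    by (simp_all add: \<gamma>_def exp_minus)
  have "path_image \<gamma> \<subseteq> sphere 0 1"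
    unfolding \<gamma>_def by (rule path_image_part_circlepath_subset) auto
  then have path: "path_image \<gamma> \<subseteq> S - {0}" "0 \<notin> path_image \<gamma>"
    using w by (auto simp: S_def norm_mult)
  have "((\<lambda>u. 1 / (u - 0)) has_contour_integral (2 * pi * \<i>)) \<gamma>"
    unfolding \<gamma>_def by (subst has_contour_integral_part_circlepath_iff)
     (use has_integral_const_real[of \<i> "-pi" pi] in \<open>auto simp: scaleR_conv_of_real algebra_simps\<close>)
  then have "winding_number \<gamma> 0 = 1"
    using winding_number_valid_path[OF valid path(2)] by (simp add: contour_integral_unique)
  moreover have "((\<lambda>u. g (w * u) / (u - 0)) has_contour_integral (2 * pi * \<i> * winding_number \<gamma> 0 * g (w * 0))) \<gamma>"
    by (rule Cauchy_integral_formula_convex_simple[OF S(1) hol _ valid path(1) closed])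
       (use S w in \<open>auto simp: interior_open S_def intro: le_less_trans[OF norm_ge_zero]\<close>)
  ultimately have "((\<lambda>u. g (w * u) / u) has_contour_integral (2 * pi * \<i> * g 0)) \<gamma>" by simp
  then have "((\<lambda>\<theta>. \<i> * g (w * cis \<theta>)) has_integral (2 * pi * \<i> * g 0)) {-pi..pi}"
    unfolding \<gamma>_def by (subst (asm) has_contour_integral_part_circlepath_iff) (auto simp: algebra_simps)
  from has_integral_mult_right[OF this, of "-\<i>"]
  have "((\<lambda>\<theta>. g (w * cis \<theta>)) has_integral (2 * pi * g 0)) {-pi..pi}"
    by (simp only: mult.assoc[symmetric] minus_mult_left[symmetric] i_squared) (simp add: mult.commute mult.left_commute)
  from integral_angle_measure_eq[OF continuous_on_circle[OF holomorphic_on_imp_continuous_on[OF g] w] this]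
  show ?thesis by (simp add: scaleR_conv_of_real)
qed

text \<open>On the circle \<open>u * cnj u = (norm w)\<^sup>2\<close>, so the Cauchy kernel there is
  the conjugate of a function holomorphic beyond the circle. Conjugated terms can thus be averaged
  by the mean value property.\<close>

lemma reflected_kernel:
  assumes v: "norm v < norm w" and wR: "norm w < R"
  obtains k R' where "norm w < R'" "R' \<le> R" "k holomorphic_on ball 0 R'" "k 0 = 1"
    "\<And>\<theta>. cnj (k (w * cis \<theta>)) = (w * cis \<theta>) / (w * cis \<theta> - v)"
proof -
  have w0: "w \<noteq> 0" using assms by auto
  define k where "k u = of_real (norm w ^ 2) / (of_real (norm w ^ 2) - cnj v * u)" for u
  \<comment> \<open>The pole of \<open>k\<close> is the reflection of \<open>v\<close> in the
    circle, at modulus \<open>norm w ^ 2 / norm v > norm w\<close>; for \<open>v = 0\<close> there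
    is none.\<close>
  define R' where "R' = (if v = 0 then R else min R (norm w ^ 2 / norm v))"
  have R': "norm w < R'" "R' \<le> R"
    using assms w0 by (auto simp: R'_def field_simps power2_eq_square)
  have ne: "of_real (norm w ^ 2) - cnj v * u \<noteq> 0" if "norm u < R'" for u
  proof
    assume "of_real (norm w ^ 2) - cnj v * u = 0"
    then have "norm (cnj v * u) = norm (complex_of_real (norm w ^ 2))" by simp
    then have "norm v * norm u = norm w ^ 2" by (simp add: norm_mult norm_power)
    with that w0 show False by (auto simp: R'_def field_simps split: if_splits)
  qed
  have "k holomorphic_on ball 0 R'"
    unfolding k_def using ne by (intro holomorphic_intros) auto
  moreover have "k 0 = 1" using w0 by (simp add: k_def)
  moreover have "cnj (k (w * cis \<theta>)) = (w * cis \<theta>) / (w * cis \<theta> - v)" for \<theta>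
  proof -
    define u where "u = w * cis \<theta>"
    have u: "norm u = norm w" "u \<noteq> 0" using w0 by (auto simp: u_def norm_mult)
    have "u \<noteq> v" using u assms by auto
    have nn: "of_real (norm w ^ 2) = u * cnj u" using u by (metis complex_norm_square)
    have "cnj (k u) = (u * cnj u) / (u * cnj u - v * cnj u)"
      unfolding k_def nn by (simp add: mult.commute)
    also have "\<dots> = u / (u - v)" using u \<open>u \<noteq> v\<close> by (simp add: left_diff_distrib[symmetric])
    finally show ?thesis by (simp add: u_def)
  qed
  ultimately show ?thesis using R' that by blast
qed

lemma cauchy_kernel_mean:
  assumes "norm v < norm w"
  shows "(\<integral>\<theta>. (w * cis \<theta>) / (w * cis \<theta> - v) \<partial>angle_measure) = 1"
proof -
  obtain k R where k: "norm w < R" "k holomorphic_on ball 0 R" "k 0 = 1"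
    "\<And>\<theta>. cnj (k (w * cis \<theta>)) = (w * cis \<theta>) / (w * cis \<theta> - v)"
    using reflected_kernel[OF assms, of "norm w + 1"] by (metis less_add_one)
  have "(\<integral>\<theta>. cnj (k (w * cis \<theta>)) \<partial>angle_measure) = cnj (k 0)"
    using mean_value_circle[OF k(2,1)] by (simp only: Bochner_Integration.integral_cnj)
  then show ?thesis using k by simp
qed

text \<open>Subtracting \<open>g v\<close> splits the integrand into \<open>u * G u\<close>, which
  is holomorphic and zero at the origin once the singularity of the difference quotient
  \<open>G\<close> is removed, and \<open>g v\<close> times the kernel, whose mean is 1.\<close>

lemma cauchy_formula_circle:
  assumes g: "g holomorphic_on ball 0 R" and w: "norm w < R" and v: "norm v < norm w"
  shows "(\<integral>\<theta>. g (w * cis \<theta>) * ((w * cis \<theta>) / (w * cis \<theta> - v)) \<partial>angle_measure) = g v"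
proof -
  define G where "G u = (if u = v then deriv g v else (g u - g v) / (u - v))" for u
  have "G holomorphic_on ball 0 R"
    unfolding G_def by (rule pole_lemma_open[OF g]) simp
  then have hol: "(\<lambda>u. u * G u) holomorphic_on ball 0 R" by (intro holomorphic_intros)
  have ne: "w * cis \<theta> \<noteq> v" for \<theta> using v by (auto simp: norm_mult)
  have "g (w * cis \<theta>) * ((w * cis \<theta>) / (w * cis \<theta> - v)) =
      (w * cis \<theta>) * G (w * cis \<theta>) + g v * ((w * cis \<theta>) / (w * cis \<theta> - v))" for \<theta>
  proof -
    have "a * (u / d) = u * ((a - b) / d) + b * (u / d)" for a b d u :: complex
      by (cases "d = 0") (auto simp: field_simps)
    then show ?thesis using ne[of \<theta>] by (simp only: G_def if_False)
  qed
  moreover have "integrable angle_measure (\<lambda>\<theta>. (w * cis \<theta>) * G (w * cis \<theta>))"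
    by (rule integrable_circle[OF holomorphic_on_imp_continuous_on[OF hol] w])
  moreover have "integrable angle_measure (\<lambda>\<theta>. (w * cis \<theta>) / (w * cis \<theta> - v))"
  proof (rule integrable_angle_measure_bounded)
    show "(\<lambda>\<theta>. (w * cis \<theta>) / (w * cis \<theta> - v)) \<in> borel_measurable borel"
      by (intro borel_measurable_continuous_onI continuous_intros) (use ne in auto)
    fix \<theta>
    have "norm w - norm v \<le> norm (w * cis \<theta> - v)"
      using norm_triangle_ineq2[of "w * cis \<theta>" v] by (simp add: norm_mult)
    then show "norm ((w * cis \<theta>) / (w * cis \<theta> - v)) \<le> norm w / (norm w - norm v)"
      using v by (simp add: norm_divide norm_mult frac_le)
  qed
  ultimately show ?thesis
    using mean_value_circle[OF hol w] cauchy_kernel_mean[OF v]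
    by (simp only: Bochner_Integration.integral_add integrable_mult_right integral_mult_right_zero) simp
qed

text \<open>With \<open>2 * Re g = g + cnj g\<close>, the first summand is Cauchy's formula. In the
  second the kernel is itself a conjugate, so the product is the conjugate of \<open>g * k\<close>
  and averages to \<open>cnj (g 0)\<close>.\<close>

lemma schwarz_formula_circle:
  assumes g: "g holomorphic_on ball 0 R" and w: "norm w < R" and v: "norm v < norm w"
  shows "(\<integral>\<theta>. of_real (2 * Re (g (w * cis \<theta>))) * ((w * cis \<theta>) / (w * cis \<theta> - v)) \<partial>angle_measure) = g v + cnj (g 0)"
proof -
  obtain k R' where k: "norm w < R'" "R' \<le> R" "k holomorphic_on ball 0 R'" "k 0 = 1"
    "\<And>\<theta>. cnj (k (w * cis \<theta>)) = (w * cis \<theta>) / (w * cis \<theta> - v)"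
    using reflected_kernel[OF v w] by metis
  have hol: "(\<lambda>u. g u * k u) holomorphic_on ball 0 R'"
    using g k by (intro holomorphic_intros) (auto elim: holomorphic_on_subset)
  have cg: "continuous_on (ball 0 R') g"
    using holomorphic_on_imp_continuous_on[OF g] by (rule continuous_on_subset) (use k in auto)
  have ck: "continuous_on (ball 0 R') k" by (rule holomorphic_on_imp_continuous_on[OF k(3)])
  have "of_real (2 * Re (g (w * cis \<theta>))) * ((w * cis \<theta>) / (w * cis \<theta> - v)) =
     g (w * cis \<theta>) * ((w * cis \<theta>) / (w * cis \<theta> - v)) + cnj (g (w * cis \<theta>) * k (w * cis \<theta>))" for \<theta>
  proof -
    have "complex_of_real (2 * Re (g (w * cis \<theta>))) = g (w * cis \<theta>) + cnj (g (w * cis \<theta>))"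
      by (simp add: complex_add_cnj)
    then show ?thesis by (simp only: complex_cnj_mult k(5) distrib_right)
  qed
  moreover have "integrable angle_measure (\<lambda>\<theta>. cnj (g (w * cis \<theta>) * k (w * cis \<theta>)))"
    by (rule integrable_circle[of R' "\<lambda>u. cnj (g u * k u)"]) (intro continuous_intros cg ck k)+
  moreover have "integrable angle_measure (\<lambda>\<theta>. g (w * cis \<theta>) * ((w * cis \<theta>) / (w * cis \<theta> - v)))"
    unfolding k(5)[symmetric]
    by (rule integrable_circle[of R' "\<lambda>u. g u * cnj (k u)"]) (intro continuous_intros cg ck k)+
  moreover have "(\<integral>\<theta>. cnj (g (w * cis \<theta>) * k (w * cis \<theta>)) \<partial>angle_measure) = cnj (g 0)"
    using mean_value_circle[OF hol k(1)] k(4) by (simp only: Bochner_Integration.integral_cnj mult_1_right)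
  ultimately show ?thesis
    using cauchy_formula_circle[OF g w v] by (simp only: Bochner_Integration.integral_add)
qed

text \<open>Parseval for the geometric series, obtained from Cauchy's formula: on the circle the
  squared modulus equals \<open>q / (1 - u)\<close> times the Cauchy kernel at the interior point
  \<open>q = (norm w)\<^sup>2\<close>.\<close>

lemma mean_norm_square_geometric:
  assumes "norm w < 1"
  shows "(\<integral>\<theta>. (norm (w * cis \<theta> / (1 - w * cis \<theta>)))\<^sup>2 \<partial>angle_measure) = (norm w)\<^sup>2 / (1 - (norm w)\<^sup>2)"
proof (cases "w = 0")
  case False
  define q where "q = complex_of_real ((norm w)\<^sup>2)"
  have nq: "norm q < norm w" using False assms
    unfolding q_def norm_of_real by (simp add: power2_eq_square)
  have "(\<lambda>u. q / (1 - u)) holomorphic_on ball 0 1"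
    by (intro holomorphic_intros) auto
  from cauchy_formula_circle[OF this assms nq]
  have "(\<integral>\<theta>. q / (1 - w * cis \<theta>) * ((w * cis \<theta>) / (w * cis \<theta> - q)) \<partial>angle_measure) = q / (1 - q)" .
  moreover have "q / (1 - w * cis \<theta>) * ((w * cis \<theta>) / (w * cis \<theta> - q)) =
     of_real ((norm (w * cis \<theta> / (1 - w * cis \<theta>)))\<^sup>2)" for \<theta>
  proof -
    define u where "u = w * cis \<theta>"
    have u: "norm u = norm w" "u \<noteq> 0" using False by (auto simp: u_def norm_mult)
    have "norm (cnj u) < 1" using u assms by simp
    then have u1: "u \<noteq> 1" "cnj u \<noteq> 1" using u assms by force+
    have nn: "q = u * cnj u" using u by (metis complex_norm_square q_def of_real_power)
    have "of_real ((norm (u / (1 - u)))\<^sup>2) = (u / (1 - u)) * cnj (u / (1 - u))"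
      by (rule complex_norm_square)
    also have "\<dots> = (u * cnj u) / ((1 - u) * (1 - cnj u))" by simp
    also have "\<dots> = q / (1 - u) * (u / (u - q))"
    proof -
      have "u - q = u * (1 - cnj u)" by (simp add: nn algebra_simps)
      then show ?thesis using u u1 by (simp add: nn)
    qed
    finally show ?thesis by (simp add: u_def)
  qed
  ultimately have "complex_of_real (\<integral>\<theta>. (norm (w * cis \<theta> / (1 - w * cis \<theta>)))\<^sup>2 \<partial>angle_measure) = q / (1 - q)"
    by (simp only: integral_complex_of_real)
  also have "\<dots> = of_real ((norm w)\<^sup>2 / (1 - (norm w)\<^sup>2))" by (simp add: q_def)
  finally show ?thesis by (simp only: of_real_eq_iff)
qed simp

section \<open>Functions with nonnegative real part and particle maps\<close>

lemma deviation_formula: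
  assumes l: "l holomorphic_on ball 0 R" "l 0 = of_real c" and w: "norm w < R" and v: "norm v < norm w"
  shows "(\<integral>\<theta>. of_real (Re (l (w * cis \<theta>))) * (2 * v / (w * cis \<theta> - v)) \<partial>angle_measure) = l v - of_real c"
    and "(\<integral>\<theta>. Re (l (w * cis \<theta>)) \<partial>angle_measure) = c"
    and "integrable angle_measure (\<lambda>\<theta>. Re (l (w * cis \<theta>)))"
    and "integrable angle_measure (\<lambda>\<theta>. of_real (Re (l (w * cis \<theta>))) * (2 * v / (w * cis \<theta> - v)))"
proof -
  have cl: "continuous_on (ball 0 R) l" using l by (simp add: holomorphic_on_imp_continuous_on)
  have int: "integrable angle_measure (\<lambda>\<theta>. of_real (Re (l (w * cis \<theta>))) :: complex)"
    by (rule integrable_circle[of R "\<lambda>u. of_real (Re (l u))"]) (intro continuous_intros cl w)+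
  show intR: "integrable angle_measure (\<lambda>\<theta>. Re (l (w * cis \<theta>)))"
    by (rule integrable_circle[of R "\<lambda>u. Re (l u)"]) (intro continuous_intros cl w)+
  have "(\<integral>\<theta>. Re (l (w * cis \<theta>)) \<partial>angle_measure) = Re (\<integral>\<theta>. l (w * cis \<theta>) \<partial>angle_measure)"
    by (rule integral_bounded_linear[OF bounded_linear_Re integrable_circle[OF cl w]])
  then show mean: "(\<integral>\<theta>. Re (l (w * cis \<theta>)) \<partial>angle_measure) = c"
    using mean_value_circle[OF l(1) w] l(2) by simp
  have ne: "w * cis \<theta> \<noteq> v" for \<theta> using v by (auto simp: norm_mult)
  have "integrable angle_measure (\<lambda>\<theta>. of_real (2 * Re (l (w * cis \<theta>))) * ((w * cis \<theta>) / (w * cis \<theta> - v)))"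
  proof -
    obtain k R' where k: "norm w < R'" "R' \<le> R" "k holomorphic_on ball 0 R'" "k 0 = 1"
      "\<And>\<theta>. cnj (k (w * cis \<theta>)) = (w * cis \<theta>) / (w * cis \<theta> - v)"
      using reflected_kernel[OF v w] by metis
    have cl': "continuous_on (ball 0 R') l"
      using cl by (rule continuous_on_subset) (use k in auto)
    show ?thesis
      unfolding k(5)[symmetric]
      by (rule integrable_circle[of R' "\<lambda>u. of_real (2 * Re (l u)) * cnj (k u)"])
         (intro continuous_intros cl' holomorphic_on_imp_continuous_on[OF k(3)] k)+
  qed
  \<comment> \<open>Removing the constant part of the kernel,
    \<open>2 * u / (u - v) - 2 = 2 * v / (u - v)\<close>, leaves a kernel that vanishes at
    \<open>v = 0\<close>; hence deviation bounds proportional to \<open>norm v\<close>.\<close>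
  moreover have "of_real (Re (l (w * cis \<theta>))) * (2 * v / (w * cis \<theta> - v)) =
     of_real (2 * Re (l (w * cis \<theta>))) * ((w * cis \<theta>) / (w * cis \<theta> - v)) - 2 * of_real (Re (l (w * cis \<theta>)))" for \<theta>
  proof -
    have "a * (2 * b / (u - b)) = (2 * a) * (u / (u - b)) - 2 * a" if "u \<noteq> b" for a b u :: complex
      using that by (simp add: field_simps)
    then show ?thesis using ne[of \<theta>] by (simp only: of_real_mult of_real_numeral)
  qed
  ultimately show "integrable angle_measure (\<lambda>\<theta>. of_real (Re (l (w * cis \<theta>))) * (2 * v / (w * cis \<theta> - v)))"
    and "(\<integral>\<theta>. of_real (Re (l (w * cis \<theta>))) * (2 * v / (w * cis \<theta> - v)) \<partial>angle_measure) = l v - of_real c"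
    using schwarz_formula_circle[OF l(1) w v] l(2) int mean
    by (simp_all only: Bochner_Integration.integrable_diff Bochner_Integration.integral_diff integrable_mult_right integral_mult_right_zero integral_complex_of_real) simp
qed

text \<open>On each circle of radius \<open>r < 1\<close> the function \<open>Re l\<close> is a
  nonnegative density of total mass \<open>c\<close>, so the kernel may be replaced by its maximal
  modulus; then \<open>r\<close> tends to 1. The function \<open>c * (1 + w) / (1 - w)\<close>
  attains the bound at positive \<open>v\<close>.\<close>

lemma positive_real_part_deviation:
  assumes l: "l holomorphic_on ball 0 1" "l 0 = of_real c" and pos: "\<And>w. norm w < 1 \<Longrightarrow> Re (l w) \<ge> 0"
    and v: "norm v < 1"
  shows "norm (l v - of_real c) \<le> 2 * c * norm v / (1 - norm v)"
proof -
  have bound: "norm (l v - of_real c) * (r - norm v) \<le> 2 * c * norm v" if r: "norm v < r" "r < 1" for r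
  proof -
    have r0: "r > 0" using r norm_ge_zero[of v] by linarith
    define w where "w = complex_of_real r"
    have w: "norm w < 1" "norm v < norm w" using r r0 by (auto simp: w_def)
    note dev = deviation_formula[OF l w]
    have "norm (l v - of_real c) \<le> (\<integral>\<theta>. Re (l (w * cis \<theta>)) * (2 * norm v / (r - norm v)) \<partial>angle_measure)"
      unfolding dev(1)[symmetric]
    proof (rule norm_integral_le)
      show "integrable angle_measure (\<lambda>\<theta>. of_real (Re (l (w * cis \<theta>))) * (2 * v / (w * cis \<theta> - v)))"
        by (rule dev(4))
      show "integrable angle_measure (\<lambda>\<theta>. Re (l (w * cis \<theta>)) * (2 * norm v / (r - norm v)))"
        using dev(3) by simp
      fix \<theta>
      have "r - norm v \<le> norm (w * cis \<theta> - v)"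
        using norm_triangle_ineq2[of "w * cis \<theta>" v] r0 by (simp add: norm_mult w_def)
      then have "norm (2 * v / (w * cis \<theta> - v)) \<le> 2 * norm v / (r - norm v)"
        using r by (simp add: norm_divide norm_mult frac_le)
      moreover have "Re (l (w * cis \<theta>)) \<ge> 0" using w by (intro pos) (simp add: norm_mult)
      ultimately show "norm (of_real (Re (l (w * cis \<theta>))) * (2 * v / (w * cis \<theta> - v)))
          \<le> Re (l (w * cis \<theta>)) * (2 * norm v / (r - norm v))"
        unfolding norm_mult[of "of_real _"] norm_of_real by (intro mult_mono) auto
    qed
    also have "\<dots> = c * (2 * norm v / (r - norm v))" using dev(2) by simp
    finally show ?thesis using r by (simp add: field_simps)
  qed
  have "norm (l v - of_real c) * (1 - norm v) \<le> 2 * c * norm v"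
  proof (rule tendsto_upperbound)
    show "((\<lambda>r. norm (l v - of_real c) * (r - norm v)) \<longlongrightarrow> norm (l v - of_real c) * (1 - norm v)) (at_left 1)"
      by (intro tendsto_intros)
    show "\<forall>\<^sub>F r in at_left 1. norm (l v - of_real c) * (r - norm v) \<le> 2 * c * norm v"
      using eventually_at_left_real[OF v] by eventually_elim (use bound in auto)
  qed simp
  then show ?thesis using v by (simp add: field_simps)
qed

text \<open>Caratheodory's bound on the first coefficient: the deviation bound is divided by
  \<open>norm v\<close>, and \<open>v\<close> tends to 0.\<close>

lemma positive_real_part_deriv:
  assumes l: "l holomorphic_on ball 0 1" "l 0 = of_real c" and pos: "\<And>w. norm w < 1 \<Longrightarrow> Re (l w) \<ge> 0"
  shows "norm (deriv l 0) \<le> 2 * c"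
proof -
  have "(l has_field_derivative deriv l 0) (at 0)"
    using l(1) by (intro holomorphic_derivI[of l "ball 0 1"]) auto
  then have lim: "((\<lambda>v. (l v - l 0) / (v - 0)) \<longlongrightarrow> deriv l 0) (at 0)"
    by (simp only: has_field_derivative_iff)
  have lim': "((\<lambda>v::complex. 2 * c / (1 - norm v)) \<longlongrightarrow> 2 * c / (1 - norm (0::complex))) (at 0)"
    by (intro tendsto_intros) auto
  have "norm (deriv l 0) \<le> 2 * c / (1 - norm (0::complex))"
  proof (rule tendsto_le[OF _ lim' tendsto_norm[OF lim]])
    have "\<forall>\<^sub>F v in at 0. v \<in> ball 0 1 - {0::complex}"
      by (intro eventually_at_in_open) auto
    then show "\<forall>\<^sub>F v in at 0. norm ((l v - l 0) / (v - 0)) \<le> 2 * c / (1 - norm v)"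
    proof eventually_elim
      fix v :: complex assume "v \<in> ball 0 1 - {0}"
      then have v: "norm v < 1" "v \<noteq> 0" by auto
      show "norm ((l v - l 0) / (v - 0)) \<le> 2 * c / (1 - norm v)"
        using positive_real_part_deviation[OF l pos v(1)] v by (simp add: norm_divide l(2) field_simps)
    qed
  qed simp
  then show ?thesis by simp
qed

section \<open>The logarithm of a particle map in the chart at infinity\<close>

lemma holomorphic_log_disc:
  assumes g: "g holomorphic_on ball 0 R" "\<And>w. norm w < R \<Longrightarrow> g w \<noteq> 0" and R: "R > 0" and a: "g 0 = exp a"
  obtains q where "q holomorphic_on ball 0 R" "\<And>w. norm w < R \<Longrightarrow> g w = exp (q w)" "q 0 = a"
proof -
  obtain q0 where q0: "q0 holomorphic_on ball 0 R" "\<And>w. w \<in> ball 0 R \<Longrightarrow> g w = exp (q0 w)"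
    using contractible_imp_holomorphic_log[OF g(1) convex_imp_contractible] g(2) by auto
  have e: "exp (q0 0) = exp a" using q0(2)[of 0] a R by simp
  show ?thesis
  proof (rule that[of "\<lambda>w. q0 w - q0 0 + a"])
    show "(\<lambda>w. q0 w - q0 0 + a) holomorphic_on ball 0 R" by (intro holomorphic_intros q0)
    show "g w = exp (q0 w - q0 0 + a)" if "norm w < R" for w
      using q0(2)[of w] that e by (simp add: exp_add exp_diff)
  qed simp
qed

text \<open>The expansion at infinity extends \<open>w * F (1 / w)\<close> to the origin with value
  \<open>exp c\<close>. As \<open>F\<close> takes values outside the closed disc, the extended
  function has no zeros, so it has a logarithm on the disc.\<close>

lemma particle_map_log:
  assumes "particle_map P F c"
  obtains l where "l holomorphic_on ball 0 1" "l 0 = of_real c" "\<And>w. norm w < 1 \<Longrightarrow> Re (l w) \<ge> 0"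
    "\<And>z. norm z > 1 \<Longrightarrow> F z = z * exp (l (1 / z))" "\<And>w. norm w \<ge> 1 \<Longrightarrow> l w = 0"
proof -
  have c: "c > 0" and hol: "F holomorphic_on {z. norm z > 1}"
    and bij: "bij_betw F {z. norm z > 1} (- (cball 0 1 \<union> P))"
    and O: "(\<lambda>z. F z - of_real (exp c) * z) \<in> O[at_infinity](\<lambda>_. 1)"
    using assms by (auto simp: particle_map_def)
  have F1: "norm (F z) > 1" if "norm z > 1" for z
    using bij_betwE[OF bij] that by (auto simp: not_le)
  define k0 where "k0 w = w * F (1 / w)" for w
  have "((\<lambda>z. (F z - of_real (exp c) * z) / z) \<longlongrightarrow> 0) at_infinity"
  proof -
    obtain C where "\<forall>\<^sub>F z in at_infinity. norm (F z - of_real (exp c) * z) \<le> C * norm (1::complex)"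
      using landau_o.bigE[OF O] by blast
    then have 1: "\<forall>\<^sub>F z in at_infinity. norm ((F z - of_real (exp c) * z) / z) \<le> C * inverse (norm z)"
      by eventually_elim (simp add: norm_mult norm_inverse divide_inverse mult_right_mono)
    have "((\<lambda>z::complex. C * inverse (norm z)) \<longlongrightarrow> C * 0) at_infinity"
      by (intro tendsto_mult tendsto_const tendsto_inverse_0_at_top filterlim_norm_at_top)
    then show ?thesis using Lim_null_comparison[OF 1] by simp
  qed
  then have "((\<lambda>z. (F z - of_real (exp c) * z) / z + of_real (exp c)) \<longlongrightarrow> 0 + of_real (exp c)) at_infinity"
    by (intro tendsto_intros)
  moreover have "\<forall>\<^sub>F z in at_infinity. (F z - of_real (exp c) * z) / z + of_real (exp c) = F z / z"
    by (rule eventually_mono[OF eventually_not_equal_at_infinity[of 0]]) (simp add: field_simps)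
  ultimately have "((\<lambda>z. F z / z) \<longlongrightarrow> of_real (exp c)) at_infinity"
    by (simp add: filterlim_cong)
  then have "((\<lambda>w. k0 w) \<longlongrightarrow> of_real (exp c)) (at 0)"
    by (simp add: lim_at_infinity_0 o_def k0_def field_simps)
  moreover have "k0 holomorphic_on ball 0 1 - {0}"
  proof -
    have "(\<lambda>w. F (1 / w)) holomorphic_on ball 0 1 - {0}"
      by (rule holomorphic_on_compose_gen[of "\<lambda>w. 1 / w" _ F "{z. norm z > 1}", unfolded o_def])
         (auto intro!: holomorphic_intros hol simp: norm_divide)
    then show ?thesis unfolding k0_def by (intro holomorphic_intros)
  qed
  ultimately have kh: "(\<lambda>w. if w = 0 then of_real (exp c) else k0 w) holomorphic_on ball 0 1" (is "?k holomorphic_on _")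
    by (intro removable_singularity) auto
  have "?k w \<noteq> 0" if "norm w < 1" for w
    using F1[of "1 / w"] that by (auto simp: k0_def norm_divide)
  moreover have "?k 0 = exp (of_real c)" by (simp add: exp_of_real)
  ultimately obtain q where q: "q holomorphic_on ball 0 1" "\<And>w. norm w < 1 \<Longrightarrow> ?k w = exp (q w)" "q 0 = of_real c"
    using holomorphic_log_disc[OF kh] by auto
  have F_q: "F z = z * exp (q (1 / z))" if "norm z > 1" for z
  proof -
    have "z \<noteq> 0" "norm (1 / z) < 1" using that by (auto simp: norm_divide divide_less_eq)
    then show ?thesis using q(2)[of "1 / z"] by (auto simp: k0_def field_simps split: if_splits)
  qed
  \<comment> \<open>The Schwarz lemma yields the sign only after division by \<open>norm w\<close>;
    at the origin it is the sign of \<open>c\<close>.\<close>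
  have pos: "Re (q w) \<ge> 0" if w: "norm w < 1" for w
  proof (cases "w = 0")
    case True
    then show ?thesis using q c by simp
  next
    case False
    have "norm (u * exp (- q u)) < 1" if u: "norm u < 1" for u
    proof (cases "u = 0")
      case False
      have "F (1 / u) = (1 / u) * exp (q u)" using F_q[of "1 / u"] u False by (simp add: norm_divide)
      then have "u * exp (- q u) = 1 / F (1 / u)" by (simp add: exp_minus field_simps)
      then show ?thesis using F1[of "1 / u"] u False by (simp add: norm_divide divide_less_eq)
    qed simp
    then have "norm (w * exp (- q w)) \<le> norm w"
      using w by (intro Schwarz_Lemma(1)[of "\<lambda>u. u * exp (- q u)"]) (auto intro!: holomorphic_intros q)
    then show ?thesis using False by (simp add: norm_mult)
  qed
  show ?thesis
  proof (rule that[of "\<lambda>w. if norm w < 1 then q w else 0"])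
    show "(\<lambda>w. if norm w < 1 then q w else 0) holomorphic_on ball 0 1"
      using q(1) by (rule holomorphic_transform) auto
    show "F z = z * exp (if norm (1 / z) < 1 then q (1 / z) else 0)" if "norm z > 1" for z
      using F_q[OF that] that by (simp add: norm_divide divide_less_eq)
  qed (use q pos in auto)
qed

section \<open>The size of a particle in terms of its capacity\<close>

lemma sinh_ge_cubic:
  fixes x :: real
  assumes "x \<ge> 0"
  shows "x + x ^ 3 / 6 \<le> sinh x"
proof -
  let ?f = "\<lambda>n. if even n then 0 else x ^ n /\<^sub>R fact n"
  have s: "?f sums sinh x" by (rule sinh_converges)
  have "sum ?f {..<4} \<le> suminf ?f"
    by (intro sum_le_suminf sums_summable[OF s]) (use assms in auto)
  moreover have "sum ?f {..<4} = x + x ^ 3 / 6"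
  proof -
    have "{..<4} = {0, 1, 2, 3::nat}" by auto
    then show ?thesis by (simp add: fact_numeral)
  qed
  ultimately show ?thesis using sums_unique[OF s] by simp
qed

text \<open>The self-map \<open>f\<close> of the disc omits \<open>p = exp (- x)\<close>. The disc
  automorphism exchanging 0 and \<open>p\<close> turns it into a zero-free \<open>g\<close> with
  \<open>g 0 = p\<close>, whose negated logarithm has nonnegative real part and value
  \<open>x\<close> at 0. Comparing the coefficient bound \<open>2 * x\<close> with
  \<open>deriv g 0 = - exp (- c) * (1 - p\<^sup>2)\<close> gives
  \<open>exp (- c) * sinh x \<le> x\<close>.\<close>

lemma omitted_value_bound:
  assumes l: "l holomorphic_on ball 0 1" "l 0 = of_real c" and pos: "\<And>w. norm w < 1 \<Longrightarrow> Re (l w) \<ge> 0"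
    and x: "x > 0" and om: "\<And>w. norm w < 1 \<Longrightarrow> w * exp (- l w) \<noteq> of_real (exp (- x))"
  shows "x\<^sup>2 \<le> 6 * (exp c - 1)"
proof -
  define p where "p = exp (- x)"
  have p: "0 < p" "p < 1" using x by (auto simp: p_def)
  define f where "f w = w * exp (- l w)" for w
  define g where "g w = (of_real p - f w) / (1 - of_real p * f w)" for w
  have f1: "norm (f w) < 1" if w: "norm w < 1" for w
  proof -
    have "norm w * exp (- Re (l w)) \<le> norm w * 1" using pos[OF w] by (intro mult_left_mono) auto
    then show ?thesis using w by (simp add: f_def norm_mult)
  qed
  have ne: "1 - of_real p * f w \<noteq> 0" if w: "norm w < 1" for w
  proof
    assume "1 - of_real p * f w = 0"
    then have "norm (of_real p * f w) = 1" by simp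
    moreover have "p * norm (f w) < 1" using f1[OF w] p mult_strict_mono[of p 1 "norm (f w)" 1] by simp
    ultimately show False using p by (simp add: norm_mult)
  qed
  have fh: "f holomorphic_on ball 0 1" unfolding f_def by (intro holomorphic_intros l)
  have gh: "g holomorphic_on ball 0 1" unfolding g_def using ne by (intro holomorphic_intros fh) auto
  have g0: "g w \<noteq> 0" if "norm w < 1" for w
    using om[OF that] ne[OF that] by (simp add: g_def f_def p_def)
  have g1: "norm (g w) < 1" if "norm w < 1" for w
  proof -
    have "norm (Moebius_function 0 (of_real p) (f w)) < 1"
      using p f1[OF that] by (intro Moebius_function_norm_lt_1) auto
    then show ?thesis by (simp add: Moebius_function_def g_def norm_divide norm_minus_commute)
  qed
  have "g 0 = exp (- of_real x)" by (simp add: g_def f_def p_def exp_of_real[symmetric])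
  then obtain q where q: "q holomorphic_on ball 0 1" "\<And>w. norm w < 1 \<Longrightarrow> g w = exp (q w)" "q 0 = - of_real x"
    using holomorphic_log_disc[OF gh g0] by auto
  have "norm (deriv (\<lambda>w. - q w) 0) \<le> 2 * x"
  proof (rule positive_real_part_deriv)
    fix w :: complex assume "norm w < 1"
    then show "0 \<le> Re (- q w)" using g1[of w] q(2)[of w] by simp
  qed (use q in \<open>auto intro!: holomorphic_intros\<close>)
  moreover have dq: "(q has_field_derivative deriv q 0) (at 0)"
    using q(1) by (intro holomorphic_derivI[of q "ball 0 1"]) auto
  then have "deriv (\<lambda>w. - q w) 0 = - deriv q 0"
    by (intro DERIV_imp_deriv DERIV_minus)
  moreover have "deriv q 0 * of_real p = - of_real (exp (- c)) * (1 - of_real p ^ 2)"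
  proof (rule DERIV_unique[of g _ 0])
    have "((\<lambda>w. exp (q w)) has_field_derivative exp (q 0) * deriv q 0) (at 0)"
      using dq by (rule DERIV_fun_exp)
    then have "((\<lambda>w. exp (q w)) has_field_derivative deriv q 0 * of_real p) (at 0)"
      by (simp add: q(3) p_def exp_of_real[symmetric] mult.commute)
    then show "(g has_field_derivative deriv q 0 * of_real p) (at 0)"
      by (rule has_field_derivative_transform_within_open[of _ _ _ "ball 0 1"]) (use q(2) in auto)
    have dl: "(l has_field_derivative deriv l 0) (at 0)"
      using l(1) by (intro holomorphic_derivI[of l "ball 0 1"]) auto
    have "(f has_field_derivative of_real (exp (- c))) (at 0)"
    proof -
      have "((\<lambda>w. w * exp (- l w)) has_field_derivative 1 * exp (- l 0) + (exp (- l 0) * (- deriv l 0)) * 0) (at 0)"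
        by (intro DERIV_mult DERIV_ident DERIV_fun_exp DERIV_minus dl)
      then show ?thesis by (simp add: f_def[abs_def] l(2) exp_of_real[symmetric])
    qed
    then have "((\<lambda>w. (of_real p - f w) / (1 - of_real p * f w)) has_field_derivative
        ((0 - of_real (exp (- c))) * (1 - of_real p * f 0) - (of_real p - f 0) * (0 - of_real p * of_real (exp (- c))))
        / ((1 - of_real p * f 0) * (1 - of_real p * f 0))) (at 0)"
      by (intro DERIV_divide DERIV_diff DERIV_const DERIV_cmult ne) auto
    moreover have "f 0 = 0" by (simp add: f_def)
    ultimately show "(g has_field_derivative - of_real (exp (- c)) * (1 - of_real p ^ 2)) (at 0)"
      by (simp add: g_def[abs_def] algebra_simps power2_eq_square)
  qed
  then have "norm (deriv q 0 * of_real p) = norm (complex_of_real (exp (- c) * (1 - p ^ 2)))" by simp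
  then have "norm (deriv q 0) * p = exp (- c) * (1 - p ^ 2)"
    unfolding norm_of_real norm_mult using p by (simp add: abs_mult power_le_one)
  moreover have "norm (deriv q 0) * p \<le> 2 * x * p" if "norm (- deriv q 0) \<le> 2 * x"
    using that p by (intro mult_right_mono) auto
  ultimately have "exp (- c) * (1 - p ^ 2) \<le> 2 * x * p" by simp
  then have "exp (- c) * ((1 - p ^ 2) / p) \<le> 2 * x" using p by (simp add: field_simps)
  moreover have "(1 - p ^ 2) / p = 2 * sinh x"
  proof -
    have "1 / p = exp x" by (simp add: p_def exp_minus divide_inverse)
    moreover have "(1 - p ^ 2) / p = 1 / p - p" using p by (simp add: field_simps power2_eq_square)
    ultimately show ?thesis by (simp add: sinh_def p_def)
  qed
  ultimately have "exp (- c) * sinh x \<le> x" by simp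
  then have "sinh x \<le> x * exp c" by (simp add: exp_minus field_simps)
  \<comment> \<open>Once the linear term is moved to the right, the cubic term of
    \<open>sinh\<close> is what bounds \<open>x\<close>, by order \<open>sqrt c\<close> for small
    \<open>c\<close>.\<close>
  then have "x + x ^ 3 / 6 \<le> x * exp c" using sinh_ge_cubic[of x] x by simp
  then have "x * x\<^sup>2 \<le> x * (6 * (exp c - 1))" by (simp add: algebra_simps power2_eq_square power3_eq_cube)
  then show ?thesis using x by simp
qed

section \<open>Boundary values and concentration of the driving measure\<close>

lemma radial_limit_nonpos:
  fixes \<phi> :: "complex \<Rightarrow> real"
  assumes cont: "continuous_on {w. 1/2 \<le> norm w \<and> norm w \<le> 1} \<phi>"
    and nonpos: "\<And>w. norm w = 1 \<Longrightarrow> \<phi> w \<le> 0" and e: "e > 0"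
  obtains r where "1/2 \<le> r" "r < 1" "\<And>w. r < norm w \<Longrightarrow> norm w < 1 \<Longrightarrow> \<phi> w \<le> e"
proof -
  let ?K = "{w::complex. 1/2 \<le> norm w \<and> norm w \<le> 1}"
  have K: "?K = cball 0 1 - ball 0 (1/2)" by auto
  have "compact ?K" unfolding K by (intro compact_diff compact_cball open_ball)
  then have uc: "uniformly_continuous_on ?K \<phi>" by (rule compact_uniformly_continuous[OF cont])
  obtain d where d: "d > 0"
    "\<And>x y. x \<in> ?K \<Longrightarrow> y \<in> ?K \<Longrightarrow> dist y x < d \<Longrightarrow> dist (\<phi> y) (\<phi> x) < e"
    by (rule uniformly_continuous_onE[OF uc e]) (rule that, assumption, blast)
  show ?thesis
  proof (rule that[of "max (1/2) (1 - d)"])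
    fix w :: complex assume w: "max (1/2) (1 - d) < norm w" "norm w < 1"
    \<comment> \<open>The comparison point is the radial projection to the unit circle, at distance
      \<open>1 - norm w\<close>, so that uniform continuity gives one radius for all
      directions.\<close>
    define u where "u = sgn w"
    have w0: "w \<noteq> 0" using w by auto
    then have u: "norm u = 1" by (simp add: u_def norm_sgn)
    have wu: "w = of_real (norm w) * u" using w0 by (simp add: u_def sgn_eq)
    have "of_real (norm w - 1) * u = of_real (norm w) * u - u" by (simp add: left_diff_distrib)
    then have "w - u = of_real (norm w - 1) * u" by (simp only: wu[symmetric])
    then have "dist w u = 1 - norm w" using u w by (simp add: dist_norm norm_mult del: of_real_diff)
    then have "dist (\<phi> w) (\<phi> u) < e" using w u by (intro d(2)) auto
    then show "\<phi> w \<le> e" using nonpos[OF u] by (simp add: dist_real_def)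
  qed (use d in auto)
qed

text \<open>The circle goes to the boundary of the image. If \<open>G z\<close> were a value
  \<open>F z0\<close>, then by the open mapping theorem and injectivity the points
  \<open>\<zeta> n\<close>, whose images tend to \<open>G z\<close>, would finally lie near
  \<open>z0\<close>, although they tend to \<open>z\<close>.\<close>

lemma boundary_values:
  assumes map: "particle_map P F c" and P: "closed P"
    and cont: "continuous_on {z. norm z \<ge> 1} G" and ext: "\<And>z. norm z > 1 \<Longrightarrow> G z = F z"
    and z: "norm z = 1"
  shows "norm (G z) \<ge> 1" and "norm (G z) = 1 \<or> G z \<in> P"
proof -
  define E where "E = {z::complex. norm z > 1}"
  have E: "open E" unfolding E_def by (intro open_Collect_less continuous_intros)
  have hol: "F holomorphic_on E" and bij: "bij_betw F E (- (cball 0 1 \<union> P))"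
    using map by (auto simp: particle_map_def E_def)
  define \<zeta> where "\<zeta> n = of_real (1 + inverse (Suc n)) * z" for n :: nat
  have \<zeta>E: "\<zeta> n \<in> E" for n using z by (simp add: \<zeta>_def E_def norm_mult del: of_real_add of_real_inverse)
  have "(\<lambda>n. complex_of_real (1 + inverse (Suc n))) \<longlonglongrightarrow> of_real (1 + 0)"
    by (intro tendsto_of_real tendsto_add tendsto_const LIMSEQ_inverse_real_of_nat)
  then have lim: "\<zeta> \<longlonglongrightarrow> z" unfolding \<zeta>_def by (auto intro: tendsto_eq_intros)
  have "(\<lambda>n. G (\<zeta> n)) \<longlonglongrightarrow> G z"
    by (rule continuous_on_tendsto_compose[OF cont lim]) (use z \<zeta>E in \<open>auto simp: E_def intro!: always_eventually less_imp_le\<close>)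
  then have limG: "(\<lambda>n. F (\<zeta> n)) \<longlonglongrightarrow> G z" using \<zeta>E ext by (simp add: E_def)
  have F1: "norm (F (\<zeta> n)) > 1" for n
    using bij_betwE[OF bij] \<zeta>E[of n] by (auto simp: not_le)
  show G1: "norm (G z) \<ge> 1"
    by (rule tendsto_lowerbound[OF tendsto_norm[OF limG]]) (auto intro!: always_eventually less_imp_le F1)
  show "norm (G z) = 1 \<or> G z \<in> P"
  proof (rule ccontr)
    assume "\<not> ?thesis"
    then have "G z \<in> F ` E" using G1 bij_betw_imp_surj_on[OF bij] by auto
    then obtain z0 where z0: "z0 \<in> E" "G z = F z0" by auto
    \<comment> \<open>Half the gap between \<open>z0\<close> and the unit circle: the ball stays in
      the exterior, and no point of the circle is within \<open>2 * e\<close> of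
      \<open>z0\<close>.\<close>
    define e where "e = (norm z0 - 1) / 2"
    have e: "e > 0" using z0 by (simp add: e_def E_def)
    have sub: "ball z0 e \<subseteq> E"
    proof
      fix u assume "u \<in> ball z0 e"
      then have "norm (z0 - u) < e" by (simp add: dist_norm)
      moreover have "norm z0 - norm u \<le> norm (z0 - u)" by (rule norm_triangle_ineq2)
      moreover have "norm z0 = 2 * e + 1" by (simp add: e_def field_simps)
      ultimately show "u \<in> E" using e by (simp add: E_def)
    qed
    have "open (F ` ball z0 e)"
      using holomorphic_on_subset[OF hol sub] inj_on_subset[OF bij_betw_imp_inj_on[OF bij] sub]
      by (intro open_mapping_thm3) auto
    moreover have "G z \<in> F ` ball z0 e" using z0 e by auto
    ultimately have "\<forall>\<^sub>F n in sequentially. F (\<zeta> n) \<in> F ` ball z0 e"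
      by (rule topological_tendstoD[OF limG])
    moreover have "\<forall>\<^sub>F n in sequentially. dist (\<zeta> n) z < e" by (rule tendstoD[OF lim e])
    ultimately have "\<forall>\<^sub>F n in sequentially. False"
    proof eventually_elim
      fix n assume "F (\<zeta> n) \<in> F ` ball z0 e" and d: "dist (\<zeta> n) z < e"
      then obtain u where u: "u \<in> ball z0 e" "F (\<zeta> n) = F u" by auto
      then have "\<zeta> n = u" using inj_onD[OF bij_betw_imp_inj_on[OF bij]] sub \<zeta>E by blast
      then have "dist (\<zeta> n) z0 < e" using u by (simp add: dist_commute)
      then have "dist z z0 < 2 * e" using d dist_triangle3[of z z0 "\<zeta> n"] by linarith
      moreover have "norm z0 \<le> norm z + dist z z0" by (metis dist_norm norm_minus_commute norm_triangle_sub)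
      moreover have "norm z0 = 2 * e + 1" by (simp add: e_def field_simps)
      ultimately show False using z by simp
    qed
    then show False by simp
  qed
qed

text \<open>Only \<open>Re l\<close> is bounded pointwise. Since \<open>l\<^sup>2\<close> has mean
  \<open>c\<^sup>2\<close>, the mean squares of \<open>Im l\<close> and \<open>Re l\<close> differ
  by exactly \<open>c\<^sup>2\<close>. With
  \<open>Re u * norm u \<le> (Re u)\<^sup>2 + (Im u)\<^sup>2 / 2\<close> everything reduces to the
  mean of \<open>(Re l)\<^sup>2\<close>, which is at most \<open>B * c\<close>.\<close>

lemma mean_Re_mult_norm_le:
  assumes l: "l holomorphic_on ball 0 1" "l 0 = of_real c" and pos: "\<And>w. norm w < 1 \<Longrightarrow> Re (l w) \<ge> 0"
    and w: "norm w < 1" and B: "\<And>\<theta>. Re (l (w * cis \<theta>)) \<le> B"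
  shows "(\<integral>\<theta>. Re (l (w * cis \<theta>)) * norm (l (w * cis \<theta>)) \<partial>angle_measure) \<le> 3 / 2 * B * c"
proof -
  have cl: "continuous_on (ball 0 1) l" using l by (simp add: holomorphic_on_imp_continuous_on)
  have int: "integrable angle_measure (\<lambda>\<theta>. (Re (l (w * cis \<theta>)))\<^sup>2)" "integrable angle_measure (\<lambda>\<theta>. (Im (l (w * cis \<theta>)))\<^sup>2)"
    "integrable angle_measure (\<lambda>\<theta>. Re (l (w * cis \<theta>)) * norm (l (w * cis \<theta>)))"
    "integrable angle_measure (\<lambda>\<theta>. Re (l (w * cis \<theta>)))" "integrable angle_measure (\<lambda>\<theta>. (l (w * cis \<theta>))\<^sup>2)"
    by (rule integrable_circle[of 1 "\<lambda>u. (Re (l u))\<^sup>2"] integrable_circle[of 1 "\<lambda>u. (Im (l u))\<^sup>2"]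
        integrable_circle[of 1 "\<lambda>u. Re (l u) * norm (l u)"] integrable_circle[of 1 "\<lambda>u. Re (l u)"]
        integrable_circle[of 1 "\<lambda>u. (l u)\<^sup>2"], intro continuous_intros cl, rule w)+
  have "(\<integral>\<theta>. (l (w * cis \<theta>))\<^sup>2 \<partial>angle_measure) = (l 0)\<^sup>2"
    by (rule mean_value_circle[of "\<lambda>u. (l u)\<^sup>2", OF _ w]) (intro holomorphic_intros l)
  then have "(\<integral>\<theta>. Re ((l (w * cis \<theta>))\<^sup>2) \<partial>angle_measure) = c\<^sup>2"
    using integral_bounded_linear[OF bounded_linear_Re int(5)] by (simp add: l(2) power2_eq_square)
  moreover have "Re (u\<^sup>2) = (Re u)\<^sup>2 - (Im u)\<^sup>2" for u by (simp add: power2_eq_square)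
  ultimately have Im2: "(\<integral>\<theta>. (Im (l (w * cis \<theta>)))\<^sup>2 \<partial>angle_measure) = (\<integral>\<theta>. (Re (l (w * cis \<theta>)))\<^sup>2 \<partial>angle_measure) - c\<^sup>2"
    using int by simp
  have "(\<integral>\<theta>. Re (l (w * cis \<theta>)) * norm (l (w * cis \<theta>)) \<partial>angle_measure)
      \<le> (\<integral>\<theta>. (Re (l (w * cis \<theta>)))\<^sup>2 + (Im (l (w * cis \<theta>)))\<^sup>2 / 2 \<partial>angle_measure)"
  proof (intro integral_mono int Bochner_Integration.integrable_add integrable_divide)
    fix \<theta>
    have "0 \<le> (norm u - Re u)\<^sup>2 / 2" for u :: complex by simp
    moreover have "(norm u - Re u)\<^sup>2 / 2 = (Re u)\<^sup>2 + (Im u)\<^sup>2 / 2 - Re u * norm u" for u :: complex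
      by (simp add: power2_diff cmod_power2 field_simps)
    ultimately show "Re (l (w * cis \<theta>)) * norm (l (w * cis \<theta>)) \<le> (Re (l (w * cis \<theta>)))\<^sup>2 + (Im (l (w * cis \<theta>)))\<^sup>2 / 2"
      by (metis diff_ge_0_iff_ge)
  qed
  also have "\<dots> = 3 / 2 * (\<integral>\<theta>. (Re (l (w * cis \<theta>)))\<^sup>2 \<partial>angle_measure) - c\<^sup>2 / 2"
    using int Im2 by (simp add: field_simps)
  also have "\<dots> \<le> 3 / 2 * (\<integral>\<theta>. B * Re (l (w * cis \<theta>)) \<partial>angle_measure)"
  proof -
    have "(\<integral>\<theta>. (Re (l (w * cis \<theta>)))\<^sup>2 \<partial>angle_measure) \<le> (\<integral>\<theta>. B * Re (l (w * cis \<theta>)) \<partial>angle_measure)"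
    proof (intro integral_mono int integrable_mult_right)
      fix \<theta>
      have "Re (l (w * cis \<theta>)) \<ge> 0" using w by (intro pos) (simp add: norm_mult)
      then show "(Re (l (w * cis \<theta>)))\<^sup>2 \<le> B * Re (l (w * cis \<theta>))"
        using B[of \<theta>] by (simp add: power2_eq_square mult_right_mono)
    qed
    then show ?thesis using zero_le_power2[of c] by linarith
  qed
  also have "(\<integral>\<theta>. B * Re (l (w * cis \<theta>)) \<partial>angle_measure) = B * c"
  proof -
    have "(\<integral>\<theta>. Re (l (w * cis \<theta>)) \<partial>angle_measure) = c"
      using integral_bounded_linear[OF bounded_linear_Re integrable_circle[OF cl w]] mean_value_circle[OF l(1) w] l(2) by simp
    then show ?thesis by simp
  qed
  finally show ?thesis by simp
qed

text \<open>On the closed left half-plane, which is convex, the derivative of \<open>exp\<close> has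
  modulus at most 1.\<close>

lemma norm_one_minus_exp_le:
  fixes u :: complex
  assumes "Re u \<ge> 0"
  shows "norm (1 - exp (- u)) \<le> norm u"
proof -
  have "norm (exp 0 - exp (- u)) \<le> 1 * norm (0 - (- u))"
  proof (rule field_differentiable_bound[of "{z. Re z \<le> 0}" exp exp])
    show "convex {z. Re z \<le> 0}" by (rule convex_halfspace_Re_le)
    show "(exp has_field_derivative exp z) (at z within {z. Re z \<le> 0})" for z :: complex
      by (rule has_field_derivative_at_within[OF DERIV_exp])
  qed (use assms in auto)
  then show ?thesis by simp
qed

text \<open>The real part of \<open>l\<close> near the unit circle is the density of the driving measure, and it lives
  where \<open>F(1/w)\<close> is close to \<open>1\<close>; as \<open>w\<close> and \<open>1/F(1/w)\<close> differ by at most \<open>\<bar>l w\<bar>\<close>, it suffices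
  to control the mean of \<open>Re l * \<bar>l\<bar>\<close>.\<close>

lemma concentration_near_one:
  assumes map: "particle_map P F c" and part: "particle P" and ext: "extends_to_boundary F"
    and l: "l holomorphic_on ball 0 1" "l 0 = of_real c" and pos: "\<And>w. norm w < 1 \<Longrightarrow> Re (l w) \<ge> 0"
    and F: "\<And>z. norm z > 1 \<Longrightarrow> F z = z * exp (l (1 / z))"
    and \<delta>: "\<delta> > 0" "P \<subseteq> cball 1 \<delta>" and e: "e > 0"
  obtains r where "1/2 \<le> r" "r < 1"
    "\<And>w. r < norm w \<Longrightarrow> norm w < 1 \<Longrightarrow>
       (\<integral>\<theta>. Re (l (w * cis \<theta>)) * norm (1 - w * cis \<theta>) \<partial>angle_measure) \<le> c * (\<delta> + 3 / 2 * (\<delta> + e)) + e"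
proof -
  obtain G where G: "continuous_on {z. norm z \<ge> 1} G" "\<And>z. norm z > 1 \<Longrightarrow> G z = F z"
    using ext by (auto simp: extends_to_boundary_def)
  have "closed P" using part by (auto simp: particle_def compact_imp_closed)
  then have bd: "norm (G z) \<ge> 1" "norm (G z) = 1 \<or> G z \<in> P" if "norm z = 1" for z
    using boundary_values[OF map _ G that] by blast+
  have G1: "norm (G z) \<ge> 1" if "norm z \<ge> 1" for z
  proof (cases "norm z = 1")
    case False
    then have z: "norm z > 1" using that by simp
    have "Re (l (1 / z)) \<ge> 0" using z by (intro pos) (simp add: norm_divide divide_less_eq)
    then have "1 * 1 \<le> norm z * exp (Re (l (1 / z)))" using z by (intro mult_mono) auto
    then show ?thesis using F[OF z] G(2)[OF z] by (simp add: norm_mult)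
  qed (use bd in auto)
  define H where "H w = G (1 / w)" for w
  \<comment> \<open>\<open>\<psi>\<close> equals \<open>Re l\<close> in the punctured disc and
    continues, through \<open>G\<close>, to the unit circle, where its values are governed by the
    particle.\<close>
  define \<psi> where "\<psi> w = ln (norm (H w) * norm w)" for w
  let ?K = "{w::complex. 1/2 \<le> norm w \<and> norm w \<le> 1}"
  have H1: "norm (H w) \<ge> 1" if "w \<in> ?K" for w
    unfolding H_def using that by (intro G1) (auto simp: norm_divide le_divide_eq)
  have Hc: "continuous_on ?K H"
    unfolding H_def by (rule continuous_on_compose2[OF G(1)]) (auto intro!: continuous_intros simp: norm_divide le_divide_eq)
  have H0: "H w \<noteq> 0" "w \<noteq> 0" if "w \<in> ?K" for w using H1[OF that] that by auto
  have \<psi>c: "continuous_on ?K \<psi>"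
    unfolding \<psi>_def by (intro continuous_intros Hc) (use H0 in auto)
  have HF: "H w = exp (l w) / w" "\<psi> w = Re (l w)" if "norm w < 1" "w \<noteq> 0" for w
  proof -
    show *: "H w = exp (l w) / w" using G(2)[of "1 / w"] F[of "1 / w"] that by (simp add: H_def norm_divide)
    show "\<psi> w = Re (l w)" using that by (simp add: \<psi>_def * norm_divide)
  qed
  have bd': "\<psi> w \<le> \<delta>" "norm (1 - 1 / H w) * \<psi> w \<le> \<delta> * \<psi> w" if w: "norm w = 1" for w
  proof -
    have w1: "norm (1 / w) = 1" using w by (simp add: norm_divide)
    \<comment> \<open>On the circle either \<open>H w\<close> has modulus 1 and
      \<open>\<psi> w = 0\<close>, or \<open>H w\<close> lies in \<open>P\<close> and hence within
      \<open>\<delta>\<close> of 1. The factor \<open>\<psi> w\<close> makes the second estimate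
      valid in both cases.\<close>
    have "\<psi> w \<le> \<delta> \<and> norm (1 - 1 / H w) * \<psi> w \<le> \<delta> * \<psi> w"
    proof (cases "norm (H w) = 1")
      case False
      then have "H w \<in> P" using bd(2)[OF w1] by (simp add: H_def)
      then have d: "norm (1 - H w) \<le> \<delta>" using \<delta>(2) by (auto simp: dist_norm)
      have n: "norm (H w) \<ge> 1" using w by (intro H1) auto
      then have Hn: "H w \<noteq> 0" by auto
      have "norm (H w) \<le> 1 + \<delta>" using norm_triangle_ineq2[of "H w" 1] d by (simp add: norm_minus_commute)
      then have "\<psi> w \<le> ln (1 + \<delta>)" unfolding \<psi>_def using w Hn \<delta> by (subst ln_le_cancel_iff) auto
      also have "\<dots> \<le> \<delta>" by (rule ln_add_one_self_le_self[OF less_imp_le[OF \<delta>(1)]])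
      finally have "\<psi> w \<le> \<delta>" .
      moreover have "\<psi> w \<ge> 0" using w n by (simp add: \<psi>_def)
      moreover have "norm (1 - 1 / H w) \<le> \<delta>"
      proof -
        have "1 - 1 / H w = - (1 - H w) / H w" using Hn by (simp add: field_simps)
        then have "norm (1 - 1 / H w) = norm (1 - H w) / norm (H w)" by (simp add: norm_divide norm_minus_commute)
        also have "\<dots> \<le> norm (1 - H w) / 1" using n by (intro divide_left_mono) auto
        finally show ?thesis using d by simp
      qed
      ultimately show ?thesis by (auto intro: mult_right_mono)
    qed (use w \<delta> in \<open>simp add: \<psi>_def\<close>)
    then show "\<psi> w \<le> \<delta>" "norm (1 - 1 / H w) * \<psi> w \<le> \<delta> * \<psi> w" by auto
  qed
  obtain r1 where r1: "1/2 \<le> r1" "r1 < 1" "\<And>w. r1 < norm w \<Longrightarrow> norm w < 1 \<Longrightarrow> \<psi> w - \<delta> \<le> e"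
  proof (rule radial_limit_nonpos[of "\<lambda>w. \<psi> w - \<delta>" e])
    show "continuous_on ?K (\<lambda>w. \<psi> w - \<delta>)" by (intro continuous_intros \<psi>c)
    show "\<psi> w - \<delta> \<le> 0" if "norm w = 1" for w using bd'(1)[OF that] by simp
  qed (use e in auto)
  obtain r2 where r2: "1/2 \<le> r2" "r2 < 1"
    "\<And>w. r2 < norm w \<Longrightarrow> norm w < 1 \<Longrightarrow> norm (1 - 1 / H w) * \<psi> w - \<delta> * \<psi> w \<le> e"
  proof (rule radial_limit_nonpos[of "\<lambda>w. norm (1 - 1 / H w) * \<psi> w - \<delta> * \<psi> w" e])
    show "continuous_on ?K (\<lambda>w. norm (1 - 1 / H w) * \<psi> w - \<delta> * \<psi> w)"
      by (intro continuous_intros \<psi>c Hc) (use H0 in blast)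
    show "norm (1 - 1 / H w) * \<psi> w - \<delta> * \<psi> w \<le> 0" if "norm w = 1" for w using bd'(2)[OF that] by simp
  qed (use e in auto)
  show ?thesis
  proof (rule that[of "max r1 r2"])
    fix w :: complex assume w: "max r1 r2 < norm w" "norm w < 1"
    have cl: "continuous_on (ball 0 1) l" using l by (simp add: holomorphic_on_imp_continuous_on)
    have int: "integrable angle_measure (\<lambda>\<theta>. Re (l (w * cis \<theta>)) * norm (1 - w * cis \<theta>))"
      "integrable angle_measure (\<lambda>\<theta>. Re (l (w * cis \<theta>)) * norm (l (w * cis \<theta>)))"
      "integrable angle_measure (\<lambda>\<theta>. Re (l (w * cis \<theta>)))"
      by (rule integrable_circle[of 1 "\<lambda>u. Re (l u) * norm (1 - u)"] integrable_circle[of 1 "\<lambda>u. Re (l u) * norm (l u)"]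
        integrable_circle[of 1 "\<lambda>u. Re (l u)"], intro continuous_intros cl, rule w)+
    have conv: "integrable angle_measure (\<lambda>_. e)"
      by (rule integrable_angle_measure_bounded[where B = "\<bar>e\<bar>"]) auto
    have "(\<integral>\<theta>. Re (l (w * cis \<theta>)) * norm (1 - w * cis \<theta>) \<partial>angle_measure)
      \<le> (\<integral>\<theta>. \<delta> * Re (l (w * cis \<theta>)) + e + Re (l (w * cis \<theta>)) * norm (l (w * cis \<theta>)) \<partial>angle_measure)"
    proof (intro integral_mono int Bochner_Integration.integrable_add integrable_mult_right conv)
      fix \<theta>
      define u where "u = w * cis \<theta>"
      have nu: "norm u = norm w" by (simp add: u_def norm_mult)
      have u: "norm u < 1" "u \<noteq> 0" "r2 < norm u" using w nu r1 by auto
      have le: "norm (1 - 1 / H u) * Re (l u) \<le> \<delta> * Re (l u) + e"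
        using r2(3)[OF u(3,1)] HF(2)[OF u(1,2)] by simp
      have p: "Re (l u) \<ge> 0" by (rule pos[OF u(1)])
      have "norm (1 - exp (- l u)) \<le> norm (l u)"
        using p by (rule norm_one_minus_exp_le)
      then have "norm (1 / H u - u) \<le> norm (l u)"
      proof -
        have "1 / H u - u = - (u * (1 - exp (- l u)))" using HF(1)[OF u(1,2)] by (simp add: exp_minus divide_inverse algebra_simps)
        then have "norm (1 / H u - u) = norm u * norm (1 - exp (- l u))" by (simp add: norm_mult)
        also have "\<dots> \<le> 1 * norm (1 - exp (- l u))" using u by (intro mult_right_mono) auto
        finally show ?thesis using \<open>norm (1 - exp (- l u)) \<le> norm (l u)\<close> by simp
      qed
      then have "norm (1 - u) \<le> norm (1 - 1 / H u) + norm (l u)"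
        using norm_triangle_ineq[of "1 - 1 / H u" "1 / H u - u"] by simp
      then have "Re (l u) * norm (1 - u) \<le> Re (l u) * (norm (1 - 1 / H u) + norm (l u))"
        using p by (rule mult_left_mono)
      also have "\<dots> \<le> \<delta> * Re (l u) + e + Re (l u) * norm (l u)" using le by (simp add: algebra_simps)
      finally show "Re (l (w * cis \<theta>)) * norm (1 - w * cis \<theta>) \<le> \<delta> * Re (l (w * cis \<theta>)) + e + Re (l (w * cis \<theta>)) * norm (l (w * cis \<theta>))"
        by (simp add: u_def)
    qed
    also have "\<dots> = \<delta> * c + e + (\<integral>\<theta>. Re (l (w * cis \<theta>)) * norm (l (w * cis \<theta>)) \<partial>angle_measure)"
    proof -
      have "(\<integral>\<theta>. Re (l (w * cis \<theta>)) \<partial>angle_measure) = c"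
        using integral_bounded_linear[OF bounded_linear_Re integrable_circle[OF cl w(2)]] mean_value_circle[OF l(1) w(2)] l(2) by simp
      moreover have "measure angle_measure UNIV = 1"
        using prob_space.prob_space[OF prob_space_angle_measure] by simp
      ultimately show ?thesis using int conv by simp
    qed
    also have "\<dots> \<le> \<delta> * c + e + 3 / 2 * (\<delta> + e) * c"
    proof (intro add_left_mono mean_Re_mult_norm_le l pos w)
      fix \<theta>
      have u: "norm (w * cis \<theta>) = norm w" by (simp add: norm_mult)
      then have "\<psi> (w * cis \<theta>) - \<delta> \<le> e" using w by (intro r1) auto
      moreover have "w * cis \<theta> \<noteq> 0" using u w r1 by auto
      ultimately show "Re (l (w * cis \<theta>)) \<le> \<delta> + e" using HF(2)[of "w * cis \<theta>"] u w by simp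
    qed
    finally show "(\<integral>\<theta>. Re (l (w * cis \<theta>)) * norm (1 - w * cis \<theta>) \<partial>angle_measure) \<le> c * (\<delta> + 3 / 2 * (\<delta> + e)) + e"
      by (simp add: algebra_simps)
  qed (use r1 r2 in auto)
qed

text \<open>Freezing the kernel \<open>2 * v / (u - v)\<close> at \<open>u = 1\<close> changes it by
  a multiple of \<open>1 - u\<close>, so the error is governed by the mean of
  \<open>Re l * norm (1 - u)\<close>, with the distances \<open>r - \<rho>\<close> and
  \<open>1 - \<rho>\<close> in the denominator. The admissible radii depend on \<open>e\<close>, so
  \<open>r \<rightarrow> 1\<close> precedes \<open>e \<rightarrow> 0\<close>. The constant is
  \<open>5 = 2 * (1 + 3 / 2)\<close>.\<close>

lemma log_approx:
  assumes map: "particle_map P F c" and part: "particle P" and ext: "extends_to_boundary F"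
    and l: "l holomorphic_on ball 0 1" "l 0 = of_real c" and pos: "\<And>w. norm w < 1 \<Longrightarrow> Re (l w) \<ge> 0"
    and F: "\<And>z. norm z > 1 \<Longrightarrow> F z = z * exp (l (1 / z))"
    and \<delta>: "\<delta> > 0" "P \<subseteq> cball 1 \<delta>"
    and v: "norm v \<le> \<rho>" "\<rho> < 1"
  shows "norm (l v - of_real c - of_real c * (2 * v / (1 - v))) \<le> 5 * \<delta> * c / (1 - \<rho>)\<^sup>2"
proof -
  define D where "D = norm (l v - of_real c - of_real c * (2 * v / (1 - v)))"
  have \<rho>0: "\<rho> \<ge> 0" using v norm_ge_zero[of v] by linarith
  have v1: "norm (1 - v) \<ge> 1 - \<rho>" using norm_triangle_ineq2[of 1 v] v by simp
  have vne: "v \<noteq> 1" using v by auto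
  have bound: "D * ((r - \<rho>) * (1 - \<rho>)) \<le> 2 * (c * (\<delta> + 3 / 2 * (\<delta> + e)) + e)"
    if e: "e > 0" and r: "\<rho> < r" "r < 1" and
      le: "\<And>w. norm w = r \<Longrightarrow> (\<integral>\<theta>. Re (l (w * cis \<theta>)) * norm (1 - w * cis \<theta>) \<partial>angle_measure) \<le> c * (\<delta> + 3 / 2 * (\<delta> + e)) + e"
    for e r
  proof -
    define w where "w = complex_of_real r"
    have nw: "norm w = r" using r \<rho>0 by (simp add: w_def)
    have w: "norm w < 1" "norm v < norm w" using r v nw by auto
    note dev = deviation_formula[OF l w]
    define k where "k = 2 / ((r - \<rho>) * (1 - \<rho>))"
    have intm: "integrable angle_measure (\<lambda>\<theta>. of_real (Re (l (w * cis \<theta>))) * (2 * v / (1 - v)))"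
      using dev(3) by (intro integrable_mult_left integrable_of_real)
    have "l v - of_real c - of_real c * (2 * v / (1 - v)) =
      (\<integral>\<theta>. of_real (Re (l (w * cis \<theta>))) * (2 * v / (w * cis \<theta> - v)) - of_real (Re (l (w * cis \<theta>))) * (2 * v / (1 - v)) \<partial>angle_measure)"
      using Bochner_Integration.integral_diff[OF dev(4) intm] dev(1,2)
      by (simp only: integral_mult_left_zero integral_complex_of_real)
    then have "D \<le> (\<integral>\<theta>. Re (l (w * cis \<theta>)) * norm (1 - w * cis \<theta>) * k \<partial>angle_measure)"
      unfolding D_def
    proof (simp only:, intro norm_integral_le Bochner_Integration.integrable_diff dev(4) intm)
      have "continuous_on (ball 0 1) l" using l by (simp add: holomorphic_on_imp_continuous_on)
      then show "integrable angle_measure (\<lambda>\<theta>. Re (l (w * cis \<theta>)) * norm (1 - w * cis \<theta>) * k)"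
        by (intro integrable_circle[of 1 "\<lambda>u. Re (l u) * norm (1 - u) * k"] continuous_intros w)
      fix \<theta>
      define u where "u = w * cis \<theta>"
      have nu: "norm u = r" by (simp add: u_def norm_mult nw)
      then have uv: "u \<noteq> v" using w nw by auto
      have p: "Re (l u) \<ge> 0" using nu r by (intro pos) auto
      have uv': "r - \<rho> \<le> norm (u - v)" using norm_triangle_ineq2[of u v] v nu by simp
      have "of_real (Re (l u)) * (2 * v / (u - v)) - of_real (Re (l u)) * (2 * v / (1 - v))
         = of_real (Re (l u)) * (2 * v * (1 - u) / ((u - v) * (1 - v)))"
        using uv vne by (simp add: field_simps)
      also have "norm \<dots> = Re (l u) * (2 * norm v * norm (1 - u) / (norm (u - v) * norm (1 - v)))"
        using p by (simp add: norm_mult norm_divide)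
      also have "\<dots> \<le> Re (l u) * (2 * 1 * norm (1 - u) / ((r - \<rho>) * (1 - \<rho>)))"
        using p r v v1 uv' by (intro mult_left_mono frac_le mult_mono mult_nonneg_nonneg mult_pos_pos) auto
      also have "\<dots> = Re (l u) * norm (1 - u) * k" by (simp add: k_def)
      finally show "norm (of_real (Re (l (w * cis \<theta>))) * (2 * v / (w * cis \<theta> - v)) - of_real (Re (l (w * cis \<theta>))) * (2 * v / (1 - v)))
         \<le> Re (l (w * cis \<theta>)) * norm (1 - w * cis \<theta>) * k" by (simp add: u_def)
    qed
    also have "\<dots> \<le> (c * (\<delta> + 3 / 2 * (\<delta> + e)) + e) * k"
      unfolding integral_mult_left_zero using le[OF nw] r v by (intro mult_right_mono) (simp_all add: k_def)
    finally show ?thesis using r v by (simp add: k_def pos_le_divide_eq mult_ac)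
  qed
  have bound': "D * ((1 - \<rho>) * (1 - \<rho>)) \<le> 2 * (c * (\<delta> + 3 / 2 * (\<delta> + e)) + e)" if e: "e > 0" for e
  proof -
    obtain r0 where r0: "1/2 \<le> r0" "r0 < 1" "\<And>w. r0 < norm w \<Longrightarrow> norm w < 1 \<Longrightarrow>
       (\<integral>\<theta>. Re (l (w * cis \<theta>)) * norm (1 - w * cis \<theta>) \<partial>angle_measure) \<le> c * (\<delta> + 3 / 2 * (\<delta> + e)) + e"
      using concentration_near_one[OF map part ext l pos F \<delta> e] by blast
    have m: "max r0 \<rho> < 1" using r0 v by simp
    show ?thesis
    proof (rule tendsto_upperbound)
      show "((\<lambda>r. D * ((r - \<rho>) * (1 - \<rho>))) \<longlongrightarrow> D * ((1 - \<rho>) * (1 - \<rho>))) (at_left 1)"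
        by (intro tendsto_intros)
      show "\<forall>\<^sub>F r in at_left 1. D * ((r - \<rho>) * (1 - \<rho>)) \<le> 2 * (c * (\<delta> + 3 / 2 * (\<delta> + e)) + e)"
        using eventually_at_left_real[OF m]
      proof eventually_elim
        fix r assume "r \<in> {max r0 \<rho><..<1}"
        then show "D * ((r - \<rho>) * (1 - \<rho>)) \<le> 2 * (c * (\<delta> + 3 / 2 * (\<delta> + e)) + e)"
          using r0 by (intro bound e) auto
      qed
    qed simp
  qed
  have "D * ((1 - \<rho>) * (1 - \<rho>)) \<le> 2 * (c * (\<delta> + 3 / 2 * (\<delta> + 0)) + 0)"
  proof (rule tendsto_lowerbound)
    show "((\<lambda>e. 2 * (c * (\<delta> + 3 / 2 * (\<delta> + e)) + e)) \<longlongrightarrow> 2 * (c * (\<delta> + 3 / 2 * (\<delta> + 0)) + 0)) (at_right 0)"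
      by (intro tendsto_intros)
    show "\<forall>\<^sub>F e in at_right 0. D * ((1 - \<rho>) * (1 - \<rho>)) \<le> 2 * (c * (\<delta> + 3 / 2 * (\<delta> + e)) + e)"
      using eventually_at_right_less[of 0] by eventually_elim (rule bound')
  qed simp
  then have "D * (1 - \<rho>)\<^sup>2 \<le> 5 * \<delta> * c" by (simp add: power2_eq_square algebra_simps)
  then show ?thesis using v by (simp add: D_def field_simps)
qed

section \<open>One step of the growth process\<close>

text \<open>The default value 0 off the disc makes \<open>l\<close> a Borel function with
  nonnegative real part on the whole plane, so that iterating it needs no side conditions on the
  arguments.\<close>

locale positive_log =
  fixes l :: "complex \<Rightarrow> complex" and c :: real
  assumes c_pos: "c > 0" and hol: "l holomorphic_on ball 0 1" and l_0: "l 0 = of_real c"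
    and Re_nonneg: "norm w < 1 \<Longrightarrow> Re (l w) \<ge> 0" and outside: "norm w \<ge> 1 \<Longrightarrow> l w = 0"
begin

lemma continuous_on_l: "continuous_on (ball 0 1) l"
  using hol by (rule holomorphic_on_imp_continuous_on)

lemma Re_nonneg': "Re (l w) \<ge> 0"
  using Re_nonneg[of w] outside[of w] by (cases "norm w < 1") auto

lemma measurable_l [measurable]: "l \<in> borel_measurable borel"
proof -
  have "l = (\<lambda>w. indicator (ball 0 1) w *\<^sub>R l w)"
    using outside by (auto simp: indicator_def fun_eq_iff)
  then show ?thesis
    using borel_measurable_continuous_on_indicator[OF _ continuous_on_l] by (metis borel_open open_ball)
qed

lemma deviation_le:
  assumes "norm v \<le> \<rho>" "\<rho> < 1"
  shows "norm (l v - of_real c) \<le> 2 / (1 - \<rho>) * c"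
proof -
  have "norm (l v - of_real c) \<le> 2 * c * norm v / (1 - norm v)"
    using assms by (intro positive_real_part_deviation hol l_0 Re_nonneg) auto
  also have "\<dots> \<le> 2 * c * 1 / (1 - \<rho>)"
    using assms c_pos by (intro frac_le mult_left_mono) auto
  finally show ?thesis by simp
qed

text \<open>Both integrands are holomorphic and vanish at the origin. The second identity says that
  the real and imaginary parts of an increment are uncorrelated with equal variances, the source of
  the isotropic limit.\<close>

lemma mean_deviation:
  assumes "norm w < 1"
  shows "(\<integral>\<theta>. l (w * cis \<theta>) - of_real c \<partial>angle_measure) = 0"
    and "(\<integral>\<theta>. (l (w * cis \<theta>) - of_real c)\<^sup>2 \<partial>angle_measure) = 0"
proof -
  have "(\<lambda>u. l u - of_real c) holomorphic_on ball 0 1" "(\<lambda>u. (l u - of_real c)\<^sup>2) holomorphic_on ball 0 1"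
    by (intro holomorphic_intros hol)+
  from this[THEN mean_value_circle, OF assms]
  show "(\<integral>\<theta>. l (w * cis \<theta>) - of_real c \<partial>angle_measure) = 0"
    and "(\<integral>\<theta>. (l (w * cis \<theta>) - of_real c)\<^sup>2 \<partial>angle_measure) = 0"
    by (simp_all only: l_0) simp_all
qed

lemma integrable_l_circle:
  fixes h :: "complex \<Rightarrow> 'b::{banach, second_countable_topology}"
  assumes "continuous_on UNIV h" "norm w < 1"
  shows "integrable angle_measure (\<lambda>\<theta>. h (l (w * cis \<theta>)))"
  by (rule integrable_circle[of 1 "\<lambda>u. h (l u)", OF _ assms(2)])
     (rule continuous_on_compose2[OF assms(1) continuous_on_l], simp)

text \<open>The model increment \<open>c * (2 * v / (1 - v))\<close> has an explicit mean square.
  True and model increments are both at most \<open>K * c\<close> in modulus, so the difference of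
  their squares is at most \<open>\<eta> * c\<close> times \<open>2 * K * c\<close>.\<close>

lemma mean_norm_square_deviation:
  assumes w: "norm w \<le> \<rho>" "\<rho> < 1"
    and approx: "\<And>v. norm v \<le> \<rho> \<Longrightarrow> norm (l v - of_real c - of_real c * (2 * v / (1 - v))) \<le> \<eta> * c"
  shows "\<bar>(\<integral>\<theta>. (norm (l (w * cis \<theta>) - of_real c))\<^sup>2 \<partial>angle_measure) - 4 * c\<^sup>2 * ((norm w)\<^sup>2 / (1 - (norm w)\<^sup>2))\<bar>
      \<le> 2 * (2 / (1 - \<rho>)) * \<eta> * c\<^sup>2"
proof -
  have w1: "norm w < 1" using w by simp
  define K where "K = 2 / (1 - \<rho>)"
  have K: "K > 0" using w by (simp add: K_def)
  let ?E = "\<lambda>v. complex_of_real c * (2 * v / (1 - v))"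
  have E: "(\<integral>\<theta>. (norm (?E (w * cis \<theta>)))\<^sup>2 \<partial>angle_measure) = 4 * c\<^sup>2 * ((norm w)\<^sup>2 / (1 - (norm w)\<^sup>2))"
  proof -
    have "(norm (?E v))\<^sup>2 = 4 * c\<^sup>2 * (norm (v / (1 - v)))\<^sup>2" for v
      by (simp add: norm_mult norm_divide power_mult_distrib power_divide)
    then show ?thesis using mean_norm_square_geometric[OF w1] by simp
  qed
  have ball1: "\<forall>v\<in>ball 0 1. 1 - v \<noteq> (0::complex)" by auto
  have int: "integrable angle_measure (\<lambda>\<theta>. (norm (l (w * cis \<theta>) - of_real c))\<^sup>2)"
    by (rule integrable_l_circle[of "\<lambda>u. (norm (u - of_real c))\<^sup>2", OF _ w1]) (intro continuous_intros)
  have int2: "integrable angle_measure (\<lambda>\<theta>. (norm (?E (w * cis \<theta>)))\<^sup>2)"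
    by (rule integrable_circle[of 1 "\<lambda>u. (norm (?E u))\<^sup>2", OF _ w1]) (intro continuous_intros ball1)
  have "norm (\<integral>\<theta>. (norm (l (w * cis \<theta>) - of_real c))\<^sup>2 - (norm (?E (w * cis \<theta>)))\<^sup>2 \<partial>angle_measure)
      \<le> (\<integral>\<theta>. 2 * K * \<eta> * c\<^sup>2 \<partial>angle_measure)"
  proof (rule norm_integral_le[OF Bochner_Integration.integrable_diff[OF int int2]])
    show "integrable angle_measure (\<lambda>\<theta>. 2 * K * \<eta> * c\<^sup>2)"
      by (rule integrable_angle_measure_bounded[where B = "\<bar>2 * K * \<eta> * c\<^sup>2\<bar>"]) auto
    fix \<theta>
    define u where "u = w * cis \<theta>"
    have u: "norm u \<le> \<rho>" using w by (simp add: u_def norm_mult)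
    have u1: "norm u < 1" using u w by simp
    have a: "norm (l u - of_real c) \<le> K * c" using deviation_le[OF u w(2)] by (simp add: K_def)
    have "norm (?E u) = c * (2 * norm u / norm (1 - u))"
      using c_pos by (simp add: norm_mult norm_divide)
    also have "\<dots> \<le> c * (2 * 1 / (1 - \<rho>))"
      using c_pos u w u1 norm_triangle_ineq2[of 1 u] by (intro mult_left_mono frac_le) auto
    finally have b: "norm (?E u) \<le> K * c" by (simp add: K_def mult.commute)
    have d: "\<bar>norm (l u - of_real c) - norm (?E u)\<bar> \<le> \<eta> * c"
      using norm_triangle_ineq3[of "l u - of_real c" "?E u"] approx[OF u] by simp
    have "\<bar>(norm (l u - of_real c))\<^sup>2 - (norm (?E u))\<^sup>2\<bar> =
       \<bar>norm (l u - of_real c) - norm (?E u)\<bar> * (norm (l u - of_real c) + norm (?E u))"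
      by (simp add: power2_eq_square square_diff_square_factored abs_mult)
    also have "\<dots> \<le> (\<eta> * c) * (K * c + K * c)"
      using a b d by (intro mult_mono add_mono) auto
    finally show "norm ((norm (l (w * cis \<theta>) - of_real c))\<^sup>2 - (norm (?E (w * cis \<theta>)))\<^sup>2) \<le> 2 * K * \<eta> * c\<^sup>2"
      by (simp add: u_def power2_eq_square algebra_simps)
  qed
  also have "\<dots> = 2 * K * \<eta> * c\<^sup>2"
    using prob_space.prob_space[OF prob_space_angle_measure] by simp
  finally show ?thesis using int int2 E by (simp add: K_def)
qed

text \<open>\<open>(Re x)\<^sup>2 = (norm x)\<^sup>2 / 2 + Re (x\<^sup>2) / 2\<close>, and the last
  term averages to 0; so the direction of \<open>s\<close> does not matter.\<close>

lemma mean_Re_square_deviation: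
  assumes w1: "norm w < 1"
  shows "(\<integral>\<theta>. (Re (s * (l (w * cis \<theta>) - of_real c)))\<^sup>2 \<partial>angle_measure)
     = (norm s)\<^sup>2 / 2 * (\<integral>\<theta>. (norm (l (w * cis \<theta>) - of_real c))\<^sup>2 \<partial>angle_measure)"
proof -
  have eq: "(Re x)\<^sup>2 = (norm x)\<^sup>2 / 2 + Re (x\<^sup>2) / 2" for x
    unfolding cmod_power2 by (simp add: power2_eq_square field_simps)
  have eq': "(Re (s * x))\<^sup>2 = (norm s)\<^sup>2 / 2 * (norm x)\<^sup>2 + Re (s\<^sup>2 / 2 * x\<^sup>2)" for x
    unfolding eq[of "s * x"] by (simp add: norm_mult power_mult_distrib)
  have i1: "integrable angle_measure (\<lambda>\<theta>. (norm (l (w * cis \<theta>) - of_real c))\<^sup>2)"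
    by (rule integrable_l_circle[of "\<lambda>u. (norm (u - of_real c))\<^sup>2", OF _ w1]) (intro continuous_intros)
  have i2: "integrable angle_measure (\<lambda>\<theta>. s\<^sup>2 / 2 * (l (w * cis \<theta>) - of_real c)\<^sup>2)"
    by (rule integrable_l_circle[of "\<lambda>u. s\<^sup>2 / 2 * (u - of_real c)\<^sup>2", OF _ w1]) (intro continuous_intros)
  have "(\<integral>\<theta>. Re (s\<^sup>2 / 2 * (l (w * cis \<theta>) - of_real c)\<^sup>2) \<partial>angle_measure) = 0"
    using integral_bounded_linear[OF bounded_linear_Re i2] mean_deviation(2)[OF w1]
    by (simp only: integral_mult_right_zero) simp
  moreover have "integrable angle_measure (\<lambda>\<theta>. Re (s\<^sup>2 / 2 * (l (w * cis \<theta>) - of_real c)\<^sup>2))"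
    using i2 by (rule integrable_Re)
  ultimately show ?thesis unfolding eq' using i1 by simp
qed

text \<open>Taylor expansion of the exponential to second order. The scaled increment is of order
  \<open>sqrt c\<close>, so the cubic remainder is of order \<open>c * sqrt c\<close>; the linear
  term averages to 0. The quadratic term turns \<open>4 * c\<^sup>2\<close> into \<open>c\<close>:
  one factor 1/2 comes from taking real parts, another from the Taylor coefficient, and
  \<open>1 / c\<close> from the scaling.\<close>

lemma char_step:
  assumes w: "norm w \<le> \<rho>" "\<rho> < 1"
    and approx: "\<And>v. norm v \<le> \<rho> \<Longrightarrow> norm (l v - of_real c - of_real c * (2 * v / (1 - v))) \<le> \<eta> * c"
  shows "norm ((\<integral>\<theta>. iexp (Re (s * (l (w * cis \<theta>) - of_real c)) / sqrt c) \<partial>angle_measure)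
       - of_real (1 - (norm s)\<^sup>2 * c * ((norm w)\<^sup>2 / (1 - (norm w)\<^sup>2))))
     \<le> c * ((norm s * (2 / (1 - \<rho>))) ^ 3 * sqrt c / 6 + (norm s)\<^sup>2 * (2 / (1 - \<rho>)) * \<eta> / 2)"
proof -
  have w1: "norm w < 1" using w by simp
  define K where "K = 2 / (1 - \<rho>)"
  define Y where "Y \<theta> = Re (s * (l (w * cis \<theta>) - of_real c)) / sqrt c" for \<theta>
  define Q where "Q = (\<integral>\<theta>. (norm (l (w * cis \<theta>) - of_real c))\<^sup>2 \<partial>angle_measure)"
  define q where "q = (norm w)\<^sup>2 / (1 - (norm w)\<^sup>2)"
  have K: "K > 0" using w by (simp add: K_def)
  have sq: "sqrt c * sqrt c = c" "sqrt c > 0" using c_pos by auto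
  have iY: "integrable angle_measure Y" "integrable angle_measure (\<lambda>\<theta>. (Y \<theta>)\<^sup>2)" "integrable angle_measure (\<lambda>\<theta>. iexp (Y \<theta>))"
    unfolding Y_def
    by (rule integrable_l_circle[of "\<lambda>u. Re (s * (u - of_real c)) / sqrt c", OF _ w1]
       integrable_l_circle[of "\<lambda>u. (Re (s * (u - of_real c)) / sqrt c)\<^sup>2", OF _ w1]
       integrable_l_circle[of "\<lambda>u. iexp (Re (s * (u - of_real c)) / sqrt c)", OF _ w1],
       intro continuous_intros, use sq in force)+
  have one: "integrable angle_measure (\<lambda>_. 1::complex)"
    by (rule integrable_angle_measure_bounded[where B = 1]) auto
  have mY: "(\<integral>\<theta>. Y \<theta> \<partial>angle_measure) = 0"
  proof -
    have i: "integrable angle_measure (\<lambda>\<theta>. s * (l (w * cis \<theta>) - of_real c))"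
      by (rule integrable_l_circle[of "\<lambda>u. s * (u - of_real c)", OF _ w1]) (intro continuous_intros)
    show ?thesis
      using integral_bounded_linear[OF bounded_linear_Re i] mean_deviation(1)[OF w1]
      by (simp only: integral_mult_right_zero Y_def integral_divide_zero) simp
  qed
  have mY2: "(\<integral>\<theta>. (Y \<theta>)\<^sup>2 \<partial>angle_measure) = (norm s)\<^sup>2 * Q / (2 * c)"
    unfolding Y_def power_divide integral_divide_zero mean_Re_square_deviation[OF w1] Q_def
    using c_pos by simp
  have "(\<integral>\<theta>. 1 + \<i> * of_real (Y \<theta>) - of_real ((Y \<theta>)\<^sup>2) / 2 \<partial>angle_measure)
     = (\<integral>\<theta>. 1 \<partial>angle_measure) + \<i> * of_real (\<integral>\<theta>. Y \<theta> \<partial>angle_measure) - of_real (\<integral>\<theta>. (Y \<theta>)\<^sup>2 \<partial>angle_measure) / 2"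
    using iY one by (simp del: of_real_power)
  also have "\<dots> = of_real (1 - (norm s)\<^sup>2 * Q / (4 * c))"
    using prob_space.prob_space[OF prob_space_angle_measure] by (simp add: mY mY2)
  finally have I2: "(\<integral>\<theta>. 1 + \<i> * of_real (Y \<theta>) - of_real ((Y \<theta>)\<^sup>2) / 2 \<partial>angle_measure) = of_real (1 - (norm s)\<^sup>2 * Q / (4 * c))" .
  have i2: "integrable angle_measure (\<lambda>\<theta>. 1 + \<i> * of_real (Y \<theta>) - of_real ((Y \<theta>)\<^sup>2) / 2)"
    using iY one by (intro Bochner_Integration.integrable_add Bochner_Integration.integrable_diff
        integrable_mult_right integrable_divide integrable_of_real) auto
  have "norm ((\<integral>\<theta>. iexp (Y \<theta>) - (1 + \<i> * of_real (Y \<theta>) - of_real ((Y \<theta>)\<^sup>2) / 2) \<partial>angle_measure))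
     \<le> (\<integral>\<theta>. (norm s * K * sqrt c) ^ 3 / 6 \<partial>angle_measure)"
  proof (rule norm_integral_le[OF Bochner_Integration.integrable_diff[OF iY(3) i2]])
    show "integrable angle_measure (\<lambda>\<theta>. (norm s * K * sqrt c) ^ 3 / 6)"
      by (rule integrable_angle_measure_bounded[where B = "\<bar>(norm s * K * sqrt c) ^ 3 / 6\<bar>"]) auto
    fix \<theta>
    have "norm (w * cis \<theta>) \<le> \<rho>" using w by (simp add: norm_mult)
    from deviation_le[OF this w(2)] have d: "norm (l (w * cis \<theta>) - of_real c) \<le> K * c" by (simp add: K_def)
    have "\<bar>Y \<theta>\<bar> = \<bar>Re (s * (l (w * cis \<theta>) - of_real c))\<bar> / sqrt c" using sq by (simp add: Y_def)
    also have "\<dots> \<le> norm (s * (l (w * cis \<theta>) - of_real c)) / sqrt c"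
      using sq by (intro divide_right_mono abs_Re_le_cmod) auto
    also have "\<dots> \<le> (norm s * (K * c)) / sqrt c"
      unfolding norm_mult using sq d by (intro divide_right_mono mult_left_mono) auto
    also have "\<dots> = norm s * K * sqrt c" using sq by (simp add: field_simps)
    finally have Y: "\<bar>Y \<theta>\<bar> \<le> norm s * K * sqrt c" .
    have "(\<Sum>k\<le>2. (\<i> * of_real (Y \<theta>)) ^ k / fact k) = 1 + \<i> * of_real (Y \<theta>) - of_real ((Y \<theta>)\<^sup>2) / 2"
      by (simp add: numeral_2_eq_2 power_mult_distrib)
    then have "norm (iexp (Y \<theta>) - (1 + \<i> * of_real (Y \<theta>) - of_real ((Y \<theta>)\<^sup>2) / 2)) \<le> \<bar>Y \<theta>\<bar> ^ 3 / 6"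
      using iexp_approx1[of "Y \<theta>" 2] by (simp add: fact_numeral)
    also have "\<dots> \<le> (norm s * K * sqrt c) ^ 3 / 6"
      using Y by (intro divide_right_mono power_mono) auto
    finally show "norm (iexp (Y \<theta>) - (1 + \<i> * of_real (Y \<theta>) - of_real ((Y \<theta>)\<^sup>2) / 2)) \<le> (norm s * K * sqrt c) ^ 3 / 6" .
  qed
  also have "\<dots> = c * ((norm s * K) ^ 3 * sqrt c / 6)"
    using prob_space.prob_space[OF prob_space_angle_measure] sq
    by (simp add: power_mult_distrib power3_eq_cube)
  finally have A: "norm ((\<integral>\<theta>. iexp (Y \<theta>) \<partial>angle_measure) - of_real (1 - (norm s)\<^sup>2 * Q / (4 * c))) \<le> c * ((norm s * K) ^ 3 * sqrt c / 6)"
    using iY(3) i2 I2 by simp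
  have "\<bar>Q - 4 * c\<^sup>2 * q\<bar> \<le> 2 * K * \<eta> * c\<^sup>2"
    using mean_norm_square_deviation[OF w approx] by (simp add: Q_def q_def K_def)
  then have "(norm s)\<^sup>2 / (4 * c) * \<bar>Q - 4 * c\<^sup>2 * q\<bar> \<le> (norm s)\<^sup>2 / (4 * c) * (2 * K * \<eta> * c\<^sup>2)"
    using c_pos by (intro mult_left_mono) auto
  moreover have "\<bar>(norm s)\<^sup>2 / (4 * c) * (Q - 4 * c\<^sup>2 * q)\<bar> = (norm s)\<^sup>2 / (4 * c) * \<bar>Q - 4 * c\<^sup>2 * q\<bar>"
    using c_pos by (simp add: abs_mult)
  moreover have "(norm s)\<^sup>2 / (4 * c) * (Q - 4 * c\<^sup>2 * q) = (norm s)\<^sup>2 * Q / (4 * c) - (norm s)\<^sup>2 * c * q"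
    using c_pos by (simp add: field_simps power2_eq_square)
  moreover have "(norm s)\<^sup>2 / (4 * c) * (2 * K * \<eta> * c\<^sup>2) = c * ((norm s)\<^sup>2 * K * \<eta> / 2)"
    using c_pos by (simp add: field_simps power2_eq_square)
  ultimately have B: "\<bar>(norm s)\<^sup>2 * Q / (4 * c) - (norm s)\<^sup>2 * c * q\<bar> \<le> c * ((norm s)\<^sup>2 * K * \<eta> / 2)" by metis
  have "norm (complex_of_real (1 - (norm s)\<^sup>2 * Q / (4 * c)) - of_real (1 - (norm s)\<^sup>2 * c * q))
     = \<bar>(norm s)\<^sup>2 * Q / (4 * c) - (norm s)\<^sup>2 * c * q\<bar>"
    unfolding of_real_diff[symmetric] norm_of_real by simp
  then have "norm ((\<integral>\<theta>. iexp (Y \<theta>) \<partial>angle_measure) - of_real (1 - (norm s)\<^sup>2 * c * q))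
     \<le> c * ((norm s * K) ^ 3 * sqrt c / 6) + c * ((norm s)\<^sup>2 * K * \<eta> / 2)"
    using norm_diff_triangle_le[OF A] B by simp
  then show ?thesis unfolding Y_def q_def K_def by (simp only: distrib_left)
qed

end

section \<open>The chain of logarithms\<close>

text \<open>The angles are enumerated from the innermost map outwards: for a cluster of \<open>N\<close> particles,
  \<open>\<phi> i\<close> is \<open>\<Theta> (N - i)\<close>. This makes the \<open>j\<close>-th partial sum independent of the next angle.\<close>

primrec log_chain :: "(complex \<Rightarrow> complex) \<Rightarrow> (nat \<Rightarrow> real) \<Rightarrow> complex \<Rightarrow> nat \<Rightarrow> complex" where
  "log_chain l \<phi> z 0 = 0"
| "log_chain l \<phi> z (Suc j) = log_chain l \<phi> z j + l (exp (- log_chain l \<phi> z j) / z * cis (\<phi> j))"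

lemma log_chain_cong: "(\<And>i. i < j \<Longrightarrow> \<phi> i = \<psi> i) \<Longrightarrow> log_chain l \<phi> z j = log_chain l \<psi> z j"
  by (induction j) auto

context positive_log
begin

lemma Re_log_chain_nonneg: "Re (log_chain l \<phi> z j) \<ge> 0"
  by (induction j) (auto intro: add_nonneg_nonneg Re_nonneg')

lemma log_chain_arg_less_1:
  assumes "norm z > 1"
  shows "norm (exp (- log_chain l \<phi> z j) / z * cis \<theta>) < 1"
proof -
  have "exp (- Re (log_chain l \<phi> z j)) \<le> 1" using Re_log_chain_nonneg by simp
  also have "\<dots> < norm z" by (rule assms)
  finally have "exp (- Re (log_chain l \<phi> z j)) < norm z" .
  moreover have "norm z > 0" using assms by linarith
  ultimately show ?thesis by (simp add: norm_mult norm_divide)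
qed

lemma holomorphic_log_chain: "(\<lambda>z. log_chain l \<phi> z j) holomorphic_on {z. norm z > 1}"
proof (induction j)
  case (Suc j)
  have "(\<lambda>z. l (exp (- log_chain l \<phi> z j) / z * cis (\<phi> j))) holomorphic_on {z. norm z > 1}"
  proof (rule holomorphic_on_compose_gen[OF _ hol, unfolded o_def])
    show "(\<lambda>z. exp (- log_chain l \<phi> z j) / z * cis (\<phi> j)) holomorphic_on {z. norm z > 1}"
      by (intro holomorphic_intros Suc.IH) auto
    show "(\<lambda>z. exp (- log_chain l \<phi> z j) / z * cis (\<phi> j)) ` {z. norm z > 1} \<subseteq> ball 0 1"
      using log_chain_arg_less_1 by (auto simp del: norm_mult)
  qed
  with Suc.IH show ?case by (auto intro: holomorphic_intros)
qed simp

lemma log_chain_at_infinity: "((\<lambda>z. log_chain l \<phi> z j) \<longlongrightarrow> of_real (real j * c)) at_infinity"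
proof (induction j)
  case (Suc j)
  have "((\<lambda>z. exp (- log_chain l \<phi> z j) * inverse z * cis (\<phi> j)) \<longlongrightarrow> exp (- of_real (real j * c)) * 0 * cis (\<phi> j)) at_infinity"
    by (intro tendsto_intros Suc.IH tendsto_inverse_0)
  then have "((\<lambda>z. exp (- log_chain l \<phi> z j) / z * cis (\<phi> j)) \<longlongrightarrow> 0) at_infinity"
    by (simp add: divide_inverse)
  moreover have "isCont l 0"
    using continuous_on_l by (simp add: continuous_on_eq_continuous_at)
  ultimately have "((\<lambda>z. l (exp (- log_chain l \<phi> z j) / z * cis (\<phi> j))) \<longlongrightarrow> l 0) at_infinity"
    by (rule isCont_tendsto_compose[rotated])
  then have "((\<lambda>z. log_chain l \<phi> z j + l (exp (- log_chain l \<phi> z j) / z * cis (\<phi> j))) \<longlongrightarrow> of_real (real j * c) + l 0) at_infinity"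
    by (intro tendsto_intros Suc.IH)
  then show ?case by (simp add: l_0 algebra_simps)
qed simp

lemma measurable_log_chain:
  assumes "\<And>i. i < j \<Longrightarrow> (\<lambda>x. \<phi> x i) \<in> borel_measurable N"
  shows "(\<lambda>x. log_chain l (\<phi> x) z j) \<in> borel_measurable N"
  using assms
proof (induction j)
  case (Suc j)
  have [measurable]: "(\<lambda>x. log_chain l (\<phi> x) z j) \<in> borel_measurable N" "(\<lambda>x. \<phi> x j) \<in> borel_measurable N"
    using Suc by auto
  have [measurable]: "cis \<in> borel_measurable borel" "exp \<in> borel_measurable (borel :: complex measure)"
    by (intro borel_measurable_continuous_onI continuous_intros)+
  show ?case by simp
qed simp

section \<open>Identification of the chain with the branch of the logarithm\<close>

context
  fixes F assumes F_eq: "\<And>z. norm z > 1 \<Longrightarrow> F z = z * exp (l (1 / z))"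
begin

text \<open>The two rotations cancel in the factor \<open>x\<close> and survive only in the argument
  of \<open>l\<close>.\<close>

lemma rotated_map_eq:
  assumes "norm x > 1"
  shows "rotated_map F \<theta> x = x * exp (l (1 / x * cis \<theta>))"
proof -
  have x: "norm (cis (- \<theta>) * x) > 1" using assms by (simp add: norm_mult)
  have "1 / (cis (- \<theta>) * x) = 1 / x * cis \<theta>" by (simp add: cis_inverse[symmetric] field_simps)
  moreover have "cis \<theta> * (cis (- \<theta>) * x) = x" by (simp add: mult.assoc[symmetric] cis_mult)
  ultimately show ?thesis using F_eq[OF x] by (simp add: rotated_map_def mult.assoc[symmetric])
qed

lemma cluster_map_eq:
  assumes z: "norm z > 1"
  shows "cluster_map F \<theta> N z = z * exp (log_chain l (\<lambda>i. \<theta> (N - i)) z N)"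
proof -
  let ?\<Lambda> = "log_chain l (\<lambda>i. \<theta> (N - i)) z"
  \<comment> \<open>Invariant: after the \<open>k\<close> innermost maps have been applied, the
    remaining cluster map still produces the same final image. The next map to be peeled off carries
    the angle \<open>\<theta> (N - k)\<close>, the last one of
    \<open>cluster_map F \<theta> (N - k)\<close>.\<close>
  have "cluster_map F \<theta> (N - k) (z * exp (?\<Lambda> k)) = cluster_map F \<theta> N z" if "k \<le> N" for k
    using that
  proof (induction k)
    case (Suc k)
    have n: "norm (z * exp (?\<Lambda> k)) > 1"
    proof -
      have "1 * 1 < norm z * exp (Re (?\<Lambda> k))"
        using z Re_log_chain_nonneg by (intro mult_less_le_imp_less) auto
      then show ?thesis by (simp add: norm_mult)
    qed
    have "1 / (z * exp (?\<Lambda> k)) = exp (- ?\<Lambda> k) / z" by (simp add: exp_minus field_simps)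
    then have r: "rotated_map F (\<theta> (N - k)) (z * exp (?\<Lambda> k)) = z * exp (?\<Lambda> (Suc k))"
      using rotated_map_eq[OF n] by (simp add: exp_add)
    have "N - k = Suc (N - Suc k)" using Suc.prems by simp
    then have "cluster_map F \<theta> (N - k) (z * exp (?\<Lambda> k)) = cluster_map F \<theta> (N - Suc k) (z * exp (?\<Lambda> (Suc k)))"
      using r by (metis cluster_map.simps(2) comp_apply)
    then show ?case using Suc by simp
  qed simp
  from this[of N] show ?thesis by simp
qed

text \<open>The chain is itself a branch with the prescribed limit. Another branch differs from it
  by a function \<open>d\<close> with \<open>exp d = 1\<close>, so \<open>d\<close> has derivative 0
  and is constant on the connected exterior; the common limit at infinity makes it 0.\<close>

lemma log_ratio_cluster_map:
  assumes z: "norm z > 1"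
  shows "log_ratio (cluster_map F \<theta> N) (real N * c) z = log_chain l (\<lambda>i. \<theta> (N - i)) z N"
  unfolding log_ratio_def
proof (rule the_equality)
  let ?E = "{u::complex. norm u > 1}"
  let ?\<Lambda> = "\<lambda>u. log_chain l (\<lambda>i. \<theta> (N - i)) u N"
  have "exp (?\<Lambda> u) = cluster_map F \<theta> N u / u" if "norm u > 1" for u
    using cluster_map_eq[OF that] that by auto
  then have props: "?\<Lambda> holomorphic_on ?E \<and> (\<forall>u. norm u > 1 \<longrightarrow> exp (?\<Lambda> u) = cluster_map F \<theta> N u / u) \<and>
      (?\<Lambda> \<longlongrightarrow> of_real (real N * c)) at_infinity"
    using holomorphic_log_chain log_chain_at_infinity by blast
  then show "\<exists>L. L holomorphic_on ?E \<and> (\<forall>u. norm u > 1 \<longrightarrow> exp (L u) = cluster_map F \<theta> N u / u) \<and>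
      (L \<longlongrightarrow> of_real (real N * c)) at_infinity \<and> ?\<Lambda> z = L z" by blast
  fix w
  assume "\<exists>L. L holomorphic_on ?E \<and> (\<forall>u. norm u > 1 \<longrightarrow> exp (L u) = cluster_map F \<theta> N u / u) \<and>
      (L \<longlongrightarrow> of_real (real N * c)) at_infinity \<and> w = L z"
  then obtain L where L: "L holomorphic_on ?E" "\<And>u. norm u > 1 \<Longrightarrow> exp (L u) = cluster_map F \<theta> N u / u"
      "(L \<longlongrightarrow> of_real (real N * c)) at_infinity" "w = L z" by blast
  define d where "d u = L u - ?\<Lambda> u" for u
  have E: "open ?E" by (intro open_Collect_less continuous_intros)
  have "?E = - cball 0 1" by (auto simp: not_le)
  then have "connected ?E"
    using connected_complement_bounded_convex[of "cball (0::complex) 1"] by simp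
  have dh: "d holomorphic_on ?E" unfolding d_def using L props by (intro holomorphic_intros) auto
  have e1: "exp (d u) = 1" if "u \<in> ?E" for u
  proof -
    have "exp (L u) = exp (?\<Lambda> u)" using L(2) props that by simp
    then show ?thesis by (simp add: d_def exp_diff)
  qed
  have "d constant_on ?E"
  proof (rule has_field_derivative_0_imp_constant_on[OF _ \<open>connected ?E\<close> E])
    fix u :: complex assume u: "u \<in> ?E"
    have du: "(d has_field_derivative deriv d u) (at u)" using dh E u by (rule holomorphic_derivI)
    then have "((\<lambda>u. exp (d u)) has_field_derivative exp (d u) * deriv d u) (at u)" by (rule DERIV_fun_exp)
    then have "((\<lambda>u. 1) has_field_derivative exp (d u) * deriv d u) (at u)"
      by (rule has_field_derivative_transform_within_open[OF _ E u]) (rule e1)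
    then have "deriv d u = 0" using DERIV_unique[OF _ DERIV_const] by force
    then show "(d has_field_derivative 0) (at u)" using du by simp
  qed
  then obtain k where k: "\<And>u. u \<in> ?E \<Longrightarrow> d u = k" unfolding constant_on_def by blast
  have "(d \<longlongrightarrow> of_real (real N * c) - of_real (real N * c)) at_infinity"
    unfolding d_def using L props by (intro tendsto_intros) auto
  moreover have "\<forall>\<^sub>F u in at_infinity. d u = k"
    unfolding eventually_at_infinity using k by (intro exI[of _ 2]) auto
  ultimately have "((\<lambda>_. k) \<longlongrightarrow> 0) (at_infinity :: complex filter)"
    by (simp add: filterlim_cong)
  then have "k = 0" using tendsto_const_iff trivial_limit_at_infinity by blast
  then show "w = ?\<Lambda> z" using k[of z] z L(4) by (simp add: d_def)
qed

end
end

section \<open>Independence and integrating out the next angle\<close>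

lemma measurable_angle_integral:
  fixes g :: "complex \<times> real \<Rightarrow> 'b::{banach, second_countable_topology}"
  assumes "g \<in> borel_measurable borel"
  shows "(\<lambda>x. \<integral>\<theta>. g (x, \<theta>) \<partial>angle_measure) \<in> borel_measurable borel"
proof -
  interpret prob_space angle_measure by (rule prob_space_angle_measure)
  have "sets (borel \<Otimes>\<^sub>M angle_measure) = sets (borel :: (complex \<times> real) measure)"
    unfolding borel_prod[symmetric] by (intro sets_pair_measure_cong) simp_all
  have "g \<in> borel_measurable (borel \<Otimes>\<^sub>M angle_measure)"
    using assms by (simp only: measurable_cong_sets[OF \<open>sets _ = _\<close> refl])
  then show ?thesis by (intro borel_measurable_lebesgue_integral) (simp add: case_prod_unfold)
qed

locale angle_sequence = prob_space M for M :: "'a measure" +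
  fixes \<Theta> :: "nat \<Rightarrow> 'a \<Rightarrow> real"
  assumes indep: "indep_vars (\<lambda>_. borel) \<Theta> {1..}"
    and distr_angle: "k \<ge> 1 \<Longrightarrow> distr M borel (\<Theta> k) = angle_measure"
begin

lemma measurable_angle: "k \<ge> 1 \<Longrightarrow> \<Theta> k \<in> borel_measurable M"
  using indep unfolding indep_vars_def by auto

text \<open>The library's \<open>indep_var\<close> wants both variables in the same type, so the angle is embedded
  into the complex numbers.\<close>

lemma expectation_fresh_angle:
  fixes X :: "'a \<Rightarrow> complex" and g :: "complex \<times> real \<Rightarrow> 'b::{banach, second_countable_topology}"
  assumes ind: "indep_var borel X borel (\<lambda>\<omega>. complex_of_real (\<Theta> k \<omega>))" and k: "k \<ge> 1"
    and g: "g \<in> borel_measurable borel" and B: "\<And>x. norm (g x) \<le> B"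
  shows "(\<integral>\<omega>. g (X \<omega>, \<Theta> k \<omega>) \<partial>M) = (\<integral>\<omega>. (\<integral>\<theta>. g (X \<omega>, \<theta>) \<partial>angle_measure) \<partial>M)"
proof -
  let ?Y = "\<lambda>\<omega>. complex_of_real (\<Theta> k \<omega>)"
  define g' where "g' x y = g (x, Re y)" for x y
  have X [measurable]: "X \<in> borel_measurable M" and Y [measurable]: "?Y \<in> borel_measurable M"
    and dist: "distr M borel X \<Otimes>\<^sub>M distr M borel ?Y = distr M (borel \<Otimes>\<^sub>M borel) (\<lambda>\<omega>. (X \<omega>, ?Y \<omega>))"
    using ind unfolding indep_var_distribution_eq by blast+
  have \<Theta>: "\<Theta> k \<in> borel_measurable M" by (rule measurable_angle[OF k])
  interpret D: prob_space "distr M borel X" by (rule prob_space_distr[OF X])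
  interpret D': prob_space "distr M borel ?Y" by (rule prob_space_distr[OF Y])
  interpret P: pair_prob_space "distr M borel X" "distr M borel ?Y" ..
  have gx: "(\<lambda>\<theta>. g (x, \<theta>)) \<in> borel_measurable borel" for x
    by (rule measurable_compose[OF _ g]) (intro borel_measurable_continuous_onI continuous_intros)
  have g'm: "(\<lambda>p. g' (fst p) (snd p)) \<in> borel_measurable (borel \<Otimes>\<^sub>M borel)"
    unfolding g'_def borel_prod
    by (rule measurable_compose[OF _ g]) (intro borel_measurable_continuous_onI continuous_intros)
  have "sets (distr M borel X \<Otimes>\<^sub>M distr M borel ?Y) = sets (borel \<Otimes>\<^sub>M borel)"
    by (intro sets_pair_measure_cong) simp_all
  from measurable_cong_sets[OF this refl] g'm
  have g'm': "(\<lambda>p. g' (fst p) (snd p)) \<in> borel_measurable (distr M borel X \<Otimes>\<^sub>M distr M borel ?Y)" by blast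
  have int: "integrable (distr M borel X \<Otimes>\<^sub>M distr M borel ?Y) (\<lambda>(x, y). g' x y)"
    unfolding case_prod_beta
    by (rule P.integrable_const_bound[where B = B]) (use B g'm' in \<open>auto simp: g'_def\<close>)
  have inner: "(\<integral>y. g' x y \<partial>distr M borel ?Y) = (\<integral>\<theta>. g (x, \<theta>) \<partial>angle_measure)" for x
  proof -
    have "(\<lambda>y. g' x y) \<in> borel_measurable borel"
      unfolding g'_def by (rule measurable_compose[OF _ gx]) measurable
    from integral_distr[OF Y this]
    have "(\<integral>y. g' x y \<partial>distr M borel ?Y) = (\<integral>\<omega>. g (x, \<Theta> k \<omega>) \<partial>M)"
      by (simp add: g'_def)
    also have "\<dots> = (\<integral>\<theta>. g (x, \<theta>) \<partial>distr M borel (\<Theta> k))"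
      by (rule integral_distr[OF \<Theta> gx, symmetric])
    finally show ?thesis by (simp only: distr_angle[OF k])
  qed
  have "(\<integral>\<omega>. g (X \<omega>, \<Theta> k \<omega>) \<partial>M) = (\<integral>p. g' (fst p) (snd p) \<partial>distr M (borel \<Otimes>\<^sub>M borel) (\<lambda>\<omega>. (X \<omega>, ?Y \<omega>)))"
    by (subst integral_distr[OF _ g'm]) (auto simp: g'_def)
  also have "\<dots> = (\<integral>x. (\<integral>y. g' x y \<partial>distr M borel ?Y) \<partial>distr M borel X)"
    unfolding dist[symmetric] using P.integral_fst[OF int, symmetric] by (simp only: case_prod_unfold)
  also have "\<dots> = (\<integral>\<omega>. (\<integral>y. g' (X \<omega>) y \<partial>distr M borel ?Y) \<partial>M)"
  proof (rule integral_distr[OF X])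
    have "sets (borel \<Otimes>\<^sub>M distr M borel ?Y) = sets (borel \<Otimes>\<^sub>M borel)"
      by (intro sets_pair_measure_cong) simp_all
    from measurable_cong_sets[OF this refl] g'm
    have "(\<lambda>(x, y). g' x y) \<in> borel_measurable (borel \<Otimes>\<^sub>M distr M borel ?Y)"
      unfolding case_prod_beta by blast
    then show "(\<lambda>x. \<integral>y. g' x y \<partial>distr M borel ?Y) \<in> borel_measurable borel"
      by (rule D'.borel_measurable_lebesgue_integral)
  qed
  finally show ?thesis by (simp only: inner)
qed

text \<open>Here the bound holds only at the values that \<open>X\<close> takes, as happens for a
  chain with nonnegative real part. Truncating \<open>g\<close> to 0 where it exceeds
  \<open>B\<close> changes neither side.\<close>

lemma expectation_fresh_angle':
  fixes X :: "'a \<Rightarrow> complex" and g :: "complex \<times> real \<Rightarrow> 'b::{banach, second_countable_topology}"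
  assumes "indep_var borel X borel (\<lambda>\<omega>. complex_of_real (\<Theta> k \<omega>))" and "k \<ge> 1"
    and g: "g \<in> borel_measurable borel" and B: "\<And>\<omega> \<theta>. norm (g (X \<omega>, \<theta>)) \<le> B"
  shows "(\<integral>\<omega>. g (X \<omega>, \<Theta> k \<omega>) \<partial>M) = (\<integral>\<omega>. (\<integral>\<theta>. g (X \<omega>, \<theta>) \<partial>angle_measure) \<partial>M)"
proof -
  define g' where "g' p = (if norm (g p) \<le> B then g p else 0)" for p
  then have "B \<ge> 0" using B order_trans[OF norm_ge_zero] by blast
  then have "norm (g' p) \<le> B" for p by (simp add: g'_def)
  moreover have "g' \<in> borel_measurable borel" unfolding g'_def using g by measurable
  ultimately have "(\<integral>\<omega>. g' (X \<omega>, \<Theta> k \<omega>) \<partial>M) = (\<integral>\<omega>. (\<integral>\<theta>. g' (X \<omega>, \<theta>) \<partial>angle_measure) \<partial>M)"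
    using assms(1,2) by (intro expectation_fresh_angle)
  moreover have "g' (X \<omega>, \<theta>) = g (X \<omega>, \<theta>)" for \<omega> \<theta> using B by (simp add: g'_def)
  ultimately show ?thesis by simp
qed

lemma measurable_log_chain_angles:
  assumes "positive_log l c" "j \<le> N"
  shows "(\<lambda>\<omega>. log_chain l (\<lambda>i. \<Theta> (N - i) \<omega>) z j) \<in> borel_measurable M"
  using assms by (intro positive_log.measurable_log_chain measurable_angle) auto

text \<open>The first \<open>j\<close> steps read the angles with indices \<open>N - j + 1\<close>
  to \<open>N\<close>, and the next one reads \<open>N - j\<close>. As \<open>j < N\<close>, this
  index is at least 1 and belongs to the independent family.\<close>

lemma indep_log_chain:
  assumes l: "positive_log l c" and j: "j < N"
  shows "indep_var borel (\<lambda>\<omega>. log_chain l (\<lambda>i. \<Theta> (N - i) \<omega>) z j) borel (\<lambda>\<omega>. complex_of_real (\<Theta> (N - j) \<omega>))"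
proof -
  let ?A = "{N - j + 1..N}" and ?B = "{N - j}"
  have "indep_var (PiM ?A (\<lambda>_. borel)) (\<lambda>\<omega>. restrict (\<lambda>i. \<Theta> i \<omega>) ?A) (PiM ?B (\<lambda>_. borel)) (\<lambda>\<omega>. restrict (\<lambda>i. \<Theta> i \<omega>) ?B)"
    using j by (intro indep_var_restrict[OF indep]) auto
  then have "indep_var borel ((\<lambda>x. log_chain l (\<lambda>i. x (N - i)) z j) \<circ> (\<lambda>\<omega>. restrict (\<lambda>i. \<Theta> i \<omega>) ?A))
      borel ((\<lambda>x. complex_of_real (x (N - j))) \<circ> (\<lambda>\<omega>. restrict (\<lambda>i. \<Theta> i \<omega>) ?B))"
  proof (rule indep_var_compose)
    show "(\<lambda>x. log_chain l (\<lambda>i. x (N - i)) z j) \<in> borel_measurable (PiM ?A (\<lambda>_. borel))"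
      by (intro positive_log.measurable_log_chain[OF l] measurable_component_singleton) (use j in auto)
    have "(\<lambda>x. x (N - j)) \<in> borel_measurable (PiM ?B (\<lambda>_. borel :: real measure))"
      by (intro measurable_component_singleton) auto
    then show "(\<lambda>x. complex_of_real (x (N - j))) \<in> borel_measurable (PiM ?B (\<lambda>_. borel))" by simp
  qed
  moreover have "log_chain l (\<lambda>i. restrict (\<lambda>i. \<Theta> i \<omega>) ?A (N - i)) z j = log_chain l (\<lambda>i. \<Theta> (N - i) \<omega>) z j" for \<omega>
    using j by (intro log_chain_cong) auto
  ultimately show ?thesis by (simp add: o_def)
qed

end

section \<open>Characteristic functions\<close>

text \<open>This is \<open>(norm w)\<^sup>2 / (1 - (norm w)\<^sup>2)\<close> at
  \<open>norm w = exp (- y)\<close>: up to the factor \<open>4 * c\<^sup>2\<close>, the approximate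
  mean squared increment when the current point has log-modulus \<open>y\<close>.\<close>

definition step_rate :: "real \<Rightarrow> real" where
  "step_rate y = 1 / (exp (2 * y) - 1)"

lemma step_rate_pos: "y > 0 \<Longrightarrow> step_rate y > 0"
  by (simp add: step_rate_def)

lemma step_rate_antimono:
  assumes "0 < x" "x \<le> y"
  shows "step_rate y \<le> step_rate x"
  using assms by (simp add: step_rate_def frac_le)

lemma step_rate_exp:
  assumes "y > 0"
  shows "(exp (- y))\<^sup>2 / (1 - (exp (- y))\<^sup>2) = step_rate y"
proof -
  have e: "(exp (- y))\<^sup>2 = 1 / exp (2 * y)"
    by (simp add: exp_minus exp_double power_inverse divide_inverse)
  have "exp (2 * y) > 1" using assms by simp
  then show ?thesis unfolding e step_rate_def by (simp add: field_simps)
qed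

lemma DERIV_step_rate:
  assumes "y > 0"
  shows "(step_rate has_real_derivative - 2 * step_rate y * (1 + step_rate y)) (at y)"
proof -
  have "exp (2 * y) - 1 \<noteq> 0" using assms by simp
  then have "((\<lambda>y. 1 / (exp (2 * y) - 1)) has_real_derivative - 2 * step_rate y * (1 + step_rate y)) (at y)"
    by (auto intro!: derivative_eq_intros simp: step_rate_def field_simps power2_eq_square)
  then show ?thesis by (simp add: step_rate_def[abs_def])
qed

text \<open>The rate \<open>h\<close> satisfies \<open>h' = - 2 * h * (1 + h)\<close> and decreases,
  so its slope is steepest at the left end \<open>\<sigma>\<close>.\<close>

lemma step_rate_lipschitz:
  assumes \<sigma>: "\<sigma> > 0" and "x \<ge> \<sigma>" "y \<ge> \<sigma>"
  shows "\<bar>step_rate x - step_rate y\<bar> \<le> 2 * step_rate \<sigma> * (1 + step_rate \<sigma>) * \<bar>x - y\<bar>"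
proof -
  have "norm (step_rate x - step_rate y) \<le> 2 * step_rate \<sigma> * (1 + step_rate \<sigma>) * norm (x - y)"
  proof (rule field_differentiable_bound[of "{\<sigma>..}" step_rate "\<lambda>y. - 2 * step_rate y * (1 + step_rate y)"])
    fix u assume u: "u \<in> {\<sigma>..}"
    then show "(step_rate has_field_derivative - 2 * step_rate u * (1 + step_rate u)) (at u within {\<sigma>..})"
      using \<sigma> by (intro has_field_derivative_at_within[OF DERIV_step_rate]) auto
    have "step_rate u \<le> step_rate \<sigma>" "0 \<le> step_rate u"
      using u \<sigma> step_rate_antimono[of \<sigma> u] step_rate_pos[of u] by auto
    then have "2 * step_rate u * (1 + step_rate u) \<le> 2 * step_rate \<sigma> * (1 + step_rate \<sigma>)" "0 \<le> 2 * step_rate u * (1 + step_rate u)"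
      by (auto intro!: mult_mono)
    then show "norm (- 2 * step_rate u * (1 + step_rate u)) \<le> 2 * step_rate \<sigma> * (1 + step_rate \<sigma>)"
      by simp
  qed (use assms in auto)
  then show ?thesis by simp
qed

section \<open>The limiting differential equation and its Euler scheme\<close>

lemma limit_variance_nonneg:
  assumes "\<sigma> > 0" "s \<ge> 0"
  shows "limit_variance s \<sigma> \<ge> 0"
proof -
  have "1 - exp (- 2 * \<sigma>) > 0" "1 - exp (- 2 * \<sigma>) \<le> 1 - exp (- 2 * (\<sigma> + s))" using assms by auto
  then show ?thesis unfolding limit_variance_def by (intro ln_ge_zero) (simp add: le_divide_eq)
qed

text \<open>This is where the logarithm in the variance comes from: it accumulates twice the step
  rate along the deterministic motion \<open>\<sigma> + s\<close>.\<close>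

lemma DERIV_limit_variance:
  assumes "\<sigma> > 0" "s \<ge> 0"
  shows "((\<lambda>s. limit_variance s \<sigma>) has_real_derivative 2 * step_rate (\<sigma> + s)) (at s)"
proof -
  define A where "A s = 1 - exp (- 2 * (\<sigma> + s))" for s
  have A0: "1 - exp (- 2 * \<sigma>) > 0" and A: "A s > 0" using assms by (auto simp: A_def)
  have "(A has_real_derivative 2 * exp (- 2 * (\<sigma> + s))) (at s)"
    unfolding A_def[abs_def] by (auto intro!: derivative_eq_intros)
  then have "((\<lambda>s. A s / (1 - exp (- 2 * \<sigma>))) has_real_derivative 2 * exp (- 2 * (\<sigma> + s)) / (1 - exp (- 2 * \<sigma>))) (at s)"
    by (rule DERIV_cdivide)
  then have "((\<lambda>s. ln (A s / (1 - exp (- 2 * \<sigma>)))) has_real_derivative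
     1 / (A s / (1 - exp (- 2 * \<sigma>))) * (2 * exp (- 2 * (\<sigma> + s)) / (1 - exp (- 2 * \<sigma>)))) (at s)"
    by (rule DERIV_chain2[rotated]) (use A A0 in \<open>intro DERIV_ln_divide, simp\<close>)
  moreover have "1 / (A s / (1 - exp (- 2 * \<sigma>))) * (2 * exp (- 2 * (\<sigma> + s)) / (1 - exp (- 2 * \<sigma>))) = 2 * step_rate (\<sigma> + s)"
  proof -
    have E: "exp (2 * (\<sigma> + s)) > 1" using assms by simp
    have e: "exp (- 2 * (\<sigma> + s)) = 1 / exp (2 * (\<sigma> + s))"
      unfolding mult_minus_left exp_minus by (simp add: divide_inverse)
    have "(1 / E) / (1 - 1 / E) = 1 / (E - 1)" if "E > 1" for E :: real
      using that by (simp add: field_simps)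
    from this[OF E] have "exp (- 2 * (\<sigma> + s)) / A s = step_rate (\<sigma> + s)"
      unfolding A_def step_rate_def e .
    moreover have "1 / (A s / (1 - exp (- 2 * \<sigma>))) * (2 * exp (- 2 * (\<sigma> + s)) / (1 - exp (- 2 * \<sigma>))) = 2 * (exp (- 2 * (\<sigma> + s)) / A s)"
      using A A0 by (simp add: field_simps)
    ultimately show ?thesis by simp
  qed
  ultimately show ?thesis by (simp add: limit_variance_def[abs_def] A_def)
qed

text \<open>The mean value inequality is applied to \<open>\<phi> u - \<phi>' s * u\<close> on
  \<open>[s, s + c]\<close>, whose derivative is at most \<open>c\<close> times a Lipschitz constant
  of \<open>\<phi>'\<close>. In that constant \<open>2 * H * (1 + H)\<close> stems from the rate,
  using \<open>\<phi> \<le> 1\<close>, and \<open>\<kappa> * H\<^sup>2\<close> from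
  \<open>\<phi>\<close>, using that the rate is at most \<open>H\<close>.\<close>

lemma limit_char_euler_step:
  assumes \<sigma>: "\<sigma> > 0" and \<kappa>: "\<kappa> \<ge> 0" and s: "s \<ge> 0" and c: "c \<ge> 0"
  defines "H \<equiv> step_rate \<sigma>"
  shows "\<bar>exp (- \<kappa> / 2 * limit_variance (s + c) \<sigma>) - (1 - \<kappa> * c * step_rate (\<sigma> + s)) * exp (- \<kappa> / 2 * limit_variance s \<sigma>)\<bar>
     \<le> \<kappa> * (2 * H * (1 + H) + \<kappa> * H\<^sup>2) * c * c"
proof -
  define \<phi> where "\<phi> s = exp (- \<kappa> / 2 * limit_variance s \<sigma>)" for s
  define \<phi>' where "\<phi>' s = - \<kappa> * step_rate (\<sigma> + s) * \<phi> s" for s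
  have H: "H > 0" unfolding H_def by (rule step_rate_pos[OF \<sigma>])
  have rate: "0 \<le> step_rate (\<sigma> + u)" "step_rate (\<sigma> + u) \<le> H" if "u \<ge> 0" for u
    using that \<sigma> step_rate_pos[of "\<sigma> + u"] step_rate_antimono[of \<sigma> "\<sigma> + u"] by (auto simp: H_def)
  have \<phi>1: "0 < \<phi> u" "\<phi> u \<le> 1" if "u \<ge> 0" for u
    using limit_variance_nonneg[OF \<sigma> that] \<kappa> by (auto simp: \<phi>_def)
  have D\<phi>: "(\<phi> has_real_derivative \<phi>' u) (at u)" if "u \<ge> 0" for u
    unfolding \<phi>_def[abs_def] \<phi>'_def
    by (auto intro!: derivative_eq_intros DERIV_limit_variance \<sigma> that)
  have lip\<phi>: "\<bar>\<phi> x - \<phi> y\<bar> \<le> \<kappa> * H * \<bar>x - y\<bar>" if "x \<ge> 0" "y \<ge> 0" for x y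
  proof -
    have "norm (\<phi> x - \<phi> y) \<le> \<kappa> * H * norm (x - y)"
    proof (rule field_differentiable_bound[of "{0..}" \<phi> \<phi>'])
      fix u :: real assume u: "u \<in> {0..}"
      then show "(\<phi> has_field_derivative \<phi>' u) (at u within {0..})"
        by (intro has_field_derivative_at_within[OF D\<phi>]) auto
      have "\<kappa> * step_rate (\<sigma> + u) * \<phi> u \<le> \<kappa> * H * 1"
        using \<kappa> H u rate[of u] \<phi>1[of u] by (intro mult_mono) auto
      then show "norm (\<phi>' u) \<le> \<kappa> * H"
        using \<kappa> u rate[of u] \<phi>1[of u] by (simp add: \<phi>'_def abs_mult)
    qed (use that in auto)
    then show ?thesis by simp
  qed
  have lip: "\<bar>\<phi>' x - \<phi>' y\<bar> \<le> \<kappa> * (2 * H * (1 + H) + \<kappa> * H\<^sup>2) * \<bar>x - y\<bar>" if xy: "x \<ge> 0" "y \<ge> 0" for x y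
  proof -
    have "\<phi>' x - \<phi>' y = - \<kappa> * ((step_rate (\<sigma> + x) - step_rate (\<sigma> + y)) * \<phi> x + step_rate (\<sigma> + y) * (\<phi> x - \<phi> y))"
      by (simp add: \<phi>'_def algebra_simps)
    then have "\<bar>\<phi>' x - \<phi>' y\<bar> = \<kappa> * \<bar>(step_rate (\<sigma> + x) - step_rate (\<sigma> + y)) * \<phi> x + step_rate (\<sigma> + y) * (\<phi> x - \<phi> y)\<bar>"
      using \<kappa> by (simp add: abs_mult)
    also have "\<dots> \<le> \<kappa> * (\<bar>step_rate (\<sigma> + x) - step_rate (\<sigma> + y)\<bar> * \<phi> x + step_rate (\<sigma> + y) * \<bar>\<phi> x - \<phi> y\<bar>)"
      using \<kappa> rate[of y] \<phi>1[of x] xy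
      by (intro mult_left_mono order_trans[OF abs_triangle_ineq]) (auto simp: abs_mult)
    also have "\<dots> \<le> \<kappa> * ((2 * H * (1 + H) * \<bar>x - y\<bar>) * 1 + H * (\<kappa> * H * \<bar>x - y\<bar>))"
      using \<kappa> rate[of y] \<phi>1[of x] xy lip\<phi>[of x y] step_rate_lipschitz[OF \<sigma>, of "\<sigma> + x" "\<sigma> + y"] H
      by (intro mult_left_mono add_mono mult_mono) (auto simp: H_def)
    finally show ?thesis by (simp add: algebra_simps power2_eq_square)
  qed
  define C where "C = \<kappa> * (2 * H * (1 + H) + \<kappa> * H\<^sup>2)"
  have C: "C \<ge> 0" using \<kappa> H by (simp add: C_def)
  have "norm ((\<phi> (s + c) - \<phi>' s * (s + c)) - (\<phi> s - \<phi>' s * s)) \<le> C * c * norm ((s + c) - s)"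
  proof (rule field_differentiable_bound[of "{s..s + c}" "\<lambda>u. \<phi> u - \<phi>' s * u" "\<lambda>u. \<phi>' u - \<phi>' s"])
    fix u assume u: "u \<in> {s..s + c}"
    then have "((\<lambda>u. \<phi> u - \<phi>' s * u) has_real_derivative \<phi>' u - \<phi>' s * 1) (at u)"
      using s by (intro DERIV_diff D\<phi> DERIV_cmult DERIV_ident) auto
    then show "((\<lambda>u. \<phi> u - \<phi>' s * u) has_field_derivative \<phi>' u - \<phi>' s) (at u within {s..s + c})"
      by (simp add: has_field_derivative_at_within)
    have "\<bar>\<phi>' u - \<phi>' s\<bar> \<le> C * \<bar>u - s\<bar>" using lip[of u s] u s by (simp add: C_def)
    also have "\<dots> \<le> C * c" using u C by (intro mult_left_mono) auto
    finally show "norm (\<phi>' u - \<phi>' s) \<le> C * c" by simp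
  qed (use c in auto)
  moreover have "(\<phi> (s + c) - \<phi>' s * (s + c)) - (\<phi> s - \<phi>' s * s) = \<phi> (s + c) - (1 - \<kappa> * c * step_rate (\<sigma> + s)) * \<phi> s"
    by (simp add: \<phi>'_def algebra_simps)
  ultimately show ?thesis using c by (simp add: \<phi>_def C_def)
qed

text \<open>Factors in \<open>[0, 1]\<close> do not amplify earlier discrepancies, so the defects of
  the two sequences merely add up.\<close>

lemma perturbed_recursion:
  fixes u v :: "nat \<Rightarrow> complex"
  assumes "\<And>j. j < N \<Longrightarrow> 0 \<le> r j \<and> r j \<le> 1"
    and "\<And>j. j < N \<Longrightarrow> norm (u (Suc j) - of_real (r j) * u j) \<le> a"
    and "\<And>j. j < N \<Longrightarrow> norm (v (Suc j) - of_real (r j) * v j) \<le> b"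
    and "u 0 = v 0"
  shows "norm (u N - v N) \<le> real N * (a + b)"
  using assms(1-3)
proof (induction N)
  case (Suc N)
  have "u (Suc N) - v (Suc N) = (u (Suc N) - of_real (r N) * u N) - (v (Suc N) - of_real (r N) * v N) + of_real (r N) * (u N - v N)"
    by (simp add: algebra_simps)
  then have "norm (u (Suc N) - v (Suc N)) \<le> norm (u (Suc N) - of_real (r N) * u N) + norm (v (Suc N) - of_real (r N) * v N) + norm (of_real (r N) * (u N - v N))"
    by (simp only:) (intro order_trans[OF norm_triangle_ineq] add_right_mono norm_triangle_ineq4)
  also have "norm (of_real (r N) * (u N - v N)) \<le> 1 * norm (u N - v N)"
    unfolding norm_mult using Suc.prems(1)[of N] by (intro mult_right_mono) auto
  also have "norm (u N - v N) \<le> real N * (a + b)" using Suc by auto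
  finally show ?case using Suc.prems(2,3)[of N] by (simp add: algebra_simps)
qed (use assms(4) in simp)

section \<open>Moments and characteristic functions of the chain\<close>

locale cluster_chain = angle_sequence M \<Theta> + positive_log l c
  for M :: "'a measure" and \<Theta> l c +
  fixes z :: complex and \<sigma> \<eta> :: real and N :: nat
  assumes \<sigma>_pos: "\<sigma> > 0" and norm_z: "norm z = exp \<sigma>"
    and approx: "norm v \<le> exp (- \<sigma>) \<Longrightarrow> norm (l v - of_real c - of_real c * (2 * v / (1 - v))) \<le> \<eta> * c"
begin

definition X :: "nat \<Rightarrow> 'a \<Rightarrow> complex" where
  "X j \<omega> = log_chain l (\<lambda>i. \<Theta> (N - i) \<omega>) z j"

definition \<Delta> :: "complex \<Rightarrow> real \<Rightarrow> complex" where
  "\<Delta> x \<theta> = l (exp (- x) / z * cis \<theta>) - of_real c"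

definition K :: real where "K = 2 / (1 - exp (- \<sigma>))"

lemma X_0 [simp]: "X 0 \<omega> = 0"
  by (simp add: X_def)

lemma X_Suc: "X (Suc j) \<omega> - of_real (real (Suc j) * c) = (X j \<omega> - of_real (real j * c)) + \<Delta> (X j \<omega>) (\<Theta> (N - j) \<omega>)"
  by (simp add: X_def \<Delta>_def algebra_simps)

lemma Re_X_nonneg: "Re (X j \<omega>) \<ge> 0"
  unfolding X_def by (rule Re_log_chain_nonneg)

lemma measurable_X: "j \<le> N \<Longrightarrow> X j \<in> borel_measurable M"
  unfolding X_def[abs_def] by (rule measurable_log_chain_angles[OF positive_log_axioms])

lemma indep_X: "j < N \<Longrightarrow> indep_var borel (X j) borel (\<lambda>\<omega>. complex_of_real (\<Theta> (N - j) \<omega>))"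
  unfolding X_def[abs_def] by (rule indep_log_chain[OF positive_log_axioms])

lemma norm_arg: "norm (exp (- x) / z) = exp (- (\<sigma> + Re x))"
  by (simp add: norm_divide norm_z flip: exp_diff)

text \<open>The real part of the chain is never negative, so every argument of \<open>l\<close>
  stays in the disc of radius \<open>exp (- \<sigma>)\<close>. Hence \<open>approx\<close> and
  \<open>K\<close> refer to this one radius.\<close>

lemma norm_arg_le: "Re x \<ge> 0 \<Longrightarrow> norm (exp (- x) / z) \<le> exp (- \<sigma>)"
  by (simp add: norm_arg)

lemma exp_neg_less_1: "exp (- \<sigma>) < 1"
  using \<sigma>_pos by simp

lemma norm_arg_less_1: "Re x \<ge> 0 \<Longrightarrow> norm (exp (- x) / z) < 1"
  using norm_arg_le exp_neg_less_1 by (metis le_less_trans)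

lemma norm_\<Delta>_le: "Re x \<ge> 0 \<Longrightarrow> norm (\<Delta> x \<theta>) \<le> K * c"
  unfolding \<Delta>_def K_def using norm_arg_le exp_neg_less_1
  by (intro deviation_le) (simp_all only: norm_mult norm_cis mult_1_right)

lemma borel_pairI: "f \<in> borel_measurable (borel \<Otimes>\<^sub>M borel) \<Longrightarrow> f \<in> borel_measurable (borel :: (complex \<times> real) measure)"
  by (simp add: borel_prod)

lemma measurable_\<Delta>: "(\<lambda>p. \<Delta> (fst p) (snd p)) \<in> borel_measurable (borel :: (complex \<times> real) measure)"
proof (rule borel_pairI)
  have [measurable]: "cis \<in> borel_measurable borel" "exp \<in> borel_measurable (borel :: complex measure)"
    by (intro borel_measurable_continuous_onI continuous_intros)+
  show "(\<lambda>p. \<Delta> (fst p) (snd p)) \<in> borel_measurable (borel \<Otimes>\<^sub>M borel)"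
    unfolding \<Delta>_def by measurable
qed

text \<open>The centred chain is a martingale: averaging over the fresh angle kills the cross term,
  and the squared increments, each at most \<open>(K * c)\<^sup>2\<close>, add up. The cruder
  deterministic bound supplies integrability.\<close>

lemma second_moment:
  assumes "j \<le> N"
  shows "(\<integral>\<omega>. (norm (X j \<omega> - of_real (real j * c)))\<^sup>2 \<partial>M) \<le> real j * (K * c)\<^sup>2"
    and "\<And>\<omega>. norm (X j \<omega> - of_real (real j * c)) \<le> real j * (K * c)"
proof -
  have bound: "norm (X j \<omega> - of_real (real j * c)) \<le> real j * (K * c)" for j \<omega>
  proof (induction j)
    case (Suc j)
    show ?case unfolding X_Suc
      using norm_triangle_ineq[of "X j \<omega> - of_real (real j * c)" "\<Delta> (X j \<omega>) (\<Theta> (N - j) \<omega>)"]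
        Suc norm_\<Delta>_le[OF Re_X_nonneg, of j \<omega> "\<Theta> (N - j) \<omega>"]
      by (simp add: algebra_simps)
  qed simp
  then show "norm (X j \<omega> - of_real (real j * c)) \<le> real j * (K * c)" for \<omega> .
  show "(\<integral>\<omega>. (norm (X j \<omega> - of_real (real j * c)))\<^sup>2 \<partial>M) \<le> real j * (K * c)\<^sup>2"
    using assms
  proof (induction j)
    case (Suc j)
    define a where "a \<omega> = X j \<omega> - of_real (real j * c)" for \<omega>
    define g where "g p = (norm ((fst p - of_real (real j * c)) + \<Delta> (fst p) (snd p)))\<^sup>2" for p :: "complex \<times> real"
    have [measurable]: "a \<in> borel_measurable M" unfolding a_def using measurable_X[of j] Suc.prems by simp
    have aB: "norm (a \<omega>) \<le> real j * (K * c)" for \<omega> unfolding a_def by (rule bound)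
    have intA: "integrable M (\<lambda>\<omega>. (norm (a \<omega>))\<^sup>2)"
      by (rule integrable_const_bound[where B = "(real j * (K * c))\<^sup>2"]) (use aB in \<open>auto intro!: AE_I2 power_mono\<close>)
    note [measurable] = measurable_\<Delta>
    have [measurable]: "(\<lambda>p. fst p) \<in> borel_measurable (borel :: (complex \<times> real) measure)"
      by (intro borel_measurable_continuous_onI continuous_intros)
    have gm: "g \<in> borel_measurable borel" unfolding g_def[abs_def] by measurable
    have gB: "norm (g (X j \<omega>, \<theta>)) \<le> (real j * (K * c) + K * c)\<^sup>2" for \<omega> \<theta>
      using bound[of j \<omega>] norm_\<Delta>_le[OF Re_X_nonneg, of j \<omega> \<theta>]
        norm_triangle_ineq[of "X j \<omega> - of_real (real j * c)" "\<Delta> (X j \<omega>) \<theta>"]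
      by (simp add: g_def power_mono)
    have "(\<integral>\<omega>. (norm (X (Suc j) \<omega> - of_real (real (Suc j) * c)))\<^sup>2 \<partial>M) = (\<integral>\<omega>. g (X j \<omega>, \<Theta> (N - j) \<omega>) \<partial>M)"
      unfolding X_Suc by (simp add: g_def)
    also have "\<dots> = (\<integral>\<omega>. (\<integral>\<theta>. g (X j \<omega>, \<theta>) \<partial>angle_measure) \<partial>M)"
      using Suc.prems by (intro expectation_fresh_angle'[OF indep_X _ gm gB]) auto
    also have "\<dots> \<le> (\<integral>\<omega>. (norm (a \<omega>))\<^sup>2 + (K * c)\<^sup>2 \<partial>M)"
    proof (rule integral_mono')
      show "integrable M (\<lambda>\<omega>. (norm (a \<omega>))\<^sup>2 + (K * c)\<^sup>2)" using intA by simp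
      fix \<omega>
      show "0 \<le> (norm (a \<omega>))\<^sup>2 + (K * c)\<^sup>2" by simp
      let ?w = "exp (- X j \<omega>) / z"
      have w: "norm ?w < 1" by (rule norm_arg_less_1[OF Re_X_nonneg])
      have i1: "integrable angle_measure (\<lambda>\<theta>. cnj (a \<omega>) * \<Delta> (X j \<omega>) \<theta>)"
        unfolding \<Delta>_def by (rule integrable_l_circle[of "\<lambda>u. cnj (a \<omega>) * (u - of_real c)", OF _ w]) (intro continuous_intros)
      have i2: "integrable angle_measure (\<lambda>\<theta>. (norm (\<Delta> (X j \<omega>) \<theta>))\<^sup>2)"
        unfolding \<Delta>_def by (rule integrable_l_circle[of "\<lambda>u. (norm (u - of_real c))\<^sup>2", OF _ w]) (intro continuous_intros)
      have k: "integrable angle_measure (\<lambda>_. x)" for x :: real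
        by (rule integrable_angle_measure_bounded[where B = "\<bar>x\<bar>"]) auto
      have m1: "measure angle_measure UNIV = 1"
        using prob_space.prob_space[OF prob_space_angle_measure] by simp
      have z0: "(\<integral>\<theta>. Re (cnj (a \<omega>) * \<Delta> (X j \<omega>) \<theta>) \<partial>angle_measure) = 0"
        using integral_bounded_linear[OF bounded_linear_Re i1] mean_deviation(1)[OF w]
        by (simp only: integral_mult_right_zero \<Delta>_def) simp
      have le: "(\<integral>\<theta>. (norm (\<Delta> (X j \<omega>) \<theta>))\<^sup>2 \<partial>angle_measure) \<le> (\<integral>\<theta>. (K * c)\<^sup>2 \<partial>angle_measure)"
        using norm_\<Delta>_le[OF Re_X_nonneg, of j \<omega>] by (intro integral_mono i2 k power_mono) auto
      have "g (X j \<omega>, \<theta>) = (norm (a \<omega>))\<^sup>2 + 2 * Re (cnj (a \<omega>) * \<Delta> (X j \<omega>) \<theta>) + (norm (\<Delta> (X j \<omega>) \<theta>))\<^sup>2" for \<theta>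
        unfolding g_def a_def fst_conv snd_conv cmod_power2 by (simp add: power2_eq_square algebra_simps)
      then have "(\<integral>\<theta>. g (X j \<omega>, \<theta>) \<partial>angle_measure) =
         (norm (a \<omega>))\<^sup>2 + 2 * (\<integral>\<theta>. Re (cnj (a \<omega>) * \<Delta> (X j \<omega>) \<theta>) \<partial>angle_measure) + (\<integral>\<theta>. (norm (\<Delta> (X j \<omega>) \<theta>))\<^sup>2 \<partial>angle_measure)"
        using integrable_Re[OF i1] i2 k m1 by (simp del: times_complex.sel complex_cnj)
      then show "(\<integral>\<theta>. g (X j \<omega>, \<theta>) \<partial>angle_measure) \<le> (norm (a \<omega>))\<^sup>2 + (K * c)\<^sup>2"
        using z0 le m1 by simp
    qed
    also have "\<dots> = (\<integral>\<omega>. (norm (a \<omega>))\<^sup>2 \<partial>M) + (K * c)\<^sup>2" using intA by (simp add: prob_space)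
    also have "\<dots> \<le> real (Suc j) * (K * c)\<^sup>2" using Suc by (simp add: a_def algebra_simps)
    finally show ?case .
  qed simp
qed

end

context cluster_chain
begin

definition H :: real where "H = step_rate \<sigma>"

definition char_fun :: "complex \<Rightarrow> nat \<Rightarrow> complex" where
  "char_fun s j = (\<integral>\<omega>. iexp (Re (s * (X j \<omega> - of_real (real j * c))) / sqrt c) \<partial>M)"

text \<open>The error of one step divided by \<open>c\<close>. The first bracket is the loss in
  \<open>char_step\<close> at radius \<open>exp (- \<sigma>)\<close>; the rest pays for freezing the
  random rate at its deterministic position, as long as \<open>real j * c \<le> T\<close>.\<close>

definition char_error :: "complex \<Rightarrow> real \<Rightarrow> real" where
  "char_error s T = ((norm s * K) ^ 3 * sqrt c / 6 + (norm s)\<^sup>2 * K * \<eta> / 2)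
     + (norm s)\<^sup>2 * (2 * H * (1 + H)) * (sqrt c * (T * K\<^sup>2 + 1) / 2)"

text \<open>Averaging over the fresh angle multiplies the exponential by \<open>A (X j)\<close>,
  which is close to \<open>1 - \<kappa> * c * step_rate (\<sigma> + Re (X j))\<close>. This factor
  is random and depends on the same \<open>X j\<close> as the exponential; freezing the rate at
  \<open>\<sigma> + real j * c\<close> allows it to leave the expectation and closes the
  recursion.\<close>

lemma char_recursion:
  assumes j: "j < N" and T: "real j * c \<le> T"
  shows "norm (char_fun s (Suc j) - of_real (1 - (norm s)\<^sup>2 * c * step_rate (\<sigma> + real j * c)) * char_fun s j)
     \<le> c * char_error s T"
proof -
  define \<kappa> where "\<kappa> = (norm s)\<^sup>2"
  define r where "r = 1 - \<kappa> * c * step_rate (\<sigma> + real j * c)"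
  define L where "L = 2 * H * (1 + H)"
  define E where "E = (norm s * K) ^ 3 * sqrt c / 6 + \<kappa> * K * \<eta> / 2"
  define e where "e x = iexp (Re (s * (x - of_real (real j * c))) / sqrt c)" for x
  define A where "A x = (\<integral>\<theta>. iexp (Re (s * \<Delta> x \<theta>) / sqrt c) \<partial>angle_measure)" for x
  have sq: "sqrt c > 0" "sqrt c * sqrt c = c" using c_pos by auto
  have L: "L \<ge> 0" using step_rate_pos[OF \<sigma>_pos] by (simp add: L_def H_def)
  have \<kappa>: "\<kappa> \<ge> 0" by (simp add: \<kappa>_def)
  have ne: "norm (e x) = 1" for x by (simp add: e_def)
  define g where "g p = iexp (Re (s * ((fst p - of_real (real j * c)) + \<Delta> (fst p) (snd p))) / sqrt c)"
    for p :: "complex \<times> real"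
  have split: "iexp (Re (s * ((x - of_real (real j * c)) + d)) / sqrt c) = e x * iexp (Re (s * d) / sqrt c)" for x d
    by (simp add: e_def distrib_left add_divide_distrib exp_add)
  have X_meas [measurable]: "X j \<in> borel_measurable M" using j by (intro measurable_X) simp
  have [measurable]: "(\<lambda>x. exp (\<i> * x)) \<in> borel_measurable (borel :: complex measure)"
    by (intro borel_measurable_continuous_onI continuous_intros)
  note [measurable] = measurable_\<Delta>
  have [measurable]: "(\<lambda>p. fst p) \<in> borel_measurable (borel :: (complex \<times> real) measure)"
    by (intro borel_measurable_continuous_onI continuous_intros)
  have gm: "g \<in> borel_measurable borel" unfolding g_def[abs_def] by measurable
  have em: "e \<in> borel_measurable borel" unfolding e_def[abs_def] by measurable
  have Am: "A \<in> borel_measurable borel"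
  proof -
    have "(\<lambda>p. iexp (Re (s * \<Delta> (fst p) (snd p)) / sqrt c)) \<in> borel_measurable (borel :: (complex \<times> real) measure)"
      by measurable
    from measurable_angle_integral[OF this] show ?thesis by (simp add: A_def[abs_def])
  qed
  have key: "norm (e x * A x - of_real r * e x) \<le> c * E + \<kappa> * c * L * (((norm (x - of_real (real j * c)))\<^sup>2 / sqrt c + sqrt c) / 2)"
    if x: "Re x \<ge> 0" for x
  proof -
    let ?w = "exp (- x) / z"
    have y: "\<sigma> + Re x > 0" using x \<sigma>_pos by simp
    have "norm (A x - of_real (1 - (norm s)\<^sup>2 * c * ((norm ?w)\<^sup>2 / (1 - (norm ?w)\<^sup>2))))
     \<le> c * ((norm s * (2 / (1 - exp (- \<sigma>)))) ^ 3 * sqrt c / 6 + (norm s)\<^sup>2 * (2 / (1 - exp (- \<sigma>))) * \<eta> / 2)"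
      unfolding A_def \<Delta>_def by (rule char_step[OF norm_arg_le[OF x] exp_neg_less_1 approx])
    then have 1: "norm (A x - of_real (1 - \<kappa> * c * step_rate (\<sigma> + Re x))) \<le> c * E"
      unfolding norm_arg step_rate_exp[OF y] by (simp only: \<kappa>_def E_def K_def)
    have "\<bar>step_rate (\<sigma> + Re x) - step_rate (\<sigma> + real j * c)\<bar> \<le> L * \<bar>(\<sigma> + Re x) - (\<sigma> + real j * c)\<bar>"
      unfolding L_def H_def using x c_pos by (intro step_rate_lipschitz \<sigma>_pos) auto
    also have "\<dots> \<le> L * norm (x - of_real (real j * c))"
      using abs_Re_le_cmod[of "x - of_real (real j * c)"] L by (intro mult_left_mono) auto
    also have "\<dots> \<le> L * (((norm (x - of_real (real j * c)))\<^sup>2 / sqrt c + sqrt c) / 2)"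
    proof -
      \<comment> \<open>A weighted arithmetic-geometric mean inequality trades the first moment for
        the second. The weight \<open>sqrt c\<close> balances both terms, since the second moment is
        of order \<open>c\<close>.\<close>
      define y where "y = norm (x - of_real (real j * c))"
      have "2 * y * sqrt c \<le> y\<^sup>2 + sqrt c * sqrt c"
        using sum_squares_bound[of y "sqrt c"] by (simp add: power2_eq_square)
      then have "y \<le> (y\<^sup>2 / sqrt c + sqrt c) / 2" using sq(1) by (simp add: field_simps)
      then show ?thesis using L by (intro mult_left_mono) (auto simp: y_def)
    qed
    finally have 2: "\<kappa> * c * \<bar>step_rate (\<sigma> + Re x) - step_rate (\<sigma> + real j * c)\<bar>
        \<le> \<kappa> * c * (L * (((norm (x - of_real (real j * c)))\<^sup>2 / sqrt c + sqrt c) / 2))"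
      using \<kappa> c_pos by (intro mult_left_mono) auto
    have "complex_of_real (1 - \<kappa> * c * step_rate (\<sigma> + Re x)) - of_real r
       = of_real (- (\<kappa> * c * (step_rate (\<sigma> + Re x) - step_rate (\<sigma> + real j * c))))"
      unfolding of_real_diff[symmetric] r_def by (simp add: algebra_simps)
    then have "norm (complex_of_real (1 - \<kappa> * c * step_rate (\<sigma> + Re x)) - of_real r) = \<kappa> * c * \<bar>step_rate (\<sigma> + Re x) - step_rate (\<sigma> + real j * c)\<bar>"
      using \<kappa> c_pos by (simp only: norm_of_real abs_minus_cancel abs_mult abs_of_nonneg abs_of_pos)
    with 2 have "norm (complex_of_real (1 - \<kappa> * c * step_rate (\<sigma> + Re x)) - of_real r)
        \<le> \<kappa> * c * (L * (((norm (x - of_real (real j * c)))\<^sup>2 / sqrt c + sqrt c) / 2))" by simp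
    from norm_diff_triangle_le[OF 1 this]
    have "norm (A x - of_real r) \<le> c * E + \<kappa> * c * (L * (((norm (x - of_real (real j * c)))\<^sup>2 / sqrt c + sqrt c) / 2))" .
    moreover have "norm (e x * A x - of_real r * e x) = norm (A x - of_real r)"
    proof -
      have "e x * A x - of_real r * e x = e x * (A x - of_real r)" by (simp add: algebra_simps)
      then show ?thesis by (simp add: norm_mult ne)
    qed
    ultimately show ?thesis by (simp add: mult.assoc)
  qed
  have A1: "norm (A x) \<le> 1" if "Re x \<ge> 0" for x
  proof -
    have w: "norm (exp (- x) / z) < 1" by (rule norm_arg_less_1[OF that])
    have "norm (A x) \<le> (\<integral>\<theta>. 1 \<partial>angle_measure)"
      unfolding A_def \<Delta>_def
    proof (rule norm_integral_le)
      show "integrable angle_measure (\<lambda>\<theta>. iexp (Re (s * (l (exp (- x) / z * cis \<theta>) - of_real c)) / sqrt c))"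
        by (rule integrable_l_circle[of "\<lambda>u. iexp (Re (s * (u - of_real c)) / sqrt c)", OF _ w])
           (intro continuous_intros, use sq in auto)
      show "integrable angle_measure (\<lambda>_. 1::real)"
        by (rule integrable_angle_measure_bounded[where B = 1]) auto
    qed auto
    then show ?thesis using prob_space.prob_space[OF prob_space_angle_measure] by simp
  qed
  have "char_fun s (Suc j) = (\<integral>\<omega>. g (X j \<omega>, \<Theta> (N - j) \<omega>) \<partial>M)"
    unfolding char_fun_def X_Suc by (simp add: g_def)
  also have "\<dots> = (\<integral>\<omega>. (\<integral>\<theta>. g (X j \<omega>, \<theta>) \<partial>angle_measure) \<partial>M)"
    using j by (intro expectation_fresh_angle[OF indep_X _ gm, where B = 1]) (auto simp: g_def)
  also have "\<dots> = (\<integral>\<omega>. e (X j \<omega>) * A (X j \<omega>) \<partial>M)"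
    unfolding g_def fst_conv snd_conv split A_def by simp
  finally have u': "char_fun s (Suc j) = (\<integral>\<omega>. e (X j \<omega>) * A (X j \<omega>) \<partial>M)" .
  have u0: "char_fun s j = (\<integral>\<omega>. e (X j \<omega>) \<partial>M)" by (simp add: char_fun_def e_def)
  have i1: "integrable M (\<lambda>\<omega>. e (X j \<omega>) * A (X j \<omega>))"
    using A1[OF Re_X_nonneg] em Am by (intro integrable_const_bound[where B = 1]) (auto simp: norm_mult ne)
  have i2: "integrable M (\<lambda>\<omega>. of_real r * e (X j \<omega>))"
    using em by (intro integrable_mult_right integrable_const_bound[where B = 1]) (auto simp: ne)
  have i3: "integrable M (\<lambda>\<omega>. (norm (X j \<omega> - of_real (real j * c)))\<^sup>2)"
    using second_moment(2)[of j] j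
    by (intro integrable_const_bound[where B = "(real j * (K * c))\<^sup>2"]) (auto intro!: AE_I2 power_mono simp del: of_real_mult of_real_of_nat_eq)
  have "norm (char_fun s (Suc j) - of_real r * char_fun s j) = norm (\<integral>\<omega>. e (X j \<omega>) * A (X j \<omega>) - of_real r * e (X j \<omega>) \<partial>M)"
    using i1 i2 unfolding u' u0 by simp
  also have "\<dots> \<le> (\<integral>\<omega>. c * E + \<kappa> * c * L * (((norm (X j \<omega> - of_real (real j * c)))\<^sup>2 / sqrt c + sqrt c) / 2) \<partial>M)"
    using key[OF Re_X_nonneg] i3
    by (intro norm_integral_le Bochner_Integration.integrable_diff[OF i1 i2]) auto
  also have "\<dots> = c * E + \<kappa> * c * L * (((\<integral>\<omega>. (norm (X j \<omega> - of_real (real j * c)))\<^sup>2 \<partial>M) / sqrt c + sqrt c) / 2)"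
    using i3 by (simp add: prob_space)
  also have "\<dots> \<le> c * E + \<kappa> * c * L * (sqrt c * (T * K\<^sup>2 + 1) / 2)"
  proof (intro add_left_mono mult_left_mono)
    have "(\<integral>\<omega>. (norm (X j \<omega> - of_real (real j * c)))\<^sup>2 \<partial>M) \<le> real j * (K * c)\<^sup>2"
      using second_moment(1)[of j] j by simp
    also have "\<dots> = (real j * c) * (K\<^sup>2 * c)" by (simp add: power2_eq_square)
    also have "\<dots> \<le> T * (K\<^sup>2 * c)" using T c_pos by (intro mult_right_mono) auto
    finally have "(\<integral>\<omega>. (norm (X j \<omega> - of_real (real j * c)))\<^sup>2 \<partial>M) / sqrt c \<le> (T * (K\<^sup>2 * c)) / sqrt c"
      using sq by (intro divide_right_mono) auto
    also have "\<dots> = sqrt c * (T * K\<^sup>2)" using sq by (simp add: field_simps)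
    finally show "((\<integral>\<omega>. (norm (X j \<omega> - of_real (real j * c)))\<^sup>2 \<partial>M) / sqrt c + sqrt c) / 2 \<le> sqrt c * (T * K\<^sup>2 + 1) / 2"
      by (simp add: algebra_simps)
  qed (use \<kappa> c_pos L in auto)
  also have "\<dots> = c * char_error s T"
    unfolding char_error_def E_def L_def \<kappa>_def by (simp add: algebra_simps)
  finally show ?thesis unfolding r_def \<kappa>_def .
qed

text \<open>Chain and limit obey the same recursion up to defects carrying a factor
  \<open>c\<close>, so their sum over all steps involves only \<open>real N * c\<close>. The
  assumption \<open>small\<close> keeps the recursion factors nonnegative.\<close>

lemma char_fun_approx:
  assumes T: "real N * c \<le> T" and small: "(norm s)\<^sup>2 * c * H \<le> 1"
  shows "norm (char_fun s N - of_real (exp (- (norm s)\<^sup>2 / 2 * limit_variance (real N * c) \<sigma>)))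
     \<le> real N * c * (char_error s T + (norm s)\<^sup>2 * (2 * H * (1 + H) + (norm s)\<^sup>2 * H\<^sup>2) * c)"
proof -
  define \<kappa> where "\<kappa> = (norm s)\<^sup>2"
  have \<kappa>: "\<kappa> \<ge> 0" by (simp add: \<kappa>_def)
  define v where "v j = complex_of_real (exp (- \<kappa> / 2 * limit_variance (real j * c) \<sigma>))" for j
  have "norm (char_fun s N - v N) \<le> real N * (c * char_error s T + \<kappa> * (2 * H * (1 + H) + \<kappa> * H\<^sup>2) * c * c)"
  proof (rule perturbed_recursion[where u = "char_fun s" and v = v and r = "\<lambda>j. 1 - \<kappa> * c * step_rate (\<sigma> + real j * c)"])
    fix j assume j: "j < N"
    have jc: "real j * c \<ge> 0" using c_pos by simp
    have "step_rate (\<sigma> + real j * c) \<le> H" "0 \<le> step_rate (\<sigma> + real j * c)"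
      using \<sigma>_pos jc step_rate_antimono[of \<sigma> "\<sigma> + real j * c"] step_rate_pos[of "\<sigma> + real j * c"] by (auto simp: H_def)
    then have "\<kappa> * c * step_rate (\<sigma> + real j * c) \<le> \<kappa> * c * H" "0 \<le> \<kappa> * c * step_rate (\<sigma> + real j * c)"
      using \<kappa> c_pos by (auto intro!: mult_left_mono)
    then show "0 \<le> 1 - \<kappa> * c * step_rate (\<sigma> + real j * c) \<and> 1 - \<kappa> * c * step_rate (\<sigma> + real j * c) \<le> 1"
      using small by (simp add: \<kappa>_def)
    have "real j * c \<le> real N * c" using j c_pos by (intro mult_right_mono) auto
    then show "norm (char_fun s (Suc j) - of_real (1 - \<kappa> * c * step_rate (\<sigma> + real j * c)) * char_fun s j) \<le> c * char_error s T"
      unfolding \<kappa>_def using T by (intro char_recursion j) simp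
    have "real (Suc j) * c = real j * c + c" by (simp add: algebra_simps)
    then have "norm (v (Suc j) - of_real (1 - \<kappa> * c * step_rate (\<sigma> + real j * c)) * v j) =
      \<bar>exp (- \<kappa> / 2 * limit_variance (real j * c + c) \<sigma>) - (1 - \<kappa> * c * step_rate (\<sigma> + real j * c)) * exp (- \<kappa> / 2 * limit_variance (real j * c) \<sigma>)\<bar>"
      unfolding v_def of_real_mult[symmetric] of_real_diff[symmetric] norm_of_real by (simp only:)
    also have "\<dots> \<le> \<kappa> * (2 * H * (1 + H) + \<kappa> * H\<^sup>2) * c * c"
      unfolding H_def using c_pos by (intro limit_char_euler_step \<sigma>_pos \<kappa> jc) simp
    finally show "norm (v (Suc j) - of_real (1 - \<kappa> * c * step_rate (\<sigma> + real j * c)) * v j) \<le> \<kappa> * (2 * H * (1 + H) + \<kappa> * H\<^sup>2) * c * c" .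
  next
    show "char_fun s 0 = v 0" by (simp add: char_fun_def v_def limit_variance_def prob_space)
  qed
  then show ?thesis by (simp add: v_def \<kappa>_def algebra_simps)
qed

end

section \<open>A continuity theorem for complex random variables\<close>

text \<open>Every real-linear functional on the plane has the form \<open>Re (s * x)\<close>, so
  these are the finite combinations of all its characters. The inductive form lets closure under
  products and convergence of means go by induction.\<close>

inductive_set trig_polys :: "(complex \<Rightarrow> complex) set" where
  base: "(\<lambda>x. iexp (Re (s * x))) \<in> trig_polys"
| add: "f \<in> trig_polys \<Longrightarrow> g \<in> trig_polys \<Longrightarrow> (\<lambda>x. f x + g x) \<in> trig_polys"
| scale: "f \<in> trig_polys \<Longrightarrow> (\<lambda>x. a * f x) \<in> trig_polys"

lemma trig_polys_const: "(\<lambda>_. a) \<in> trig_polys"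
  using scale[OF base[of 0], of a] by simp

text \<open>Characters multiply by adding their parameters; a nested induction extends this
  bilinearly.\<close>

lemma trig_polys_mult:
  assumes "f \<in> trig_polys" "g \<in> trig_polys"
  shows "(\<lambda>x. f x * g x) \<in> trig_polys"
  using assms(1)
proof induction
  case (base s)
  show ?case using assms(2)
  proof induction
    case (base s')
    have "iexp (Re (s * x)) * iexp (Re (s' * x)) = iexp (Re ((s + s') * x))" for x
      by (simp add: distrib_right distrib_left exp_add)
    then show ?case using trig_polys.base[of "s + s'"] by simp
  next
    case (add f g)
    then show ?case using trig_polys.add by (simp add: distrib_left)
  next
    case (scale f a)
    then show ?case using trig_polys.scale[of _ a] by (simp add: mult.left_commute)
  qed
next
  case (add f g)
  then show ?case using trig_polys.add by (simp add: distrib_right)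
next
  case (scale f a)
  then show ?case using trig_polys.scale[of _ a] by (simp add: mult.assoc)
qed

lemma trig_polys_sin: "(\<lambda>x. of_real (sin (Re (s * x)))) \<in> trig_polys"
proof -
  have "(\<lambda>x. (- \<i> / 2) * iexp (Re (s * x)) + (\<i> / 2) * iexp (Re (- s * x))) \<in> trig_polys"
    by (intro trig_polys.intros)
  moreover have "(- \<i> / 2) * iexp (Re (s * x)) + (\<i> / 2) * iexp (Re (- s * x)) = of_real (sin (Re (s * x)))" for x
    by (simp add: sin_of_real[symmetric] sin_exp_eq exp_minus field_simps)
  ultimately show ?thesis by simp
qed

lemma trig_polys_bounded_continuous:
  assumes "f \<in> trig_polys"
  shows "continuous_on UNIV f \<and> (\<exists>B. \<forall>x. norm (f x) \<le> B)"
  using assms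
proof induction
  case (base s)
  show ?case by (auto intro!: continuous_intros exI[of _ 1])
next
  case (add f g)
  then obtain A B where "\<forall>x. norm (f x) \<le> A" "\<forall>x. norm (g x) \<le> B" by blast
  then have "\<forall>x. norm (f x + g x) \<le> A + B" using norm_triangle_mono by blast
  then show ?case using add by (auto intro: continuous_intros)
next
  case (scale f a)
  then obtain A where "\<forall>x. norm (f x) \<le> A" by blast
  then have "\<forall>x. norm (a * f x) \<le> norm a * A" by (simp add: norm_mult mult_left_mono)
  then show ?case using scale by (auto intro: continuous_intros)
qed

lemma real_polynomial_sin_trig_polys:
  fixes p :: "complex \<Rightarrow> real"
  assumes "real_polynomial_function p"
  shows "(\<lambda>x. of_real (p (Complex (sin (k * Re x)) (sin (k * Im x))))) \<in> trig_polys"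
  using assms
proof induction
  case (linear f)
  have eq: "f (Complex a b) = f 1 * a + f \<i> * b" for a b
  proof -
    have "Complex a b = a *\<^sub>R 1 + b *\<^sub>R \<i>" by (simp add: complex_eq_iff)
    then show ?thesis by (simp add: linear_simps[OF linear])
  qed
  have 1: "(\<lambda>x. of_real (sin (k * Re x))) \<in> trig_polys" using trig_polys_sin[of "of_real k"] by simp
  \<comment> \<open>\<open>k * Im x = Re (- \<i> * k * x)\<close>, so the imaginary part is a
    functional of the same form.\<close>
  have 2: "(\<lambda>x. of_real (sin (k * Im x))) \<in> trig_polys" using trig_polys_sin[of "- \<i> * of_real k"] by simp
  show ?case unfolding eq of_real_add of_real_mult
    by (intro trig_polys.add trig_polys.scale 1 2)
next
  case (const a)
  show ?case by (rule trig_polys_const)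
next
  case (add f g)
  then show ?case using trig_polys.add by simp
next
  case (mult f g)
  then show ?case using trig_polys_mult by simp
qed

section \<open>From characters to bounded continuous functions\<close>

lemma trig_polys_expectation_tendsto:
  assumes M: "prob_space M" and M': "prob_space M'"
    and X: "\<And>n. X n \<in> borel_measurable M" and Z: "Z \<in> borel_measurable M'"
    and char: "\<And>s. (\<lambda>n. \<integral>\<omega>. iexp (Re (s * X n \<omega>)) \<partial>M) \<longlonglongrightarrow> (\<integral>\<omega>. iexp (Re (s * Z \<omega>)) \<partial>M')"
    and f: "f \<in> trig_polys"
  shows "(\<lambda>n. \<integral>\<omega>. f (X n \<omega>) \<partial>M) \<longlonglongrightarrow> (\<integral>\<omega>. f (Z \<omega>) \<partial>M')"
proof -
  have int: "integrable M (\<lambda>\<omega>. f (X n \<omega>))" "integrable M' (\<lambda>\<omega>. f (Z \<omega>))" if fT: "f \<in> trig_polys" for f n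
  proof -
    obtain B where B: "\<And>x. norm (f x) \<le> B" and f: "f \<in> borel_measurable borel"
      using trig_polys_bounded_continuous[OF fT] by (auto intro: borel_measurable_continuous_onI)
    show "integrable M (\<lambda>\<omega>. f (X n \<omega>))" "integrable M' (\<lambda>\<omega>. f (Z \<omega>))"
      using B measurable_compose[OF X f] measurable_compose[OF Z f]
      by (auto intro!: finite_measure.integrable_const_bound[where B = B] prob_space.finite_measure M M')
  qed
  show ?thesis using f
  proof induction
    case (base s)
    show ?case by (rule char)
  next
    case (add f g)
    then show ?case using int[of f] int[of g] by (simp add: tendsto_add)
  next
    case (scale f a)
    then show ?case using int[of f] by (simp add: tendsto_mult)
  qed
qed

text \<open>Composing \<open>f\<close> with the periodic folding \<open>arcsin \<circ> sin\<close> of both coordinates turns it into a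
  continuous function of two sines, which Stone-Weierstrass approximates by trigonometric polynomials
  uniformly on the whole plane; folding changes nothing on a large square.\<close>

lemma trig_poly_approx:
  fixes f :: "complex \<Rightarrow> real"
  assumes f: "continuous_on UNIV f" and B: "\<And>x. \<bar>f x\<bar> \<le> B" and e: "e > 0" and R: "R > 0"
  obtains g where "(\<lambda>x. complex_of_real (g x)) \<in> trig_polys"
    "\<And>x. \<bar>g x\<bar> \<le> B + e" "\<And>x. norm x \<le> R \<Longrightarrow> \<bar>g x - f x\<bar> \<le> e"
proof -
  \<comment> \<open>Scaling by \<open>k\<close> maps \<open>[-R, R]\<close> onto
    \<open>[-pi/2, pi/2]\<close>, where \<open>arcsin\<close> inverts \<open>sin\<close>.\<close>
  define k where "k = pi / (2 * R)"
  have k: "k > 0" using R by (simp add: k_def)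
  define h where "h s = f (Complex (arcsin (Re s) / k) (arcsin (Im s) / k))" for s
  let ?S = "cbox (Complex (-1) (-1)) (Complex 1 1)"
  have S: "s \<in> ?S \<longleftrightarrow> \<bar>Re s\<bar> \<le> 1 \<and> \<bar>Im s\<bar> \<le> 1" for s
    by (auto simp: in_cbox_complex_iff)
  have "continuous_on ?S (\<lambda>s. Complex (arcsin (Re s) / k) (arcsin (Im s) / k))"
    using k S by (intro continuous_intros) (auto simp: abs_le_iff)
  then have "continuous_on ?S h"
    unfolding h_def by (rule continuous_on_compose2[OF f]) auto
  then obtain p where p: "real_polynomial_function p" "\<And>s. s \<in> ?S \<Longrightarrow> \<bar>h s - p s\<bar> < e"
    using Stone_Weierstrass_real_polynomial_function[of ?S h e] e by auto
  define g where "g x = p (Complex (sin (k * Re x)) (sin (k * Im x)))" for x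
  have close: "\<bar>h (Complex (sin (k * Re x)) (sin (k * Im x))) - g x\<bar> < e" for x
    unfolding g_def using S by (intro p(2)) auto
  show ?thesis
  proof (rule that[of g])
    show "(\<lambda>x. complex_of_real (g x)) \<in> trig_polys"
      unfolding g_def by (rule real_polynomial_sin_trig_polys[OF p(1)])
    show "\<bar>g x\<bar> \<le> B + e" for x
    proof -
      have "\<bar>h s\<bar> \<le> B" for s by (simp add: h_def B)
      from this[of "Complex (sin (k * Re x)) (sin (k * Im x))"] close[of x] show ?thesis by linarith
    qed
    show "\<bar>g x - f x\<bar> \<le> e" if x: "norm x \<le> R" for x
    proof -
      have "arcsin (sin (k * y)) = k * y" if "\<bar>y\<bar> \<le> R" for y
      proof (rule arcsin_sin)
        have "\<bar>k * y\<bar> \<le> k * R" using that k by (simp add: abs_mult)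
        also have "k * R = pi / 2" using R by (simp add: k_def)
        finally show "- (pi / 2) \<le> k * y" "k * y \<le> pi / 2" by auto
      qed
      moreover have "\<bar>Re x\<bar> \<le> R" "\<bar>Im x\<bar> \<le> R"
        using x abs_Re_le_cmod[of x] abs_Im_le_cmod[of x] by linarith+
      ultimately have "h (Complex (sin (k * Re x)) (sin (k * Im x))) = f x"
        using k by (simp add: h_def)
      then show ?thesis using close[of x] by simp
    qed
  qed
qed

text \<open>Off the ball the functions differ by at most \<open>2 * B + e\<close>; the summand
  \<open>e\<close> is already counted everywhere, so only \<open>2 * B\<close> meets the tail
  probability.\<close>

lemma expectation_close_on_ball:
  fixes f g :: "complex \<Rightarrow> real"
  assumes M: "prob_space M" and X: "X \<in> borel_measurable M"
    and f: "f \<in> borel_measurable borel" and g: "g \<in> borel_measurable borel"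
    and fB: "\<And>x. \<bar>f x\<bar> \<le> B" and gB: "\<And>x. \<bar>g x\<bar> \<le> B + e" and e: "e \<ge> 0"
    and close: "\<And>x. norm x \<le> R \<Longrightarrow> \<bar>g x - f x\<bar> \<le> e"
  shows "\<bar>(\<integral>\<omega>. g (X \<omega>) \<partial>M) - (\<integral>\<omega>. f (X \<omega>) \<partial>M)\<bar> \<le> e + 2 * B * measure M {\<omega>\<in>space M. norm (X \<omega>) > R}"
proof -
  interpret prob_space M by fact
  note [measurable] = X
  let ?A = "{\<omega>\<in>space M. norm (X \<omega>) > R}"
  have A: "?A \<in> sets M" by measurable
  have if': "integrable M (\<lambda>\<omega>. f (X \<omega>))"
    using fB measurable_compose[OF X f] by (intro integrable_const_bound[where B = B]) auto
  have ig: "integrable M (\<lambda>\<omega>. g (X \<omega>))"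
    using gB measurable_compose[OF X g] by (intro integrable_const_bound[where B = "B + e"]) auto
  have iA: "integrable M (\<lambda>\<omega>. indicator ?A \<omega> :: real)"
    by (rule integrable_const_bound[where B = 1]) (use A in auto)
  have "\<bar>(\<integral>\<omega>. g (X \<omega>) \<partial>M) - (\<integral>\<omega>. f (X \<omega>) \<partial>M)\<bar> = norm (\<integral>\<omega>. g (X \<omega>) - f (X \<omega>) \<partial>M)"
    using if' ig by simp
  also have "\<dots> \<le> (\<integral>\<omega>. norm (g (X \<omega>) - f (X \<omega>)) \<partial>M)" by (rule integral_norm_bound)
  also have "\<dots> \<le> (\<integral>\<omega>. e + 2 * B * indicator ?A \<omega> \<partial>M)"
  proof (rule integral_mono)
    fix \<omega> assume "\<omega> \<in> space M"
    then show "norm (g (X \<omega>) - f (X \<omega>)) \<le> e + 2 * B * indicator ?A \<omega>"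
      using close[of "X \<omega>"] fB[of "X \<omega>"] gB[of "X \<omega>"] by (cases "norm (X \<omega>) \<le> R") (auto simp: indicator_def)
  qed (use if' ig iA in auto)
  also have "\<dots> = e + 2 * B * measure M ?A"
    using iA A by (simp add: prob_space Bochner_Integration.integral_add)
  finally show ?thesis .
qed

text \<open>A test function is replaced by a trigonometric polynomial close to it on a large disc
  and still bounded outside. The mass outside is controlled by the uniform second moment for
  \<open>X n\<close>, and by continuity of measure for \<open>Z\<close>.\<close>

lemma levy_continuity_complex:
  fixes X :: "nat \<Rightarrow> 'a \<Rightarrow> complex" and Z :: "'b \<Rightarrow> complex"
  assumes M: "prob_space M" and M': "prob_space M'"
    and X: "\<And>n. X n \<in> borel_measurable M" and Z: "Z \<in> borel_measurable M'"
    and char: "\<And>s. (\<lambda>n. \<integral>\<omega>. iexp (Re (s * X n \<omega>)) \<partial>M) \<longlonglongrightarrow> (\<integral>\<omega>. iexp (Re (s * Z \<omega>)) \<partial>M')"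
    and int: "\<And>n. integrable M (\<lambda>\<omega>. (norm (X n \<omega>))\<^sup>2)"
    and tight: "\<And>n. (\<integral>\<omega>. (norm (X n \<omega>))\<^sup>2 \<partial>M) \<le> C"
  shows "converges_in_distribution M X M' Z"
  unfolding converges_in_distribution_def
proof (intro conjI allI impI X Z)
  interpret M: prob_space M by fact
  interpret M': prob_space M' by fact
  fix f :: "complex \<Rightarrow> real"
  assume f: "continuous_on UNIV f" and "bounded (range f)"
  then obtain B where B: "B > 0" "\<And>x. \<bar>f x\<bar> \<le> B" unfolding bounded_pos by auto
  have fm: "f \<in> borel_measurable borel" using f by (rule borel_measurable_continuous_onI)
  have C: "C \<ge> 0" using tight[of 0] by (rule order_trans[rotated]) simp
  note [measurable] = X Z
  have markov: "measure M {\<omega>\<in>space M. norm (X n \<omega>) > R} \<le> C / R\<^sup>2" if R: "R > 0" for n R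
  proof -
    have "measure M {\<omega>\<in>space M. norm (X n \<omega>) > R} \<le> measure M {\<omega>\<in>space M. (norm (X n \<omega>))\<^sup>2 \<ge> R\<^sup>2}"
      by (rule M.finite_measure_mono) (use R in \<open>auto intro!: power_mono\<close>)
    also have "\<dots> \<le> (\<integral>\<omega>. (norm (X n \<omega>))\<^sup>2 \<partial>M) / R\<^sup>2"
      using R by (intro integral_Markov_inequality_measure[where A = "space M"] int) auto
    also have "\<dots> \<le> C / R\<^sup>2" using tight by (intro divide_right_mono) auto
    finally show ?thesis .
  qed
  have tailZ: "(\<lambda>m. measure M' {\<omega>\<in>space M'. norm (Z \<omega>) > real m}) \<longlonglongrightarrow> 0"
  proof -
    have "(\<lambda>m. measure M' {\<omega>\<in>space M'. norm (Z \<omega>) > real m}) \<longlonglongrightarrow> measure M' (\<Inter>m. {\<omega>\<in>space M'. norm (Z \<omega>) > real m})"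
      by (rule M'.finite_Lim_measure_decseq) (auto simp: decseq_def)
    moreover have "(\<Inter>m. {\<omega>\<in>space M'. norm (Z \<omega>) > real m}) = {}"
    proof -
      have False if "\<And>m. norm (Z \<omega>) > real m" for \<omega>
        using reals_Archimedean2[of "norm (Z \<omega>)"] that less_asym by blast
      then show ?thesis by auto
    qed
    ultimately show ?thesis by simp
  qed
  show "(\<lambda>n. \<integral>\<omega>. f (X n \<omega>) \<partial>M) \<longlonglongrightarrow> (\<integral>\<omega>. f (Z \<omega>) \<partial>M')"
  proof (rule LIMSEQ_I)
    fix \<epsilon> :: real assume \<epsilon>: "\<epsilon> > 0"
    \<comment> \<open>The errors \<open>2 * e\<close> for \<open>X n\<close>, \<open>e\<close> for
      the convergence and \<open>2 * e\<close> for \<open>Z\<close> add up to \<open>5 * e\<close>,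
      below \<open>8 * e = \<epsilon>\<close>.\<close>
    define e where "e = \<epsilon> / 8"
    have e: "e > 0" using \<epsilon> by (simp add: e_def)
    have "(\<lambda>m. 2 * B * measure M' {\<omega>\<in>space M'. norm (Z \<omega>) > real m}) \<longlonglongrightarrow> 2 * B * 0"
      by (intro tendsto_intros tailZ)
    then have ev1: "\<forall>\<^sub>F m in sequentially. 2 * B * measure M' {\<omega>\<in>space M'. norm (Z \<omega>) > real m} < e"
      using e by (intro order_tendstoD) auto
    have "(\<lambda>m. 2 * B * (C / (real m)\<^sup>2)) \<longlonglongrightarrow> 0" by real_asymp
    then have ev2: "\<forall>\<^sub>F m in sequentially. 2 * B * (C / (real m)\<^sup>2) < e"
      using e by (intro order_tendstoD) auto
    obtain m where m: "m > 0" "2 * B * measure M' {\<omega>\<in>space M'. norm (Z \<omega>) > real m} < e" "2 * B * (C / (real m)\<^sup>2) < e"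
      using eventually_happens[OF eventually_conj[OF eventually_gt_at_top[of 0] eventually_conj[OF ev1 ev2]]] by auto
    obtain g where g: "(\<lambda>x. complex_of_real (g x)) \<in> trig_polys"
      "\<And>x. \<bar>g x\<bar> \<le> B + e" "\<And>x. norm x \<le> real m \<Longrightarrow> \<bar>g x - f x\<bar> \<le> e"
      using trig_poly_approx[OF f B(2) e, of "real m"] m(1) by auto
    have "continuous_on UNIV (\<lambda>x. Re (complex_of_real (g x)))"
      by (rule continuous_on_Re[OF conjunct1[OF trig_polys_bounded_continuous[OF g(1)]]])
    then have gm: "g \<in> borel_measurable borel" by (intro borel_measurable_continuous_onI) simp
    have "(\<lambda>n. Re (\<integral>\<omega>. complex_of_real (g (X n \<omega>)) \<partial>M)) \<longlonglongrightarrow> Re (\<integral>\<omega>. complex_of_real (g (Z \<omega>)) \<partial>M')"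
      by (intro tendsto_Re trig_polys_expectation_tendsto[OF M M' X Z char g(1)])
    then have "(\<lambda>n. \<integral>\<omega>. g (X n \<omega>) \<partial>M) \<longlonglongrightarrow> (\<integral>\<omega>. g (Z \<omega>) \<partial>M')" by simp
    from LIMSEQ_D[OF this e] obtain n0 where n0: "\<And>n. n \<ge> n0 \<Longrightarrow> \<bar>(\<integral>\<omega>. g (X n \<omega>) \<partial>M) - (\<integral>\<omega>. g (Z \<omega>) \<partial>M')\<bar> < e"
      by auto
    have Zc: "\<bar>(\<integral>\<omega>. g (Z \<omega>) \<partial>M') - (\<integral>\<omega>. f (Z \<omega>) \<partial>M')\<bar> < 2 * e"
    proof -
      have "\<bar>(\<integral>\<omega>. g (Z \<omega>) \<partial>M') - (\<integral>\<omega>. f (Z \<omega>) \<partial>M')\<bar> \<le> e + 2 * B * measure M' {\<omega>\<in>space M'. norm (Z \<omega>) > real m}"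
        by (rule expectation_close_on_ball[OF M' Z fm gm B(2) g(2) less_imp_le[OF e]]) (rule g(3))
      then show ?thesis using m(2) by linarith
    qed
    have Xc: "\<bar>(\<integral>\<omega>. g (X n \<omega>) \<partial>M) - (\<integral>\<omega>. f (X n \<omega>) \<partial>M)\<bar> < 2 * e" for n
    proof -
      have "2 * B * measure M {\<omega>\<in>space M. norm (X n \<omega>) > real m} \<le> 2 * B * (C / (real m)\<^sup>2)"
        using markov[of "real m" n] m(1) B(1) by (intro mult_left_mono) auto
      moreover have "\<bar>(\<integral>\<omega>. g (X n \<omega>) \<partial>M) - (\<integral>\<omega>. f (X n \<omega>) \<partial>M)\<bar> \<le> e + 2 * B * measure M {\<omega>\<in>space M. norm (X n \<omega>) > real m}"
        by (rule expectation_close_on_ball[OF M X fm gm B(2) g(2) less_imp_le[OF e]]) (rule g(3))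
      ultimately show ?thesis using m(3) by linarith
    qed
    show "\<exists>n0. \<forall>n\<ge>n0. norm ((\<integral>\<omega>. f (X n \<omega>) \<partial>M) - (\<integral>\<omega>. f (Z \<omega>) \<partial>M')) < \<epsilon>"
    proof (intro exI allI impI)
      fix n assume "n \<ge> n0"
      from n0[OF this] Xc[of n] Zc have "\<bar>(\<integral>\<omega>. f (X n \<omega>) \<partial>M) - (\<integral>\<omega>. f (Z \<omega>) \<partial>M')\<bar> < 5 * e" by linarith
      then show "norm ((\<integral>\<omega>. f (X n \<omega>) \<partial>M) - (\<integral>\<omega>. f (Z \<omega>) \<partial>M')) < \<epsilon>" using \<epsilon> by (simp add: e_def)
    qed
  qed
qed

section \<open>The fluctuation theorem\<close>

lemma (in prob_space) expectation_iexp_normal: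
  assumes X: "distributed M lborel X (normal_density 0 (sqrt v))" and v: "v > 0"
  shows "(\<integral>\<omega>. iexp (a * X \<omega>) \<partial>M) = of_real (exp (- a\<^sup>2 * v / 2))"
proof -
  have sv: "sqrt v > 0" using v by simp
  define Y where "Y \<omega> = X \<omega> / sqrt v" for \<omega>
  have Y: "distributed M lborel Y std_normal_density"
    using X normal_standard_normal_convert[OF sv, of X 0] by (simp add: Y_def[abs_def])
  have Ym: "Y \<in> measurable M lborel" using Y by (rule distributed_measurable)
  have im: "(\<lambda>y::real. iexp (a * sqrt v * y)) \<in> borel_measurable lborel" by measurable
  have "(\<integral>\<omega>. iexp (a * X \<omega>) \<partial>M) = (\<integral>\<omega>. iexp (a * sqrt v * Y \<omega>) \<partial>M)"
    using sv by (simp add: Y_def)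
  also have "\<dots> = (\<integral>y. iexp (a * sqrt v * y) \<partial>distr M lborel Y)"
    by (rule integral_distr[OF Ym im, symmetric])
  also have "distr M lborel Y = std_normal_distribution"
    using Y by (rule distributed_distr_eq_density)
  also have "(\<integral>y. iexp (a * sqrt v * y) \<partial>std_normal_distribution) = char std_normal_distribution (a * sqrt v)"
    by (simp add: char_def)
  also have "\<dots> = of_real (exp (- a\<^sup>2 * v / 2))"
    using v by (simp add: char_std_normal_distribution power_mult_distrib)
  finally show ?thesis .
qed

lemma complex_gaussian_measurable:
  assumes "prob_space M" "complex_gaussian M Z v"
  shows "Z \<in> borel_measurable M"
proof -
  have "(\<lambda>\<omega>. Re (Z \<omega>)) \<in> borel_measurable M" "(\<lambda>\<omega>. Im (Z \<omega>)) \<in> borel_measurable M"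
    using assms prob_space.indep_var_rv1 prob_space.indep_var_rv2 unfolding complex_gaussian_def by blast+
  then show ?thesis by (simp add: borel_measurable_complex_iff)
qed

text \<open>\<open>Re (s * Z) = Re s * Re Z - Im s * Im Z\<close>; independence factors the
  expectation, and the two exponents combine to the squared modulus of \<open>s\<close>.\<close>

lemma complex_gaussian_char:
  assumes M: "prob_space M" and Z: "complex_gaussian M Z v" and v: "v > 0"
  shows "(\<integral>\<omega>. iexp (Re (s * Z \<omega>)) \<partial>M) = of_real (exp (- (norm s)\<^sup>2 / 2 * v))"
proof -
  interpret prob_space M by fact
  have Re: "distributed M lborel (\<lambda>\<omega>. Re (Z \<omega>)) (normal_density 0 (sqrt v))"
    and Im: "distributed M lborel (\<lambda>\<omega>. Im (Z \<omega>)) (normal_density 0 (sqrt v))"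
    and ind: "indep_var borel (\<lambda>\<omega>. Re (Z \<omega>)) borel (\<lambda>\<omega>. Im (Z \<omega>))"
    using Z by (auto simp: complex_gaussian_def)
  have [measurable]: "Z \<in> borel_measurable M" by (rule complex_gaussian_measurable[OF M Z])
  have "indep_var borel ((\<lambda>x. iexp (Re s * x)) \<circ> (\<lambda>\<omega>. Re (Z \<omega>))) borel ((\<lambda>x. iexp (- Im s * x)) \<circ> (\<lambda>\<omega>. Im (Z \<omega>)))"
    by (rule indep_var_compose[OF ind]) measurable
  then have ind': "indep_var borel (\<lambda>\<omega>. iexp (Re s * Re (Z \<omega>))) borel (\<lambda>\<omega>. iexp (- Im s * Im (Z \<omega>)))"
    by (simp add: o_def)
  have "(\<integral>\<omega>. iexp (Re (s * Z \<omega>)) \<partial>M) = (\<integral>\<omega>. iexp (Re s * Re (Z \<omega>)) * iexp (- Im s * Im (Z \<omega>)) \<partial>M)"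
    by (simp add: exp_add[symmetric] algebra_simps)
  also have "\<dots> = (\<integral>\<omega>. iexp (Re s * Re (Z \<omega>)) \<partial>M) * (\<integral>\<omega>. iexp (- Im s * Im (Z \<omega>)) \<partial>M)"
    by (rule indep_var_lebesgue_integral[OF ind'])
       (intro integrable_const_bound[where B = 1], auto simp del: of_real_mult of_real_minus)+
  also have "\<dots> = of_real (exp (- (Re s)\<^sup>2 * v / 2) * exp (- (- Im s)\<^sup>2 * v / 2))"
    unfolding expectation_iexp_normal[OF Re v] expectation_iexp_normal[OF Im v] by (rule of_real_mult[symmetric])
  also have "exp (- (Re s)\<^sup>2 * v / 2) * exp (- (- Im s)\<^sup>2 * v / 2) = exp (- (norm s)\<^sup>2 / 2 * v)"
    by (simp add: exp_add[symmetric] cmod_power2 field_simps)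
  finally show ?thesis .
qed

text \<open>The tip \<open>1 + \<delta>\<close> belongs to the particle and so is not a value of
  \<open>F\<close>. Its reciprocal is therefore omitted by \<open>w * exp (- l w)\<close>, which is
  \<open>1 / F (1 / w)\<close> away from the origin.\<close>

lemma particle_radius_bound:
  assumes map: "particle_map P F c" and l: "l holomorphic_on ball 0 1" "l 0 = of_real c" 
    and pos: "\<And>w. norm w < 1 \<Longrightarrow> Re (l w) \<ge> 0"
    and F: "\<And>z. norm z > 1 \<Longrightarrow> F z = z * exp (l (1 / z))"
    and \<delta>: "\<delta> > 0" "of_real (1 + \<delta>) \<in> P"
  shows "(ln (1 + \<delta>))\<^sup>2 \<le> 6 * (exp c - 1)"
proof (rule omitted_value_bound[OF l pos])
  show "ln (1 + \<delta>) > 0" using \<delta> by simp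
  fix w :: complex assume w: "norm w < 1"
  have e: "exp (- ln (1 + \<delta>)) = 1 / (1 + \<delta>)" using \<delta> by (simp add: exp_minus inverse_eq_divide)
  show "w * exp (- l w) \<noteq> of_real (exp (- ln (1 + \<delta>)))"
  proof
    assume eq: "w * exp (- l w) = of_real (exp (- ln (1 + \<delta>)))"
    have d0: "1 + \<delta> \<noteq> 0" using \<delta> by simp
    have w0: "w \<noteq> 0" using eq by auto
    then have n: "norm (1 / w) > 1" using w by (simp add: norm_divide)
    have "F (1 / w) = inverse (w * exp (- l w))" using F[OF n] w0 by (simp add: exp_minus divide_inverse)
    also have "\<dots> = of_real (1 + \<delta>)" unfolding eq e using d0 by (simp add: of_real_inverse[symmetric] inverse_eq_divide del: of_real_add)
    finally have "F (1 / w) \<in> P" using \<delta> by simp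
    moreover have "F (1 / w) \<in> - (cball 0 1 \<union> P)"
      using map n bij_betwE unfolding particle_map_def by blast
    ultimately show False by simp
  qed
qed

text \<open>Rounding changes the product by at most \<open>c n\<close>.\<close>

lemma tendsto_floor_mult:
  fixes c :: "nat \<Rightarrow> real"
  assumes c: "c \<longlonglongrightarrow> 0" "(\<lambda>n. real n * c n) \<longlonglongrightarrow> 1" and t: "t > 0"
  shows "(\<lambda>n. real (nat \<lfloor>real n * t\<rfloor>) * c n) \<longlonglongrightarrow> t"
proof -
  have "\<bar>(real (nat \<lfloor>real n * t\<rfloor>) - real n * t) * c n\<bar> \<le> \<bar>c n\<bar>" for n
  proof -
    have "real n * t \<ge> 0" using t by simp
    then have "real (nat \<lfloor>real n * t\<rfloor>) = of_int \<lfloor>real n * t\<rfloor>" by (simp add: of_nat_nat)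
    then have "\<bar>real (nat \<lfloor>real n * t\<rfloor>) - real n * t\<bar> \<le> 1" by linarith
    then show ?thesis unfolding abs_mult by (intro mult_left_le_one_le) auto
  qed
  then have "(\<lambda>n. (real (nat \<lfloor>real n * t\<rfloor>) - real n * t) * c n) \<longlonglongrightarrow> 0"
    by (intro Lim_null_comparison[OF _ tendsto_rabs_zero[OF c(1)]]) auto
  then have "(\<lambda>n. (real (nat \<lfloor>real n * t\<rfloor>) - real n * t) * c n + real n * c n * t) \<longlonglongrightarrow> 0 + 1 * t"
    by (intro tendsto_intros c)
  then show ?thesis by (simp add: algebra_simps)
qed

theorem theorem1:
  fixes P :: "nat \<Rightarrow> complex set"
    and F :: "nat \<Rightarrow> complex \<Rightarrow> complex"
    and c :: "nat \<Rightarrow> real"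
    and M :: "'a measure" and \<Theta> :: "nat \<Rightarrow> 'a \<Rightarrow> real"
    and M' :: "'b measure" and Z :: "'b \<Rightarrow> complex"
    and t a \<sigma> :: real and z :: complex
  assumes "\<And>n. particle (P n)"
    and "\<And>n. symmetric_particle (P n)"
    and "\<And>n. particle_map (P n) (F n) (c n)"
    and "\<And>n. extends_to_boundary (F n)"
    and "c \<longlonglongrightarrow> 0"
    and "(\<lambda>n. real n * c n) \<longlonglongrightarrow> 1"
    and "prob_space M"
    and "prob_space.indep_vars M (\<lambda>_. borel) \<Theta> {1..}"
    and "\<And>k. k \<ge> 1 \<Longrightarrow> distr M borel (\<Theta> k) = uniform_measure lborel {-pi..<pi}"
    and "t > 0" and "a \<in> {-pi..<pi}" and "\<sigma> > 0"
    and "z = exp (\<i> * of_real a + of_real \<sigma>)"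
    and "prob_space M'"
    and "complex_gaussian M' Z (limit_variance t \<sigma>)"
  shows "converges_in_distribution M
           (\<lambda>n \<omega>. let N = nat \<lfloor>real n * t\<rfloor> in
              of_real (1 / sqrt (c n)) *
              (log_ratio (cluster_map (F n) (\<lambda>k. \<Theta> k \<omega>) N) (real N * c n) z - of_real (real N * c n)))
           M' Z"
proof -
  interpret angle_sequence M \<Theta>
    using assms(7-9) unfolding angle_sequence_def angle_sequence_axioms_def angle_measure_def by blast
  have nz: "norm z = exp \<sigma>" unfolding assms(13) norm_exp_eq_Re by simp
  then have z1: "norm z > 1" using assms(12) by simp
  have "\<exists>l. l holomorphic_on ball 0 1 \<and> l 0 = of_real (c n) \<and> (\<forall>w. norm w < 1 \<longrightarrow> Re (l w) \<ge> 0) \<and>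
    (\<forall>z. norm z > 1 \<longrightarrow> F n z = z * exp (l (1 / z))) \<and> (\<forall>w. norm w \<ge> 1 \<longrightarrow> l w = 0)" for n
    using particle_map_log[OF assms(3)[of n]] by metis
  then obtain l where l: "\<And>n. l n holomorphic_on ball 0 1" "\<And>n. l n 0 = of_real (c n)"
    "\<And>n w. norm w < 1 \<Longrightarrow> Re (l n w) \<ge> 0" "\<And>n z. norm z > 1 \<Longrightarrow> F n z = z * exp (l n (1 / z))"
    "\<And>n w. norm w \<ge> 1 \<Longrightarrow> l n w = 0"
    by metis
  obtain \<delta> where \<delta>: "\<And>n. \<delta> n > (0::real)" "\<And>n. P n \<subseteq> cball 1 (\<delta> n)" "\<And>n. of_real (1 + \<delta> n) \<in> P n"
    using assms(2) unfolding symmetric_particle_def by metis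
  have c_pos: "c n > 0" for n using assms(3)[of n] by (simp add: particle_map_def)
  have \<delta>0: "\<delta> \<longlonglongrightarrow> 0"
  proof -
    have "(\<lambda>n. 6 * (exp (c n) - 1)) \<longlonglongrightarrow> 6 * (exp 0 - 1)" by (intro tendsto_intros assms(5))
    then have up: "(\<lambda>n. 6 * (exp (c n) - 1)) \<longlonglongrightarrow> 0" by simp
    have "(\<lambda>n. (ln (1 + \<delta> n))\<^sup>2) \<longlonglongrightarrow> 0"
      by (rule Lim_null_comparison[OF _ up])
         (use particle_radius_bound[OF assms(3) l(1,2,3,4) \<delta>(1,3)] in auto)
    from tendsto_real_sqrt[OF this] have "(\<lambda>n. ln (1 + \<delta> n)) \<longlonglongrightarrow> 0"
      by (simp add: tendsto_rabs_zero_iff)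
    then have "(\<lambda>n. exp (ln (1 + \<delta> n)) - 1) \<longlonglongrightarrow> exp 0 - 1" by (intro tendsto_intros)
    moreover have "exp (ln (1 + \<delta> n)) - 1 = \<delta> n" for n using \<delta>(1)[of n] by simp
    ultimately show ?thesis by simp
  qed
  define N where "N n = nat \<lfloor>real n * t\<rfloor>" for n
  \<comment> \<open>The relative error of \<open>log_approx\<close> with
    \<open>\<rho> = exp (- \<sigma>)\<close>.\<close>
  define \<eta> where "\<eta> n = 5 * \<delta> n / (1 - exp (- \<sigma>))\<^sup>2" for n
  interpret C: cluster_chain M \<Theta> "l n" "c n" z \<sigma> "\<eta> n" "N n" for n
  proof unfold_locales
    fix v :: complex assume v: "norm v \<le> exp (- \<sigma>)"
    show "norm (l n v - of_real (c n) - of_real (c n) * (2 * v / (1 - v))) \<le> \<eta> n * c n"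
      using log_approx[OF assms(3,1,4) l(1-4) \<delta>(1,2) v] assms(12) by (simp add: \<eta>_def)
  qed (use c_pos l nz assms(12) in auto)
  have Nc: "(\<lambda>n. real (N n) * c n) \<longlonglongrightarrow> t"
    unfolding N_def by (rule tendsto_floor_mult[OF assms(5,6,10)])
  \<comment> \<open>A convergent sequence is bounded, so one horizon \<open>T\<close> serves all
    \<open>n\<close>, both in the tightness bound and in \<open>char_error\<close>.\<close>
  then obtain T where T: "\<And>n. real (N n) * c n \<le> T"
    using convergent_imp_Bseq[OF convergentI[OF Nc]] unfolding Bseq_def by (auto simp: abs_le_iff)
  define Y where "Y n \<omega> = of_real (1 / sqrt (c n)) * (C.X n (N n) \<omega> - of_real (real (N n) * c n))" for n \<omega>
  have log_ratio: "log_ratio (cluster_map (F n) \<theta> m) (real m * c n) z = log_chain (l n) (\<lambda>i. \<theta> (m - i)) z m" for n \<theta> m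
    by (rule C.log_ratio_cluster_map[OF _ z1]) (rule l(4))
  have "(\<lambda>n \<omega>. let N = nat \<lfloor>real n * t\<rfloor> in of_real (1 / sqrt (c n)) *
      (log_ratio (cluster_map (F n) (\<lambda>k. \<Theta> k \<omega>) N) (real N * c n) z - of_real (real N * c n))) = Y"
    unfolding Let_def N_def[symmetric] Y_def C.X_def by (simp only: log_ratio)
  moreover have "converges_in_distribution M Y M' Z"
  proof (rule levy_continuity_complex[OF assms(7,14)])
    show "Y n \<in> borel_measurable M" for n
      unfolding Y_def using C.measurable_X[of "N n" n] by measurable
    show "Z \<in> borel_measurable M'" by (rule complex_gaussian_measurable[OF assms(14,15)])
    have sq: "sqrt (c n) > 0" "(sqrt (c n))\<^sup>2 = c n" for n using c_pos[of n] by auto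
    have nY: "norm (Y n \<omega>) = norm (C.X n (N n) \<omega> - of_real (real (N n) * c n)) / sqrt (c n)" for n \<omega>
      using sq[of n] by (simp add: Y_def norm_divide)
    show intY: "integrable M (\<lambda>\<omega>. (norm (Y n \<omega>))\<^sup>2)" for n
    proof (rule integrable_const_bound[where B = "(real (N n) * (C.K * c n) / sqrt (c n))\<^sup>2"])
      show "(\<lambda>\<omega>. (norm (Y n \<omega>))\<^sup>2) \<in> borel_measurable M"
        unfolding Y_def using C.measurable_X[of "N n" n] by measurable
      have "norm (Y n \<omega>) \<le> real (N n) * (C.K * c n) / sqrt (c n)" for \<omega>
        unfolding nY using C.second_moment(2)[of "N n" n \<omega>] sq[of n] by (intro divide_right_mono) auto
      then show "AE \<omega> in M. norm ((norm (Y n \<omega>))\<^sup>2) \<le> (real (N n) * (C.K * c n) / sqrt (c n))\<^sup>2"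
        by (intro AE_I2) (simp add: power_mono)
    qed
    show "(\<integral>\<omega>. (norm (Y n \<omega>))\<^sup>2 \<partial>M) \<le> T * C.K\<^sup>2" for n
    proof -
      have "(\<integral>\<omega>. (norm (Y n \<omega>))\<^sup>2 \<partial>M) = (\<integral>\<omega>. (norm (C.X n (N n) \<omega> - of_real (real (N n) * c n)))\<^sup>2 \<partial>M) / c n"
        unfolding nY power_divide sq(2) by simp
      also have "\<dots> \<le> (real (N n) * (C.K * c n)\<^sup>2) / c n"
        using C.second_moment(1)[of "N n" n] c_pos[of n] by (intro divide_right_mono) auto
      also have "\<dots> = (real (N n) * c n) * C.K\<^sup>2" using c_pos[of n] by (simp add: power2_eq_square)
      also have "\<dots> \<le> T * C.K\<^sup>2" using T by (intro mult_right_mono) auto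
      finally show ?thesis .
    qed
    show "(\<lambda>n. \<integral>\<omega>. iexp (Re (s * Y n \<omega>)) \<partial>M) \<longlonglongrightarrow> (\<integral>\<omega>. iexp (Re (s * Z \<omega>)) \<partial>M')" for s
    proof -
      define \<kappa> where "\<kappa> = (norm s)\<^sup>2"
      have "Re (s * Y n \<omega>) = Re (s * (C.X n (N n) \<omega> - of_real (real (N n) * c n))) / sqrt (c n)" for n \<omega>
      proof -
        have "s * Y n \<omega> = (s * (C.X n (N n) \<omega> - of_real (real (N n) * c n))) / of_real (sqrt (c n))"
          by (simp add: Y_def)
        then show ?thesis by (simp only: Re_divide_of_real)
      qed
      then have char: "(\<integral>\<omega>. iexp (Re (s * Y n \<omega>)) \<partial>M) = C.char_fun n s (N n)" for n
        by (simp only: C.char_fun_def)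
      \<comment> \<open>\<open>C.K\<close> and \<open>C.H\<close> depend on \<open>\<sigma>\<close>
        alone, so all constants are uniform in \<open>n\<close> and the errors vanish with
        \<open>c n\<close> and \<open>\<eta> n\<close>.\<close>
      define D where "D = \<kappa> * (2 * C.H * (1 + C.H) + \<kappa> * C.H\<^sup>2)"
      define err where "err n = real (N n) * c n * (C.char_error n s T + D * c n)" for n
      have \<eta>0: "\<eta> \<longlonglongrightarrow> 0"
      proof -
        have "(\<lambda>n. 5 * \<delta> n / (1 - exp (- \<sigma>))\<^sup>2) \<longlonglongrightarrow> 5 * 0 / (1 - exp (- \<sigma>))\<^sup>2"
          using assms(12) by (intro tendsto_intros \<delta>0) auto
        then show ?thesis by (simp add: \<eta>_def[abs_def])
      qed
      have sc: "(\<lambda>n. sqrt (c n)) \<longlonglongrightarrow> sqrt 0" by (intro tendsto_intros assms(5))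
      have "(\<lambda>n. C.char_error n s T) \<longlonglongrightarrow> (norm s * C.K) ^ 3 * sqrt 0 / 6 + (norm s)\<^sup>2 * C.K * 0 / 2
          + (norm s)\<^sup>2 * (2 * C.H * (1 + C.H)) * (sqrt 0 * (T * C.K\<^sup>2 + 1) / 2)"
        unfolding C.char_error_def by (intro tendsto_intros sc \<eta>0) auto
      then have "(\<lambda>n. C.char_error n s T) \<longlonglongrightarrow> 0" by simp
      then have "err \<longlonglongrightarrow> t * (0 + D * 0)"
        unfolding err_def by (intro tendsto_intros Nc assms(5))
      then have err0: "err \<longlonglongrightarrow> 0" by simp
      have "(\<lambda>n. \<kappa> * c n * C.H) \<longlonglongrightarrow> \<kappa> * 0 * C.H" by (intro tendsto_intros assms(5))
      \<comment> \<open>This gives the hypothesis of \<open>char_fun_approx\<close> for all large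
        \<open>n\<close>, as \<open>c n\<close> tends to 0 while \<open>C.H\<close> is
        fixed.\<close>
      then have small: "\<forall>\<^sub>F n in sequentially. \<kappa> * c n * C.H < 1" by (intro order_tendstoD) auto
      have "(\<lambda>n. C.char_fun n s (N n) - of_real (exp (- \<kappa> / 2 * limit_variance (real (N n) * c n) \<sigma>))) \<longlonglongrightarrow> 0"
      proof (rule Lim_null_comparison[OF _ err0])
        show "\<forall>\<^sub>F n in sequentially. norm (C.char_fun n s (N n) - of_real (exp (- \<kappa> / 2 * limit_variance (real (N n) * c n) \<sigma>))) \<le> err n"
          using small
        proof eventually_elim
          fix n assume "\<kappa> * c n * C.H < 1"
          then show "norm (C.char_fun n s (N n) - of_real (exp (- \<kappa> / 2 * limit_variance (real (N n) * c n) \<sigma>))) \<le> err n"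
            using C.char_fun_approx[where n = n and T = T and s = s, OF T] by (simp add: \<kappa>_def err_def D_def)
        qed
      qed
      moreover have "(\<lambda>n. complex_of_real (exp (- \<kappa> / 2 * limit_variance (real (N n) * c n) \<sigma>))) \<longlonglongrightarrow> of_real (exp (- \<kappa> / 2 * limit_variance t \<sigma>))"
      proof -
        have "isCont (\<lambda>s. limit_variance s \<sigma>) t"
          using DERIV_limit_variance[OF assms(12), of t] assms(10) by (intro DERIV_isCont) auto
        from isCont_tendsto_compose[OF this Nc] show ?thesis by (intro tendsto_intros)
      qed
      ultimately have "(\<lambda>n. C.char_fun n s (N n)) \<longlonglongrightarrow> 0 + of_real (exp (- \<kappa> / 2 * limit_variance t \<sigma>))"
        using tendsto_add by fastforce
      moreover have "limit_variance t \<sigma> > 0"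
      proof -
        have "1 - exp (- 2 * \<sigma>) > 0" "1 - exp (- 2 * \<sigma>) < 1 - exp (- 2 * (\<sigma> + t))" using assms(10,12) by auto
        then show ?thesis unfolding limit_variance_def by (intro ln_gt_zero) (simp add: less_divide_eq)
      qed
      ultimately show ?thesis
        unfolding char complex_gaussian_char[OF assms(14,15) \<open>limit_variance t \<sigma> > 0\<close>] by (simp add: \<kappa>_def)
    qed
  qed
  ultimately show ?thesis by simp
qed

end
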